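(* Let $1<p<\infty$ and let $\mu$ be a decomposable measure. The $p$-operator space structure on $L^1(\mu)$, as a subspace of the dual $p$-operator space $(\min L^\infty(\mu))^*$ via the canonical embedding $L^1(\mu)\hookrightarrow L^\infty(\mu)^*$, is the maximal structure on $L^p$, i.e. it is $\max_{L^p}L^1(\mu)$. Equivalently, the canonical embedding $\max_{L^p}L^1(\mu)\to(\min L^\infty(\mu))^*$ is a complete isometry.
   Context: Scalars are complex. $\ell^p(n)$ is $\mathbb{C}^n$ with the $\ell^p$-norm, and $\mathcal{B}(E)$ denotes the bounded operators on a Banach space $E$. A $p$-operator space is a Banach space $\mathcal{V}$ with norms on $\mathbb{M}_n(\mathcal{V})$, $n\in\mathbb{N}$ (with the norm on $\mathbb{M}_1(\mathcal{V})=\mathcal{V}$ the given one), such that $\|u\oplus v\|=\max\{\|u\|,\|v\|\}$ for $u\in\mathbb{M}_n(\mathcal{V})$, $v\in\mathbb{M}_m(\mathcal{V})$, and $\|\alpha u\beta\|\le\|\alpha\|_{\mathcal{B}(\ell^p(n))}\|u\|\,\|\beta\|_{\mathcal{B}(\ell^p(n))}$ for $u\in\mathbb{M}_n(\mathcal{V})$ and $\alpha,\beta\in\mathbb{M}_n\cong\mathcal{B}(\ell^p(n))$. For a linear map $T$, $T^{(n)}[v_{ij}]=[Tv_{ij}]$; $T$ is completely bounded if $\|T\|_{p\mathrm{cb}}=\sup_n\|T^{(n)}\|<\infty$, and a complete isometry if every $T^{(n)}$ is an isometry. $\mathcal{CB}_p(\mathcal{V},\mathcal{W})$ is the space of completely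 bounded maps with norm $\|\cdot\|_{p\mathrm{cb}}$. For a Banach space $E$ of the form $L^p(\phi)$, $\mathcal{B}(E)$ is a $p$-operator space via $\mathbb{M}_n(\mathcal{B}(E))\cong\mathcal{B}(\ell^p(n,E))$. The dual $\mathcal{V}^*$ is a $p$-operator space via $\mathbb{M}_n(\mathcal{V}^* )\cong\mathcal{CB}_p(\mathcal{V},\mathcal{B}(\ell^p(n)))$, $[f_{ij}]\mapsto(v\mapsto[f_{ij}(v)])$. For a Banach space $\mathcal{X}$, $\min\mathcal{X}$ is the $p$-operator space with norms $\|[x_{ij}]\|=\sup\{\|[\varphi(x_{ij})]\|_{\mathcal{B}(\ell^p(n))}:\varphi\in\mathcal{X}^*,\ \|\varphi\|\le1\}$ (i.e. $\mathbb{M}_n(\min\mathcal{X})\cong\mathcal{X}\otimes^\lambda\mathcal{B}(\ell^p(n))$, the injective tensor product), and $\max_{L^p}\mathcal{X}$ is the $p$-operator space with norms $\|x\|_{\max_{L^p}}=\sup\{\|\pi^{(n)}(x)\|:\pi:\mathcal{X}\to\mathcal{B}(L^p(\phi))\text{ a linear contraction},\ \phi\text{ a measure}\}$ for $x\in\mathbb{M}_n(\mathcal{X})$. A measure $\mu$ is decomposable if $\mu=\sum_{\iota\in I}\mu_\iota$ with each $\mu_\iota$ finite and $\mu_\iota,\mu_{\iota'}$ mutually singular for distinct indices; this is understood as: the underlying space is partitioned into measurable sets $F_\iota$, $\iota\in I$, with $\mu(F_\iota)<\infty$, a set $A$ is measurable iff every $A\cap F_\iota$ is measurable, and $\mu(A)=\sum_\iota\mu(A\cap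 F_\iota)$ (so $\mu_\iota=\mu|_{F_\iota}$). $L^\infty(\mu)$ consists of locally essentially bounded measurable functions modulo equality locally $\mu$-a.e. (a set is locally null if its intersection with every set of finite measure is null), so that $L^1(\mu)^*\cong L^\infty(\mu)$. *)

theory Defs
  imports "HOL-Analysis.Analysis"
begin

section \<open>Complex normed spaces with explicit carriers\<close>

text \<open>The spaces \<open>L\<^sup>p(\<mu>)\<close> depend on the measure, so normed spaces are represented by
  records with explicit carrier rather than by types.\<close>

record 'v nspace =
  carr :: "'v set"
  vadd :: "'v \<Rightarrow> 'v \<Rightarrow> 'v"
  vzero :: 'v
  vscale :: "complex \<Rightarrow> 'v \<Rightarrow> 'v"
  vnorm :: "'v \<Rightarrow> real"

primrec vsum :: "('v, 'z) nspace_scheme \<Rightarrow> (nat \<Rightarrow> 'v) \<Rightarrow> nat \<Rightarrow> 'v" where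
  "vsum V f 0 = vzero V"
| "vsum V f (Suc n) = vadd V (vsum V f n) (f n)"

definition cfield :: "complex nspace" where
  "cfield = \<lparr>carr = UNIV, vadd = (+), vzero = 0, vscale = (*), vnorm = cmod\<rparr>"

definition linear_map ::
  "('v, 'y) nspace_scheme \<Rightarrow> ('w, 'z) nspace_scheme \<Rightarrow> ('v \<Rightarrow> 'w) \<Rightarrow> bool" where
  "linear_map V W T \<longleftrightarrow>
     (\<forall>x\<in>carr V. T x \<in> carr W) \<and>
     (\<forall>x\<in>carr V. \<forall>y\<in>carr V. T (vadd V x y) = vadd W (T x) (T y)) \<and>
     (\<forall>c. \<forall>x\<in>carr V. T (vscale V c x) = vscale W c (T x))"

definition linear_contraction ::
  "('v, 'y) nspace_scheme \<Rightarrow> ('w, 'z) nspace_scheme \<Rightarrow> ('v \<Rightarrow> 'w) \<Rightarrow> bool" where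
  "linear_contraction V W T \<longleftrightarrow>
     linear_map V W T \<and> (\<forall>x\<in>carr V. vnorm W (T x) \<le> vnorm V x)"

definition op_norm ::
  "('v, 'y) nspace_scheme \<Rightarrow> ('w, 'z) nspace_scheme \<Rightarrow> ('v \<Rightarrow> 'w) \<Rightarrow> ennreal" where
  "op_norm V W T = (SUP x\<in>{x \<in> carr V. vnorm V x \<le> 1}. ennreal (vnorm W (T x)))"

text \<open>Operators are taken extensional (\<open>undefined\<close> off the carrier), so that equality of
  operators is equality on the carrier.\<close>

definition bounded_ops ::
  "('v, 'y) nspace_scheme \<Rightarrow> ('w, 'z) nspace_scheme \<Rightarrow> ('v \<Rightarrow> 'w) nspace" where
  "bounded_ops V W =
     \<lparr>carr = {T \<in> extensional (carr V). linear_map V W T \<and> op_norm V W T < \<infinity>},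
      vadd = (\<lambda>S T. \<lambda>x\<in>carr V. vadd W (S x) (T x)),
      vzero = (\<lambda>x\<in>carr V. vzero W),
      vscale = (\<lambda>c T. \<lambda>x\<in>carr V. vscale W c (T x)),
      vnorm = (\<lambda>T. enn2real (op_norm V W T))\<rparr>"

abbreviation dual_space :: "('v, 'z) nspace_scheme \<Rightarrow> ('v \<Rightarrow> complex) nspace" where
  "dual_space V \<equiv> bounded_ops V cfield"


section \<open>Lebesgue spaces\<close>

definition rep :: "('a \<Rightarrow> complex) set \<Rightarrow> 'a \<Rightarrow> complex" where
  "rep A = (SOME f. f \<in> A)"

text \<open>The quotient of a function space \<open>F\<close> by an equivalence relation \<open>E\<close>; the norm \<open>N\<close> is
  given on representatives.\<close>

definition function_quotient ::
  "('a \<Rightarrow> complex) set \<Rightarrow> (('a \<Rightarrow> complex) \<times> ('a \<Rightarrow> complex)) set \<Rightarrow>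
   (('a \<Rightarrow> complex) \<Rightarrow> real) \<Rightarrow> ('a \<Rightarrow> complex) set nspace" where
  "function_quotient F E N =
     \<lparr>carr = F // E,
      vadd = (\<lambda>A B. E `` {\<lambda>t. rep A t + rep B t}),
      vzero = E `` {\<lambda>t. 0},
      vscale = (\<lambda>c A. E `` {\<lambda>t. c * rep A t}),
      vnorm = (\<lambda>A. N (rep A))\<rparr>"

definition Lp_functions :: "real \<Rightarrow> 'a measure \<Rightarrow> ('a \<Rightarrow> complex) set" where
  "Lp_functions p M =
     {f \<in> borel_measurable M. integrable M (\<lambda>t. cmod (f t) powr p)}"

definition Lp :: "real \<Rightarrow> 'a measure \<Rightarrow> ('a \<Rightarrow> complex) set nspace" where
  "Lp p M = function_quotient (Lp_functions p M)
     {(f, g) \<in> Lp_functions p M \<times> Lp_functions p M. AE t in M. f t = g t}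
     (\<lambda>f. (\<integral>t. cmod (f t) powr p \<partial>M) powr (1 / p))"

definition locally_AE :: "'a measure \<Rightarrow> ('a \<Rightarrow> bool) \<Rightarrow> bool" where
  "locally_AE M P \<longleftrightarrow>
     (\<forall>A\<in>sets M. emeasure M A < \<infinity> \<longrightarrow> (AE t in M. t \<in> A \<longrightarrow> P t))"

definition Linf_functions :: "'a measure \<Rightarrow> ('a \<Rightarrow> complex) set" where
  "Linf_functions M =
     {f \<in> borel_measurable M. \<exists>C. locally_AE M (\<lambda>t. cmod (f t) \<le> C)}"

definition Linf :: "'a measure \<Rightarrow> ('a \<Rightarrow> complex) set nspace" where
  "Linf M = function_quotient (Linf_functions M)
     {(f, g) \<in> Linf_functions M \<times> Linf_functions M. locally_AE M (\<lambda>t. f t = g t)}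
     (\<lambda>f. Inf {C. 0 \<le> C \<and> locally_AE M (\<lambda>t. cmod (f t) \<le> C)})"

text \<open>The canonical embedding of \<open>L\<^sup>1(\<mu>)\<close> into the dual of \<open>L\<^sup>\<infinity>(\<mu>)\<close>.\<close>

definition L1_embedding ::
  "'a measure \<Rightarrow> ('a \<Rightarrow> complex) set \<Rightarrow> (('a \<Rightarrow> complex) set \<Rightarrow> complex)" where
  "L1_embedding M A = (\<lambda>B\<in>carr (Linf M). \<integral>t. rep A t * rep B t \<partial>M)"

text \<open>The family of pieces is given as a set of pairwise disjoint sets; the sum of their
  measures is an unordered, possibly uncountable, sum in \<open>[0,\<infinity>]\<close>.\<close>

definition decomposable :: "'a measure \<Rightarrow> bool" where
  "decomposable M \<longleftrightarrow>
     (\<exists>\<F>. \<F> \<subseteq> sets M \<and> disjoint \<F> \<and> \<Union>\<F> = space M \<and>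
        (\<forall>F\<in>\<F>. emeasure M F < \<infinity>) \<and>
        (\<forall>A. A \<subseteq> space M \<longrightarrow> (A \<in> sets M \<longleftrightarrow> (\<forall>F\<in>\<F>. A \<inter> F \<in> sets M))) \<and>
        (\<forall>A\<in>sets M. emeasure M A = (\<Sum>\<^sub>\<infinity>F\<in>\<F>. emeasure M (A \<inter> F))))"


section \<open>Matrix norms and \<open>p\<close>-operator spaces\<close>

text \<open>An \<open>n \<times> n\<close> matrix is a function of two indices \<open>i, j < n\<close>; other entries are ignored.
  Matrix norms take values in \<open>[0,\<infinity>]\<close>, so that the suprema defining them below are meaningful
  before they are known to be finite. The record carries the data of a \<open>p\<close>-operator space; no
  space is assumed to satisfy its axioms, they are properties of the concrete structures
  constructed below.\<close>

record 'v pospace = "'v nspace" +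
  mnorm :: "nat \<Rightarrow> (nat \<Rightarrow> nat \<Rightarrow> 'v) \<Rightarrow> ennreal"

definition with_mnorm ::
  "'v nspace \<Rightarrow> (nat \<Rightarrow> (nat \<Rightarrow> nat \<Rightarrow> 'v) \<Rightarrow> ennreal) \<Rightarrow> 'v pospace" where
  "with_mnorm X N = nspace.extend X (pospace.fields N)"

definition matrices :: "nat \<Rightarrow> ('v, 'z) nspace_scheme \<Rightarrow> (nat \<Rightarrow> nat \<Rightarrow> 'v) set" where
  "matrices n V = {x. \<forall>i<n. \<forall>j<n. x i j \<in> carr V}"

definition amplify :: "('v \<Rightarrow> 'w) \<Rightarrow> (nat \<Rightarrow> nat \<Rightarrow> 'v) \<Rightarrow> nat \<Rightarrow> nat \<Rightarrow> 'w" where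
  "amplify T x = (\<lambda>i j. T (x i j))"

text \<open>\<open>ell p n E\<close> is \<open>\<ell>\<^sup>p(n, E)\<close>.\<close>

definition ell :: "real \<Rightarrow> nat \<Rightarrow> ('v, 'z) nspace_scheme \<Rightarrow> (nat \<Rightarrow> 'v) nspace" where
  "ell p n E =
     \<lparr>carr = {..<n} \<rightarrow>\<^sub>E carr E,
      vadd = (\<lambda>x y. \<lambda>i\<in>{..<n}. vadd E (x i) (y i)),
      vzero = (\<lambda>i\<in>{..<n}. vzero E),
      vscale = (\<lambda>c x. \<lambda>i\<in>{..<n}. vscale E c (x i)),
      vnorm = (\<lambda>x. (\<Sum>i<n. vnorm E (x i) powr p) powr (1 / p))\<rparr>"

definition matrix_op ::
  "real \<Rightarrow> nat \<Rightarrow> ('v, 'z) nspace_scheme \<Rightarrow> (nat \<Rightarrow> nat \<Rightarrow> 'v \<Rightarrow> 'v) \<Rightarrow>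
   (nat \<Rightarrow> 'v) \<Rightarrow> nat \<Rightarrow> 'v" where
  "matrix_op p n E T =
     (\<lambda>\<xi>\<in>carr (ell p n E). \<lambda>i\<in>{..<n}. vsum E (\<lambda>j. T i j (\<xi> j)) n)"

definition scalar_matrix_op ::
  "real \<Rightarrow> nat \<Rightarrow> (nat \<Rightarrow> nat \<Rightarrow> complex) \<Rightarrow> (nat \<Rightarrow> complex) \<Rightarrow> nat \<Rightarrow> complex" where
  "scalar_matrix_op p n a = matrix_op p n cfield (\<lambda>i j z. a i j * z)"

text \<open>\<open>\<B>(E)\<close> with the norms coming from \<open>\<M>\<^sub>n(\<B>(E)) \<cong> \<B>(\<ell>\<^sup>p(n, E))\<close>; used for
  \<open>E = L\<^sup>p(\<phi>)\<close> and \<open>E = \<ell>\<^sup>p(n)\<close>.\<close>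

definition pops :: "real \<Rightarrow> 'v nspace \<Rightarrow> ('v \<Rightarrow> 'v) pospace" where
  "pops p E = with_mnorm (bounded_ops E E)
     (\<lambda>n T. op_norm (ell p n E) (ell p n E) (matrix_op p n E T))"

definition pcb_norm :: "'v pospace \<Rightarrow> 'w pospace \<Rightarrow> ('v \<Rightarrow> 'w) \<Rightarrow> ennreal" where
  "pcb_norm V W T =
     (SUP n\<in>{1..}. SUP x\<in>{x \<in> matrices n V. mnorm V n x \<le> 1}. mnorm W n (amplify T x))"

definition complete_isometry :: "'v pospace \<Rightarrow> 'w pospace \<Rightarrow> ('v \<Rightarrow> 'w) \<Rightarrow> bool" where
  "complete_isometry V W T \<longleftrightarrow>
     linear_map V W T \<and>
     (\<forall>n\<ge>1. \<forall>x\<in>matrices n V. mnorm W n (amplify T x) = mnorm V n x)"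

definition pdual :: "real \<Rightarrow> 'v pospace \<Rightarrow> ('v \<Rightarrow> complex) pospace" where
  "pdual p V = with_mnorm (dual_space V)
     (\<lambda>n f. pcb_norm V (pops p (ell p n cfield))
              (\<lambda>v. scalar_matrix_op p n (\<lambda>i j. f i j v)))"

definition pmin :: "real \<Rightarrow> 'v nspace \<Rightarrow> 'v pospace" where
  "pmin p X = with_mnorm X
     (\<lambda>n x. SUP \<phi>\<in>{\<phi> \<in> carr (dual_space X). vnorm (dual_space X) \<phi> \<le> 1}.
        op_norm (ell p n cfield) (ell p n cfield) (scalar_matrix_op p n (amplify \<phi> x)))"

text \<open>HOL has no quantification over all measure spaces inside a term, so the type \<open>'b\<close> of the
  points of the spaces carrying \<open>\<phi>\<close> is a parameter; the measure \<open>\<phi>\<close> (with its underlying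
  set and \<open>\<sigma>\<close>-algebra) is arbitrary. A statement for all infinite \<open>'b\<close> covers all measures, as
  those on a finite type are carried over to any infinite type.\<close>

definition pmax :: "'b itself \<Rightarrow> real \<Rightarrow> 'v nspace \<Rightarrow> 'v pospace" where
  "pmax _ p X = with_mnorm X
     (\<lambda>n x. SUP (\<phi>, \<pi>)\<in>{(\<phi> :: 'b measure, \<pi>).
                  linear_contraction X (bounded_ops (Lp p \<phi>) (Lp p \<phi>)) \<pi>}.
        mnorm (pops p (Lp p \<phi>)) n (amplify \<pi> x))"

text \<open>The structure on \<open>X\<close> as a subspace of \<open>W\<close> via an embedding \<open>J\<close>.\<close>

definition subspace_structure :: "'v nspace \<Rightarrow> ('v \<Rightarrow> 'w) \<Rightarrow> 'w pospace \<Rightarrow> 'v pospace" where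
  "subspace_structure X J W = with_mnorm X (\<lambda>n x. mnorm W n (amplify J x))"

end

theory Submission
  imports Defs
begin

text \<open>
  Write \<open>x = [x\<^sub>i\<^sub>j]\<close> for a matrix over \<open>L\<^sup>1(\<mu>)\<close>. Its norm in \<open>(min L\<^sup>\<infinity>(\<mu>))\<^sup>*\<close> (the dual norm)
  and its norm in \<open>max L\<^sup>1(\<mu>)\<close> (the maximal norm) are both suprema of norms of operators obtained
  from \<open>x\<close>, and each is bounded by the other.

  \<^emph>\<open>The dual norm is at most the maximal norm.\<close> Let \<open>v\<close> be an \<open>m \<times> m\<close> matrix over \<open>L\<^sup>\<infinity>(\<mu>)\<close> of minimal
  norm at most 1. Every \<open>g\<close> in the unit ball of \<open>L\<^sup>1(\<mu>)\<close> is a contractive functional on \<open>L\<^sup>\<infinity>(\<mu>)\<close>, so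
  by the definition of the minimal norm the scalar matrix \<open>[\<langle>g, v\<^sub>k\<^sub>l\<rangle>]\<close> is a contraction of \<open>\<ell>\<^sup>p(m)\<close>
  (\<open>L1_pairing_lp_bounded\<close>). Hence \<open>g \<mapsto> [\<langle>g, v\<^sub>k\<^sub>l\<rangle>]\<close> is a linear contraction from \<open>L\<^sup>1(\<mu>)\<close> to
  \<open>\<B>(\<ell>\<^sup>p(m))\<close>, and \<open>\<ell>\<^sup>p(m)\<close> is the \<open>L\<^sup>p\<close> space of \<open>m\<close> points; so it is one of the maps \<open>\<pi>\<close> that define
  the maximal norm. Its amplification at \<open>x\<close> is the matrix \<open>[\<langle>x\<^sub>i\<^sub>j, v\<^sub>k\<^sub>l\<rangle>]\<close> of the dual norm
  (\<open>dual_norm_le_max_norm\<close>).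

  \<^emph>\<open>The maximal norm is at most the dual norm.\<close> Let \<open>\<pi>\<close> be a linear contraction from \<open>L\<^sup>1(\<mu>)\<close> to
  \<open>\<B>(L\<^sup>p(\<phi>))\<close>. Finitely many vectors of \<open>L\<^sup>p(\<phi>)\<close> are almost unchanged by averaging over a suitable
  finite family of disjoint sets of finite measure (\<open>block_average_approximation\<close>). The averaging
  operator factors as \<open>\<iota> P\<close> with contractions \<open>P\<close> into and \<open>\<iota>\<close> from some \<open>\<ell>\<^sup>p(m)\<close>, so it suffices to
  bound the compression \<open>[P \<pi>(x\<^sub>i\<^sub>j) \<iota>]\<close>. Now average the functions \<open>x\<^sub>i\<^sub>j\<close> as well, over disjoint sets
  \<open>B\<^sub>r\<close>. For the averages, the compression is the pairing of \<open>x\<close> with the matrix-valued step function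
  \<open>\<Sum>\<^sub>r D\<^sub>r 1\<^bsub>B\<^sub>r\<^esub>\<close>, where \<open>D\<^sub>r\<close> is the compression of \<open>\<pi>\<close> at the normalised indicator function of
  \<open>B\<^sub>r\<close> and therefore a contraction of \<open>\<ell>\<^sup>p(m)\<close>. This step function has minimal norm at most 1: a
  contractive functional \<open>\<psi>\<close> maps it to \<open>\<Sum>\<^sub>r c\<^sub>r D\<^sub>r\<close> with \<open>c\<^sub>r = \<psi>(1\<^bsub>B\<^sub>r\<^esub>)\<close>, and \<open>\<Sum>\<^sub>r |c\<^sub>r| \<le> 1\<close> because
  the sets \<open>B\<^sub>r\<close> are disjoint (\<open>step_matrix_min_norm\<close>). So the dual norm bounds the compression of the
  averages, and the errors of both approximations tend to 0 (\<open>compression_bounded\<close>,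
  \<open>matrix_bound\<close>).
\<close>

section \<open>Convexity of powers and matrices acting on \<open>\<ell>\<^sup>p\<close>\<close>

lemma powr_above_tangent:
  fixes a t p :: real
  assumes "1 \<le> p" "0 < a" "0 \<le> t"
  shows "a powr p + p * a powr (p - 1) * (t - a) \<le> t powr p"
proof (cases "t = 0")
  case True
  have "a powr p + p * a powr (p - 1) * (0 - a) = (1 - p) * a powr p"
    using assms by (simp add: powr_diff field_simps)
  also have "\<dots> \<le> 0" using assms by (simp add: mult_nonpos_nonneg)
  finally show ?thesis using True assms by simp
next
  case False
  have "(p * a powr (p - 1)) * (t - a) \<le> t powr p - a powr p"
  proof (rule convex_on_imp_above_tangent)
    show "convex_on {0<..} (\<lambda>x::real. x powr p)" using powr_convex[OF assms(1)] .
    show "connected {0::real<..}" by simp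
    show "a \<in> interior {0<..}" using assms by (simp add: interior_open)
    show "t \<in> {0<..}" using assms False by simp
    show "((\<lambda>x. x powr p) has_real_derivative p * a powr (p - 1)) (at a within {0<..})"
      using has_real_derivative_powr[of a p] assms by (auto intro: has_field_derivative_at_within)
  qed
  then show ?thesis by simp
qed

text \<open>Jensen's inequality for weights of total mass at most 1: the missing mass can be thought of as
  placed at 0, where the power vanishes. It follows by summing the tangent inequality at the weighted mean.\<close>

lemma powr_sum_subconvex:
  fixes c y :: "'i \<Rightarrow> real"
  assumes p: "1 \<le> p" and c: "\<And>i. i \<in> I \<Longrightarrow> 0 \<le> c i" "sum c I \<le> 1"
    and y: "\<And>i. i \<in> I \<Longrightarrow> 0 \<le> y i"
  shows "(\<Sum>i\<in>I. c i * y i) powr p \<le> (\<Sum>i\<in>I. c i * y i powr p)"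
proof -
  define a where "a = (\<Sum>i\<in>I. c i * y i)"
  have a0: "0 \<le> a" unfolding a_def using c y by (intro sum_nonneg mult_nonneg_nonneg) auto
  show ?thesis
  proof (cases "a = 0")
    case True
    then show ?thesis using c by (simp add: a_def[symmetric] sum_nonneg)
  next
    case False
    with a0 have a: "0 < a" by simp
    have "a powr p \<le> a powr p * (sum c I + p * (1 - sum c I))"
    proof -
      have "1 \<le> sum c I + p * (1 - sum c I)"
        using mult_nonneg_nonneg[of "p - 1" "1 - sum c I"] p c(2) by (simp add: algebra_simps)
      then show ?thesis using mult_left_mono[of 1 "sum c I + p * (1 - sum c I)" "a powr p"] by simp
    qed
    also have "\<dots> = sum c I * a powr p + p * a powr (p - 1) * (a - sum c I * a)"
    proof -
      have "a powr (p - 1) * a = a powr p" using a by (simp add: powr_diff)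
      then have "p * a powr (p - 1) * (a - sum c I * a) = p * (1 - sum c I) * a powr p"
        by (simp add: algebra_simps flip: \<open>a powr (p - 1) * a = a powr p\<close>)
      then show ?thesis by (simp add: algebra_simps)
    qed
    also have "\<dots> = (\<Sum>i\<in>I. c i * (a powr p + p * a powr (p - 1) * (y i - a)))"
    proof -
      have "(\<Sum>i\<in>I. c i * (a powr p + p * a powr (p - 1) * (y i - a)))
          = (\<Sum>i\<in>I. c i * a powr p + p * a powr (p - 1) * (c i * y i - c i * a))"
        by (simp add: algebra_simps)
      also have "\<dots> = sum c I * a powr p + p * a powr (p - 1) * ((\<Sum>i\<in>I. c i * y i) - sum c I * a)"
        by (simp only: sum.distrib sum_subtractf sum_distrib_left[symmetric] sum_distrib_right[symmetric])
      finally show ?thesis by (simp add: a_def)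
    qed
    also have "\<dots> \<le> (\<Sum>i\<in>I. c i * y i powr p)"
      using c y a p by (intro sum_mono mult_left_mono powr_above_tangent) auto
    finally show ?thesis by (simp add: a_def)
  qed
qed

text \<open>The only limit argument for sums of \<open>p\<close>-th powers: an error that is linear in \<open>e\<close> in each summand
  disappears as \<open>e\<close> tends to 0. The approximants may depend on \<open>e\<close> in any way.\<close>

lemma sum_powr_le_by_approximation:
  fixes H K :: "'i \<Rightarrow> real"
  assumes I: "finite I" and p: "0 < p" and H: "\<And>i. i \<in> I \<Longrightarrow> 0 \<le> H i"
    and approx: "\<And>e. 0 < e \<Longrightarrow> \<exists>G. (\<forall>i\<in>I. 0 \<le> G i \<and> H i \<le> G i + e * K i) \<and> (\<Sum>i\<in>I. G i powr p) \<le> C"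
  shows "(\<Sum>i\<in>I. H i powr p) \<le> C"
proof -
  let ?F = "\<lambda>e. \<Sum>i\<in>I. (max 0 (H i - e * K i)) powr p"
  have "?F e \<le> C" if e: "0 < e" for e
  proof -
    obtain G where G: "\<forall>i\<in>I. 0 \<le> G i \<and> H i \<le> G i + e * K i" "(\<Sum>i\<in>I. G i powr p) \<le> C"
      using approx[OF e] by blast
    have "?F e \<le> (\<Sum>i\<in>I. G i powr p)"
      using G(1) p by (intro sum_mono powr_mono2) (auto simp: algebra_simps)
    then show ?thesis using G(2) by simp
  qed
  then have ev: "eventually (\<lambda>e. ?F e \<le> C) (at_right 0)"
    by (rule eventually_mono[OF eventually_at_right_less])
  have "((\<lambda>e. ?F e) \<longlongrightarrow> (\<Sum>i\<in>I. (max 0 (H i - 0 * K i)) powr p)) (at_right 0)"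
    by (intro tendsto_sum tendsto_powr' tendsto_max tendsto_intros) (use p in auto)
  moreover have "(\<Sum>i\<in>I. (max 0 (H i - 0 * K i)) powr p) = (\<Sum>i\<in>I. H i powr p)"
    using H by (intro sum.cong) auto
  ultimately have "(?F \<longlongrightarrow> (\<Sum>i\<in>I. H i powr p)) (at_right 0)" by simp
  then show ?thesis by (rule tendsto_upperbound[OF _ ev]) simp
qed

text \<open>The matrix \<open>a\<close> defines an operator from \<open>\<ell>\<^sup>p(J)\<close> to \<open>\<ell>\<^sup>p(I)\<close> of norm at most \<open>C\<close>, for \<open>C \<ge> 0\<close>. With \<open>p\<close>-th
  powers and without roots, sums over products of index sets can be rearranged freely.\<close>

definition lp_bounded ::
  "real \<Rightarrow> 'i set \<Rightarrow> 'j set \<Rightarrow> ('i \<Rightarrow> 'j \<Rightarrow> complex) \<Rightarrow> real \<Rightarrow> bool" where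
  "lp_bounded p I J a C \<longleftrightarrow>
     (\<forall>z. (\<Sum>i\<in>I. cmod (\<Sum>j\<in>J. a i j * z j) powr p) \<le> C powr p * (\<Sum>j\<in>J. cmod (z j) powr p))"

lemma lp_boundedD:
  "lp_bounded p I J a C \<Longrightarrow>
    (\<Sum>i\<in>I. cmod (\<Sum>j\<in>J. a i j * z j) powr p) \<le> C powr p * (\<Sum>j\<in>J. cmod (z j) powr p)"
  by (simp add: lp_bounded_def)

lemma lp_bounded_cong:
  assumes "\<And>i j. i \<in> I \<Longrightarrow> j \<in> J \<Longrightarrow> a i j = b i j"
  shows "lp_bounded p I J a C \<longleftrightarrow> lp_bounded p I J b C"
  unfolding lp_bounded_def using assms by (simp cong: sum.cong)

text \<open>By homogeneity; the case of a vector of norm 0 is separate because it cannot be normalised.\<close>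

lemma lp_bounded_by_unit_ball:
  assumes J: "finite J" and p: "0 < p"
    and unit: "\<And>z. (\<Sum>j\<in>J. cmod (z j) powr p) \<le> 1 \<Longrightarrow>
                 (\<Sum>i\<in>I. cmod (\<Sum>j\<in>J. a i j * z j) powr p) \<le> C powr p"
  shows "lp_bounded p I J a C"
  unfolding lp_bounded_def
proof
  fix z
  define S where "S = (\<Sum>j\<in>J. cmod (z j) powr p)"
  have S0: "0 \<le> S" unfolding S_def by (simp add: sum_nonneg)
  show "(\<Sum>i\<in>I. cmod (\<Sum>j\<in>J. a i j * z j) powr p) \<le> C powr p * (\<Sum>j\<in>J. cmod (z j) powr p)"
  proof (cases "S = 0")
    case True
    then have "\<forall>j\<in>J. z j = 0" using J by (simp add: S_def sum_nonneg_eq_0_iff)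
    then have "(\<Sum>i\<in>I. cmod (\<Sum>j\<in>J. a i j * z j) powr p) = 0" by simp
    then show ?thesis using S0 by (simp add: S_def)
  next
    case False
    with S0 have S: "0 < S" by simp
    define s where "s = S powr (- 1 / p)"
    have "s powr p = S powr (- 1)" unfolding s_def powr_powr using p by simp
    then have s: "0 < s" "s powr p = 1 / S" using S by (simp_all add: s_def powr_minus_divide)
    have "(\<Sum>j\<in>J. cmod (of_real s * z j) powr p) = s powr p * S"
      using s by (simp add: norm_mult powr_mult S_def sum_distrib_left)
    then have "(\<Sum>j\<in>J. cmod (of_real s * z j) powr p) \<le> 1" using s S by simp
    from unit[OF this] have "(\<Sum>i\<in>I. cmod (\<Sum>j\<in>J. a i j * (of_real s * z j)) powr p) \<le> C powr p" .
    also have "(\<Sum>i\<in>I. cmod (\<Sum>j\<in>J. a i j * (of_real s * z j)) powr p)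
       = (\<Sum>i\<in>I. cmod (of_real s * (\<Sum>j\<in>J. a i j * z j)) powr p)"
      by (simp only: sum_distrib_left mult.left_commute)
    also have "\<dots> = s powr p * (\<Sum>i\<in>I. cmod (\<Sum>j\<in>J. a i j * z j) powr p)"
      using s(1) by (simp add: norm_mult powr_mult flip: sum_distrib_left)
    finally show ?thesis using s S by (simp add: S_def[symmetric] divide_simps mult_ac)
  qed
qed

lemma lp_bounded_scale:
  assumes "lp_bounded p I J a C"
  shows "lp_bounded p I J (\<lambda>i j. w * a i j) (cmod w * C)"
  unfolding lp_bounded_def
proof
  fix z
  have "(\<Sum>i\<in>I. cmod (\<Sum>j\<in>J. w * a i j * z j) powr p) = (\<Sum>i\<in>I. cmod (w * (\<Sum>j\<in>J. a i j * z j)) powr p)"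
    by (simp add: sum_distrib_left mult.assoc)
  also have "\<dots> = cmod w powr p * (\<Sum>i\<in>I. cmod (\<Sum>j\<in>J. a i j * z j) powr p)"
    by (simp add: norm_mult powr_mult flip: sum_distrib_left)
  also have "\<dots> \<le> cmod w powr p * (C powr p * (\<Sum>j\<in>J. cmod (z j) powr p))"
    using lp_boundedD[OF assms] by (intro mult_left_mono) auto
  finally show "(\<Sum>i\<in>I. cmod (\<Sum>j\<in>J. w * a i j * z j) powr p) \<le> (cmod w * C) powr p * (\<Sum>j\<in>J. cmod (z j) powr p)"
    by (simp add: powr_mult mult.assoc)
qed

text \<open>For fixed finite index sets, entrywise convergence is enough to preserve a bound.\<close>

lemma lp_bounded_approx:
  assumes I: "finite I" and J: "finite J" and p: "0 < p"
    and approx: "\<And>e. 0 < e \<Longrightarrow> \<exists>b. (\<forall>i\<in>I. \<forall>j\<in>J. cmod (a i j - b i j) \<le> e) \<and> lp_bounded p I J b C"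
  shows "lp_bounded p I J a C"
  unfolding lp_bounded_def
proof
  fix z
  show "(\<Sum>i\<in>I. cmod (\<Sum>j\<in>J. a i j * z j) powr p) \<le> C powr p * (\<Sum>j\<in>J. cmod (z j) powr p)"
  proof (rule sum_powr_le_by_approximation[where K = "\<lambda>i. \<Sum>j\<in>J. cmod (z j)"])
    fix e :: real assume e: "0 < e"
    obtain b where b: "\<And>i j. i \<in> I \<Longrightarrow> j \<in> J \<Longrightarrow> cmod (a i j - b i j) \<le> e" "lp_bounded p I J b C"
      using approx[OF e] by blast
    have "cmod (\<Sum>j\<in>J. a i j * z j) \<le> cmod (\<Sum>j\<in>J. b i j * z j) + e * (\<Sum>j\<in>J. cmod (z j))" if "i \<in> I" for i
    proof -
      have "(\<Sum>j\<in>J. a i j * z j) = (\<Sum>j\<in>J. b i j * z j) + (\<Sum>j\<in>J. (a i j - b i j) * z j)"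
        by (simp add: left_diff_distrib sum_subtractf)
      moreover have "cmod (\<Sum>j\<in>J. (a i j - b i j) * z j) \<le> (\<Sum>j\<in>J. e * cmod (z j))"
        using b(1)[OF that] by (intro sum_norm_le) (auto simp: norm_mult intro!: mult_right_mono)
      ultimately show ?thesis
        by (intro ord_eq_le_trans[OF arg_cong[of _ _ cmod] norm_triangle_le]) (auto simp: sum_distrib_left)
    qed
    then show "\<exists>G. (\<forall>i\<in>I. 0 \<le> G i \<and> cmod (\<Sum>j\<in>J. a i j * z j) \<le> G i + e * (\<Sum>j\<in>J. cmod (z j))) \<and>
         (\<Sum>i\<in>I. G i powr p) \<le> C powr p * (\<Sum>j\<in>J. cmod (z j) powr p)"
      using lp_boundedD[OF b(2)] by (intro exI[of _ "\<lambda>i. cmod (\<Sum>j\<in>J. b i j * z j)"]) auto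
  qed (use I p in auto)
qed

text \<open>The triangle inequality for operator norms on \<open>\<ell>\<^sup>p\<close>, obtained from convexity of the power function.\<close>

lemma lp_bounded_subconvex:
  fixes c :: "'r \<Rightarrow> complex"
  assumes R: "finite R" and p: "1 \<le> p" and c: "(\<Sum>r\<in>R. cmod (c r)) \<le> 1"
    and M: "\<And>r. r \<in> R \<Longrightarrow> lp_bounded p I J (M r) 1"
  shows "lp_bounded p I J (\<lambda>i j. \<Sum>r\<in>R. c r * M r i j) 1"
  unfolding lp_bounded_def
proof
  fix z
  define S where "S = (\<Sum>j\<in>J. cmod (z j) powr p)"
  define y where "y r i = cmod (\<Sum>j\<in>J. M r i j * z j)" for r i
  have "(\<Sum>i\<in>I. cmod (\<Sum>j\<in>J. (\<Sum>r\<in>R. c r * M r i j) * z j) powr p)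
      \<le> (\<Sum>i\<in>I. (\<Sum>r\<in>R. cmod (c r) * y r i) powr p)"
  proof (intro sum_mono powr_mono2)
    fix i assume "i \<in> I"
    have "(\<Sum>j\<in>J. (\<Sum>r\<in>R. c r * M r i j) * z j) = (\<Sum>r\<in>R. c r * (\<Sum>j\<in>J. M r i j * z j))"
      by (simp add: sum_distrib_left sum_distrib_right mult.assoc) (rule sum.swap)
    then show "cmod (\<Sum>j\<in>J. (\<Sum>r\<in>R. c r * M r i j) * z j) \<le> (\<Sum>r\<in>R. cmod (c r) * y r i)"
      by (simp add: y_def sum_norm_le norm_mult)
  qed (use p in auto)
  also have "\<dots> \<le> (\<Sum>i\<in>I. \<Sum>r\<in>R. cmod (c r) * y r i powr p)"
    using p c by (intro sum_mono powr_sum_subconvex) (auto simp: y_def)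
  also have "\<dots> = (\<Sum>r\<in>R. cmod (c r) * (\<Sum>i\<in>I. y r i powr p))"
    by (subst sum.swap) (simp add: sum_distrib_left)
  also have "\<dots> \<le> (\<Sum>r\<in>R. cmod (c r) * S)"
    using lp_boundedD[OF M] by (intro sum_mono mult_left_mono) (auto simp: y_def S_def)
  also have "\<dots> \<le> 1 * S"
    unfolding sum_distrib_right[symmetric] using c by (intro mult_right_mono) (auto simp: S_def sum_nonneg)
  finally show "(\<Sum>i\<in>I. cmod (\<Sum>j\<in>J. (\<Sum>r\<in>R. c r * M r i j) * z j) powr p)
      \<le> 1 powr p * (\<Sum>j\<in>J. cmod (z j) powr p)" by (simp add: S_def)
qed

section \<open>Functions in \<open>L\<^sup>p\<close>\<close>

definition lp_norm :: "real \<Rightarrow> 'a measure \<Rightarrow> ('a \<Rightarrow> complex) \<Rightarrow> real" where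
  "lp_norm p M f = (\<integral>t. cmod (f t) powr p \<partial>M) powr (1 / p)"

lemma lp_norm_nonneg [simp]: "0 \<le> lp_norm p M f"
  by (simp add: lp_norm_def)

lemma lp_norm_powr: "0 < p \<Longrightarrow> lp_norm p M f powr p = (\<integral>t. cmod (f t) powr p \<partial>M)"
  by (simp add: lp_norm_def powr_powr)

lemma lp_norm_le_iff:
  assumes "0 < p" "0 \<le> c"
  shows "lp_norm p M f \<le> c \<longleftrightarrow> (\<integral>t. cmod (f t) powr p \<partial>M) \<le> c powr p"
  using assms by (metis lp_norm_nonneg lp_norm_powr powr_mono2 powr_less_mono2 not_le less_imp_le)

lemma lp_norm_cong_AE:
  assumes "f \<in> borel_measurable M" "g \<in> borel_measurable M" "AE t in M. f t = g t"
  shows "lp_norm p M f = lp_norm p M g"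
  unfolding lp_norm_def
  by (rule arg_cong[where f = "\<lambda>x. x powr (1 / p)"], rule integral_cong_AE) (use assms in auto)

lemma Lp_functions_measurable [measurable_dest]:
  "f \<in> Lp_functions p M \<Longrightarrow> f \<in> borel_measurable M"
  by (simp add: Lp_functions_def)

lemma Lp_functions_integrable:
  "f \<in> Lp_functions p M \<Longrightarrow> integrable M (\<lambda>t. cmod (f t) powr p)"
  by (simp add: Lp_functions_def)

lemma L1_functions_iff: "f \<in> Lp_functions 1 M \<longleftrightarrow> integrable M f"
  by (auto simp: Lp_functions_def integrable_norm_iff)

lemma Lp_functions_dominated:
  assumes "g \<in> Lp_functions p M" "f \<in> borel_measurable M" "0 \<le> p"
    and "\<And>t. t \<in> space M \<Longrightarrow> cmod (f t) \<le> c * cmod (g t)"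
  shows "f \<in> Lp_functions p M"
proof -
  have "integrable M (\<lambda>t. cmod (f t) powr p)"
  proof (rule Bochner_Integration.integrable_bound)
    show "integrable M (\<lambda>t. max 0 c powr p * cmod (g t) powr p)"
      using Lp_functions_integrable[OF assms(1)] by simp
    show "AE t in M. norm (cmod (f t) powr p) \<le> norm (max 0 c powr p * cmod (g t) powr p)"
    proof (rule AE_I2)
      fix t assume t: "t \<in> space M"
      have "cmod (f t) \<le> max 0 c * cmod (g t)"
        using assms(4)[OF t] mult_right_mono[of c "max 0 c" "cmod (g t)"] by simp
      then have "cmod (f t) powr p \<le> (max 0 c * cmod (g t)) powr p"
        using assms(3) by (intro powr_mono2) auto
      then show "norm (cmod (f t) powr p) \<le> norm (max 0 c powr p * cmod (g t) powr p)"
        by (simp add: powr_mult)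
    qed
  qed (use assms(2) in measurable)
  then show ?thesis using assms(2) by (simp add: Lp_functions_def)
qed

lemma Lp_functions_scale:
  "f \<in> Lp_functions p M \<Longrightarrow> (\<lambda>t. c * f t) \<in> Lp_functions p M"
  by (auto simp: Lp_functions_def norm_mult powr_mult)

lemma Lp_functions_zero [simp]: "(\<lambda>t. 0) \<in> Lp_functions p M"
  by (auto simp: Lp_functions_def)

lemma Lp_functions_add:
  assumes p: "0 \<le> p" and f: "f \<in> Lp_functions p M" and g: "g \<in> Lp_functions p M"
  shows "(\<lambda>t. f t + g t) \<in> Lp_functions p M"
proof -
  note [measurable] = Lp_functions_measurable[OF f] Lp_functions_measurable[OF g]
  have "integrable M (\<lambda>t. cmod (f t + g t) powr p)"
  proof (rule Bochner_Integration.integrable_bound)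
    show "integrable M (\<lambda>t. 2 powr p * (cmod (f t) powr p + cmod (g t) powr p))"
      using Lp_functions_integrable[OF f] Lp_functions_integrable[OF g] by auto
    show "AE t in M. norm (cmod (f t + g t) powr p) \<le> norm (2 powr p * (cmod (f t) powr p + cmod (g t) powr p))"
    proof (rule AE_I2)
      fix t
      have "cmod (f t + g t) \<le> 2 * max (cmod (f t)) (cmod (g t))"
        using norm_triangle_ineq[of "f t" "g t"] by linarith
      then have "cmod (f t + g t) powr p \<le> (2 * max (cmod (f t)) (cmod (g t))) powr p"
        using p by (intro powr_mono2) auto
      also have "\<dots> \<le> 2 powr p * (cmod (f t) powr p + cmod (g t) powr p)"
        by (simp add: powr_mult max_def)
      finally show "norm (cmod (f t + g t) powr p) \<le> norm (2 powr p * (cmod (f t) powr p + cmod (g t) powr p))"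
        by simp
    qed
  qed measurable
  then show ?thesis by (simp add: Lp_functions_def)
qed

lemma Lp_functions_diff:
  assumes "0 \<le> p" "f \<in> Lp_functions p M" "g \<in> Lp_functions p M"
  shows "(\<lambda>t. f t - g t) \<in> Lp_functions p M"
  using Lp_functions_add[OF assms(1,2) Lp_functions_scale[OF assms(3), of "-1"]] by simp

lemma Lp_functions_sum:
  assumes "0 \<le> p" "\<And>i. i \<in> I \<Longrightarrow> f i \<in> Lp_functions p M"
  shows "(\<lambda>t. \<Sum>i\<in>I. f i t) \<in> Lp_functions p M"
  using assms(2) by (induction I rule: infinite_finite_induct) (auto intro!: Lp_functions_add assms(1))

text \<open>Minkowski's inequality. If \<open>\<parallel>f\<parallel> \<le> a\<close> and \<open>\<parallel>g\<parallel> \<le> b\<close> with \<open>a, b > 0\<close>, then \<open>(f + g) / (a + b)\<close> is the convex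
  combination of \<open>f / a\<close> and \<open>g / b\<close> with weights \<open>a / (a + b)\<close> and \<open>b / (a + b)\<close>; convexity of the
  power function, integrated, gives \<open>\<parallel>f + g\<parallel> \<le> a + b\<close>.\<close>

lemma lp_norm_triangle:
  assumes p: "1 \<le> p" and f: "f \<in> Lp_functions p M" and g: "g \<in> Lp_functions p M"
  shows "lp_norm p M (\<lambda>t. f t + g t) \<le> lp_norm p M f + lp_norm p M g"
proof (rule field_le_epsilon)
  fix e :: real assume e: "0 < e"
  \<comment> \<open>Adding half of the slack to both norms keeps the divisors positive.\<close>
  define a where "a = lp_norm p M f + e / 2"
  define b where "b = lp_norm p M g + e / 2"
  have a: "0 < a" and b: "0 < b"
    using e by (auto simp: a_def b_def intro!: add_nonneg_pos)
  have fa: "(\<integral>t. cmod (f t) powr p \<partial>M) \<le> a powr p"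
    using lp_norm_le_iff[of p a M f] a e p by (simp add: a_def)
  have gb: "(\<integral>t. cmod (g t) powr p \<partial>M) \<le> b powr p"
    using lp_norm_le_iff[of p b M g] b e p by (simp add: b_def)
  let ?u = "a / (a + b)" and ?v = "b / (a + b)"
  note fi = Lp_functions_integrable[OF f] and gi = Lp_functions_integrable[OF g]
  have pw: "cmod (f t + g t) powr p
     \<le> (a + b) powr p * (?u * (cmod (f t) powr p / a powr p) + ?v * (cmod (g t) powr p / b powr p))" for t
  proof -
    have "cmod (f t + g t) \<le> (a + b) * (?u * (cmod (f t) / a) + ?v * (cmod (g t) / b))"
    proof -
      have "(a + b) * (?u * (x / a)) = x" "(a + b) * (?v * (x / b)) = x" for x
        using a b by (simp_all add: add_pos_pos less_imp_neq[symmetric])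
      then show ?thesis using norm_triangle_ineq[of "f t" "g t"] by (simp add: distrib_left)
    qed
    then have "cmod (f t + g t) powr p \<le> ((a + b) * (?u * (cmod (f t) / a) + ?v * (cmod (g t) / b))) powr p"
      using p by (intro powr_mono2) auto
    also have "\<dots> = (a + b) powr p * (?u * (cmod (f t) / a) + ?v * (cmod (g t) / b)) powr p"
      by (rule powr_mult)
    also have "(?u * (cmod (f t) / a) + ?v * (cmod (g t) / b)) powr p
       \<le> ?u * (cmod (f t) / a) powr p + ?v * (cmod (g t) / b) powr p"
      using powr_sum_subconvex[OF p, of "{True, False}" "\<lambda>i. if i then ?u else ?v"
          "\<lambda>i. if i then cmod (f t) / a else cmod (g t) / b"] a b
      by (simp add: add_divide_distrib[symmetric])
    finally show ?thesis using a b by (simp add: powr_divide mult_left_mono)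
  qed
  have "(\<integral>t. cmod (f t + g t) powr p \<partial>M) \<le>
     (\<integral>t. (a + b) powr p * (?u * (cmod (f t) powr p / a powr p) + ?v * (cmod (g t) powr p / b powr p)) \<partial>M)"
    using Lp_functions_integrable[OF Lp_functions_add[OF _ f g]] p fi gi pw
    by (intro integral_mono) auto
  also have "\<dots> = (a + b) powr p * (?u * ((\<integral>t. cmod (f t) powr p \<partial>M) / a powr p) + ?v * ((\<integral>t. cmod (g t) powr p \<partial>M) / b powr p))"
    using fi gi by (simp add: integral_add)
  also have "\<dots> \<le> (a + b) powr p * (?u * 1 + ?v * 1)"
    using a b fa gb by (intro mult_left_mono add_mono) (auto simp: divide_le_eq)
  also have "\<dots> = (a + b) powr p" using a b by (simp add: add_divide_distrib[symmetric])
  finally have "lp_norm p M (\<lambda>t. f t + g t) \<le> a + b"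
    using a b p by (simp add: lp_norm_le_iff)
  then show "lp_norm p M (\<lambda>t. f t + g t) \<le> lp_norm p M f + lp_norm p M g + e"
    by (simp add: a_def b_def)
qed

lemma lp_norm_scale:
  assumes "0 < p" shows "lp_norm p M (\<lambda>t. c * f t) = cmod c * lp_norm p M f"
  using assms by (simp add: lp_norm_def norm_mult powr_mult powr_powr)

lemma lp_norm_sum:
  assumes p: "1 \<le> p" and I: "finite I" and f: "\<And>i. i \<in> I \<Longrightarrow> f i \<in> Lp_functions p M"
  shows "lp_norm p M (\<lambda>t. \<Sum>i\<in>I. f i t) \<le> (\<Sum>i\<in>I. lp_norm p M (f i))"
  using I f
proof (induction I)
  case empty
  then show ?case by (simp add: lp_norm_def)
next
  case (insert i I)
  have "(\<lambda>t. \<Sum>i\<in>I. f i t) \<in> Lp_functions p M" using insert p by (intro Lp_functions_sum) auto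
  then have "lp_norm p M (\<lambda>t. f i t + (\<Sum>i\<in>I. f i t)) \<le> lp_norm p M (f i) + lp_norm p M (\<lambda>t. \<Sum>i\<in>I. f i t)"
    using insert by (intro lp_norm_triangle[OF p]) auto
  then show ?case using insert by force
qed

lemma lp_norm_triangle_le:
  assumes p: "1 \<le> p" and f: "f \<in> Lp_functions p M" and g: "g \<in> Lp_functions p M"
  shows "lp_norm p M f \<le> lp_norm p M g + lp_norm p M (\<lambda>t. f t - g t)"
  using lp_norm_triangle[OF p g Lp_functions_diff[OF _ f g]] p by simp

text \<open>Simple functions converge to \<open>f\<close> pointwise and are bounded by \<open>2 |f|\<close>, so dominated convergence with
  the dominating function \<open>(3 |f|)\<^sup>p\<close> applies.\<close>

lemma Lp_simple_approximation:
  assumes p: "1 \<le> p" and f: "f \<in> Lp_functions p M" and e: "0 < e"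
  obtains G where "simple_function M G" "G \<in> Lp_functions p M" "lp_norm p M (\<lambda>t. f t - G t) \<le> e"
proof -
  note [measurable] = Lp_functions_measurable[OF f]
  obtain s where s: "\<And>i. simple_function M (s i)" "\<And>x. x \<in> space M \<Longrightarrow> (\<lambda>i. s i x) \<longlonglongrightarrow> f x"
    "\<And>i x. x \<in> space M \<Longrightarrow> cmod (s i x) \<le> 2 * cmod (f x)"
    using borel_measurable_implies_sequence_metric[OF Lp_functions_measurable[OF f], of 0]
    unfolding norm_conv_dist by metis
  have sm [measurable]: "s i \<in> borel_measurable M" for i using s(1) by (rule borel_measurable_simple_function)
  have sL: "s i \<in> Lp_functions p M" for i
    using Lp_functions_dominated[OF f sm _ s(3)] p by simp
  have "(\<lambda>i. \<integral>t. cmod (f t - s i t) powr p \<partial>M) \<longlonglongrightarrow> (\<integral>t. 0 \<partial>M)"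
  proof (rule integral_dominated_convergence)
    show "integrable M (\<lambda>t. 3 powr p * cmod (f t) powr p)" using Lp_functions_integrable[OF f] by simp
    show "AE t in M. (\<lambda>i. cmod (f t - s i t) powr p) \<longlonglongrightarrow> 0"
    proof (rule AE_I2)
      fix t assume t: "t \<in> space M"
      have "(\<lambda>i. cmod (f t - s i t) powr p) \<longlonglongrightarrow> cmod (f t - f t) powr p"
        by (intro tendsto_powr' tendsto_intros s(2) t) (use p in auto)
      then show "(\<lambda>i. cmod (f t - s i t) powr p) \<longlonglongrightarrow> 0" by simp
    qed
    show "AE t in M. norm (cmod (f t - s i t) powr p) \<le> 3 powr p * cmod (f t) powr p" for i
    proof (rule AE_I2)
      fix t assume t: "t \<in> space M"
      have "cmod (f t - s i t) \<le> 3 * cmod (f t)"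
        using s(3)[OF t, of i] norm_triangle_ineq4[of "f t" "s i t"] by linarith
      then have "cmod (f t - s i t) powr p \<le> (3 * cmod (f t)) powr p" using p by (intro powr_mono2) auto
      then show "norm (cmod (f t - s i t) powr p) \<le> 3 powr p * cmod (f t) powr p" by (simp add: powr_mult)
    qed
  qed measurable
  then have "eventually (\<lambda>i. (\<integral>t. cmod (f t - s i t) powr p \<partial>M) < e powr p) sequentially"
    using e by (intro order_tendstoD) auto
  then obtain i where "(\<integral>t. cmod (f t - s i t) powr p \<partial>M) < e powr p"
    by (auto simp: eventually_sequentially)
  then have "lp_norm p M (\<lambda>t. f t - s i t) \<le> e" using e p by (simp add: lp_norm_le_iff)
  then show ?thesis using that s(1) sL by blast
qed

section \<open>Averaging over finitely many disjoint sets\<close>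

definition finite_blocks :: "'a measure \<Rightarrow> nat \<Rightarrow> (nat \<Rightarrow> 'a set) \<Rightarrow> bool" where
  "finite_blocks M R B \<longleftrightarrow>
     (\<forall>r<R. B r \<in> sets M \<and> emeasure M (B r) < \<infinity>) \<and> disjoint_family_on B {..<R}"

lemma finite_blocksD:
  assumes "finite_blocks M R B" "r < R"
  shows "B r \<in> sets M" "emeasure M (B r) < \<infinity>" "emeasure M (B r) = ennreal (measure M (B r))"
  using assms by (auto simp: finite_blocks_def emeasure_eq_ennreal_measure less_top)

lemma finite_blocks_sum:
  fixes c :: "nat \<Rightarrow> 'b::comm_ring_1"
  assumes "finite_blocks M R B" "t \<in> B r" "r < R"
  shows "(\<Sum>s<R. c s * indicator (B s) t) = c r"
proof -
  have "(\<Sum>s<R. c s * indicator (B s) t) = (\<Sum>s<R. if s = r then c r else 0)"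
    using assms by (intro sum.cong) (auto simp: finite_blocks_def disjoint_family_on_def indicator_def)
  then show ?thesis using assms by simp
qed

lemma finite_blocks_sum_outside:
  fixes c :: "nat \<Rightarrow> 'b::comm_ring_1"
  assumes "\<And>r. r < R \<Longrightarrow> t \<notin> B r"
  shows "(\<Sum>s<R. c s * indicator (B s) t) = 0"
  using assms by (intro sum.neutral) auto

text \<open>The vectors \<open>\<mu>(A)\<^bsup>-1/p\<^esup> 1\<^sub>A\<close>, for the sets \<open>A\<close> of a finite disjoint family, span a copy of \<open>\<ell>\<^sup>p\<close> in
  \<open>L\<^sup>p(\<mu>)\<close>, and the coefficients \<open>\<mu>(A)\<^bsup>1/p - 1\<^esup> \<integral>\<^sub>A f\<close> are the coordinates of the projection of \<open>f\<close> onto it.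
  If \<open>\<mu>(A) = 0\<close>, both expressions are 0, since 0 to any real power is 0 for \<open>powr\<close>; so null sets
  need no exception.\<close>

definition block_coef :: "real \<Rightarrow> 'a measure \<Rightarrow> 'a set \<Rightarrow> ('a \<Rightarrow> complex) \<Rightarrow> complex" where
  "block_coef p M A f = of_real (measure M A powr (1 / p - 1)) * (\<integral>t. f t * indicator A t \<partial>M)"

definition block_vec :: "real \<Rightarrow> 'a measure \<Rightarrow> 'a set \<Rightarrow> 'a \<Rightarrow> complex" where
  "block_vec p M A t = of_real (measure M A powr (- 1 / p)) * indicator A t"

lemma Lp_functions_integrable_on_finite:
  assumes p: "1 \<le> p" and f: "f \<in> Lp_functions p M" and A: "A \<in> sets M" "emeasure M A < \<infinity>"
  shows "integrable M (\<lambda>t. f t * indicator A t)"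
proof (rule Bochner_Integration.integrable_bound)
  show "integrable M (\<lambda>t. indicator A t + cmod (f t) powr p)"
    using Lp_functions_integrable[OF f] A by auto
  show "AE t in M. norm (f t * indicator A t) \<le> norm (indicator A t + cmod (f t) powr p)"
  proof (rule AE_I2)
    fix t
    have "cmod (f t) \<le> 1 + cmod (f t) powr p"
    proof (cases "cmod (f t) \<le> 1")
      case False
      then show ?thesis using powr_mono[of 1 p "cmod (f t)"] p by simp
    qed (simp add: add_increasing2)
    then show "norm (f t * indicator A t) \<le> norm (indicator A t + cmod (f t) powr p)"
      by (auto simp: indicator_def)
  qed
qed (use Lp_functions_measurable[OF f] A in measurable)

text \<open>With \<open>a\<close> the mean of \<open>|f|\<close> over \<open>A\<close>, the left-hand side is at most \<open>a\<^sup>p \<mu>(A)\<close>. Integrating over \<open>A\<close> the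
  tangent inequality at \<open>a\<close> gives the bound: its linear term integrates to 0.\<close>

lemma block_coef_powr_le:
  assumes p: "1 \<le> p" and f: "f \<in> Lp_functions p M" and A: "A \<in> sets M" "emeasure M A < \<infinity>"
  shows "cmod (block_coef p M A f) powr p \<le> (\<integral>t. cmod (f t) powr p * indicator A t \<partial>M)"
proof -
  define m where "m = measure M A"
  define I where "I = (\<integral>t. cmod (f t) * indicator A t \<partial>M)"
  have norm_ind: "cmod (indicator A t) = indicator A t" for t by (simp add: indicator_def)
  have fi: "integrable M (\<lambda>t. cmod (f t) * indicator A t)"
    using integrable_norm[OF Lp_functions_integrable_on_finite[OF assms]] by (simp add: norm_mult norm_ind)
  have I: "cmod (\<integral>t. f t * indicator A t \<partial>M) \<le> I"
    unfolding I_def by (rule order_trans[OF integral_norm_bound]) (simp add: norm_mult norm_ind)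
  have I0: "0 \<le> I" unfolding I_def by (simp add: integral_nonneg_AE)
  have m0: "0 \<le> m" by (simp add: m_def)
  have pi: "integrable M (\<lambda>t. cmod (f t) powr p * indicator A t)"
    using integrable_mult_indicator[OF A(1) Lp_functions_integrable[OF f]] by (simp add: mult.commute)
  have "cmod (block_coef p M A f) \<le> m powr (1 / p - 1) * I"
    using I by (simp add: block_coef_def norm_mult m_def mult_left_mono)
  then have *: "cmod (block_coef p M A f) powr p \<le> (m powr (1 / p - 1) * I) powr p"
    using p by (intro powr_mono2) auto
  show ?thesis
  proof (cases "m = 0 \<or> I = 0")
    case True
    then have "(m powr (1 / p - 1) * I) powr p = 0" by auto
    with * show ?thesis by (simp add: integral_nonneg_AE order_trans)
  next
    case False
    then have m: "0 < m" and Ip: "0 < I" using m0 I0 by auto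
    define a where "a = I / m"
    have a: "0 < a" using m Ip by (simp add: a_def)
    have "(m powr (1 / p - 1) * I) powr p = a powr p * m"
    proof -
      have "I = a * m" using m by (simp add: a_def)
      then have "m powr (1 / p - 1) * I = a * m powr (1 / p)" using m by (simp add: powr_diff)
      then show ?thesis using p m by (simp add: powr_mult powr_powr)
    qed
    also have "\<dots> = (\<integral>t. a powr p * indicator A t + p * a powr (p - 1) * (cmod (f t) * indicator A t - a * indicator A t) \<partial>M)"
      using fi A m by (simp add: I_def[symmetric] m_def[symmetric] a_def)
    also have "\<dots> \<le> (\<integral>t. cmod (f t) powr p * indicator A t \<partial>M)"
    proof (rule integral_mono)
      show "integrable M (\<lambda>t. a powr p * indicator A t + p * a powr (p - 1) * (cmod (f t) * indicator A t - a * indicator A t))"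
        using fi A by auto
      show "integrable M (\<lambda>t. cmod (f t) powr p * indicator A t)" by (rule pi)
      show "a powr p * indicator A t + p * a powr (p - 1) * (cmod (f t) * indicator A t - a * indicator A t)
          \<le> cmod (f t) powr p * indicator A t" for t
        using powr_above_tangent[OF p a, of "cmod (f t)"] by (simp add: indicator_def)
    qed
    finally show ?thesis using * by simp
  qed
qed

text \<open>The map from \<open>L\<^sup>p\<close> to the coordinates in \<open>\<ell>\<^sup>p\<close> is a contraction.\<close>

lemma block_coef_contraction:
  assumes p: "1 \<le> p" and B: "finite_blocks M R B" and f: "f \<in> Lp_functions p M"
  shows "(\<Sum>r<R. cmod (block_coef p M (B r) f) powr p) \<le> (\<integral>t. cmod (f t) powr p \<partial>M)"
proof -
  have pi: "integrable M (\<lambda>t. cmod (f t) powr p * indicator (B r) t)" if "r < R" for r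
    using integrable_mult_indicator[OF finite_blocksD(1)[OF B that] Lp_functions_integrable[OF f]]
    by (simp add: mult.commute)
  have "(\<Sum>r<R. cmod (block_coef p M (B r) f) powr p)
      \<le> (\<Sum>r<R. \<integral>t. cmod (f t) powr p * indicator (B r) t \<partial>M)"
    using finite_blocksD[OF B] by (intro sum_mono block_coef_powr_le[OF p f]) auto
  also have "\<dots> = (\<integral>t. (\<Sum>r<R. cmod (f t) powr p * indicator (B r) t) \<partial>M)"
    using pi by (subst Bochner_Integration.integral_sum) auto
  also have "\<dots> \<le> (\<integral>t. cmod (f t) powr p \<partial>M)"
  proof (rule integral_mono)
    show "(\<Sum>r<R. cmod (f t) powr p * indicator (B r) t) \<le> cmod (f t) powr p" for t
    proof (cases "\<exists>r<R. t \<in> B r")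
      case True
      then obtain r where r: "r < R" "t \<in> B r" by blast
      show ?thesis unfolding finite_blocks_sum[OF B r(2,1)] ..
    next
      case False
      then show ?thesis by (subst finite_blocks_sum_outside) auto
    qed
    show "integrable M (\<lambda>t. \<Sum>r<R. cmod (f t) powr p * indicator (B r) t)"
      using pi by (intro Bochner_Integration.integrable_sum) auto
  qed (rule Lp_functions_integrable[OF f])
  finally show ?thesis .
qed

lemma block_vec_combination_powr:
  assumes p: "0 < p" and B: "finite_blocks M R B"
  shows "cmod (\<Sum>r<R. z r * block_vec p M (B r) t) powr p
     = (\<Sum>r<R. (cmod (z r) powr p * (measure M (B r) powr (- 1 / p)) powr p) * indicator (B r) t)"
proof -
  have *: "(\<Sum>r<R. z r * block_vec p M (B r) t)
    = (\<Sum>r<R. (z r * of_real (measure M (B r) powr (- 1 / p))) * indicator (B r) t)"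
    by (simp add: block_vec_def mult.assoc)
  show ?thesis
  proof (cases "\<exists>r<R. t \<in> B r")
    case True
    then obtain r where r: "r < R" "t \<in> B r" by blast
    show ?thesis unfolding * finite_blocks_sum[OF B r(2,1)] by (simp add: norm_mult powr_mult)
  next
    case False
    then show ?thesis unfolding * by (simp add: finite_blocks_sum_outside)
  qed
qed

text \<open>The map from \<open>\<ell>\<^sup>p\<close> into \<open>L\<^sup>p\<close> is isometric on the coordinates of non-null sets and vanishes on the
  others.\<close>

lemma block_vec_combination:
  assumes p: "0 < p" and B: "finite_blocks M R B"
  shows "(\<lambda>t. \<Sum>r<R. z r * block_vec p M (B r) t) \<in> Lp_functions p M"
    and "(\<integral>t. cmod (\<Sum>r<R. z r * block_vec p M (B r) t) powr p \<partial>M) \<le> (\<Sum>r<R. cmod (z r) powr p)"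
proof -
  have int: "integrable M (\<lambda>t. (cmod (z r) powr p * (measure M (B r) powr (- 1 / p)) powr p) * indicator (B r) t)"
    if "r < R" for r
    using finite_blocksD[OF B that] by auto
  have "(\<lambda>t. \<Sum>r<R. z r * block_vec p M (B r) t) \<in> borel_measurable M"
    using finite_blocksD(1)[OF B] unfolding block_vec_def
    by (intro borel_measurable_sum borel_measurable_times borel_measurable_const borel_measurable_indicator) auto
  then show "(\<lambda>t. \<Sum>r<R. z r * block_vec p M (B r) t) \<in> Lp_functions p M"
    unfolding Lp_functions_def mem_Collect_eq block_vec_combination_powr[OF p B]
    using int by (intro conjI Bochner_Integration.integrable_sum) (assumption | simp only: lessThan_iff)+
  have "(\<integral>t. cmod (\<Sum>r<R. z r * block_vec p M (B r) t) powr p \<partial>M)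
     = (\<Sum>r<R. (cmod (z r) powr p * (measure M (B r) powr (- 1 / p)) powr p) * measure M (B r))"
    unfolding block_vec_combination_powr[OF p B]
    using int finite_blocksD[OF B] by (subst Bochner_Integration.integral_sum) auto
  also have "\<dots> \<le> (\<Sum>r<R. cmod (z r) powr p)"
  proof (rule sum_mono)
    fix r assume "r \<in> {..<R}"
    have "(measure M (B r) powr (- 1 / p)) powr p = measure M (B r) powr (- 1)"
      unfolding powr_powr using p by simp
    then have "(measure M (B r) powr (- 1 / p)) powr p * measure M (B r) \<le> 1"
      by (cases "measure M (B r) = 0") (simp_all add: powr_minus)
    then show "(cmod (z r) powr p * (measure M (B r) powr (- 1 / p)) powr p) * measure M (B r) \<le> cmod (z r) powr p"
      using mult_left_mono[of _ 1 "cmod (z r) powr p"] by (simp add: mult.assoc)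
  qed
  finally show "(\<integral>t. cmod (\<Sum>r<R. z r * block_vec p M (B r) t) powr p \<partial>M) \<le> (\<Sum>r<R. cmod (z r) powr p)" .
qed

lemma block_coef_cong_AE:
  assumes "f \<in> borel_measurable M" "g \<in> borel_measurable M" "AE t in M. f t = g t" "A \<in> sets M"
  shows "block_coef p M A f = block_coef p M A g"
proof -
  have "(\<integral>t. f t * indicator A t \<partial>M) = (\<integral>t. g t * indicator A t \<partial>M)"
    by (rule integral_cong_AE) (use assms in auto)
  then show ?thesis by (simp add: block_coef_def)
qed

lemma block_coef_sum:
  assumes p: "1 \<le> p" and A: "A \<in> sets M" "emeasure M A < \<infinity>"
    and f: "\<And>i. i \<in> I \<Longrightarrow> f i \<in> Lp_functions p M"
  shows "block_coef p M A (\<lambda>t. \<Sum>i\<in>I. c i * f i t) = (\<Sum>i\<in>I. c i * block_coef p M A (f i))"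
proof -
  have "(\<integral>t. (\<Sum>i\<in>I. c i * f i t) * indicator A t \<partial>M) = (\<integral>t. (\<Sum>i\<in>I. c i * (f i t * indicator A t)) \<partial>M)"
    by (simp add: sum_distrib_right mult.assoc)
  also have "\<dots> = (\<Sum>i\<in>I. c i * (\<integral>t. f i t * indicator A t \<partial>M))"
    using Lp_functions_integrable_on_finite[OF p f A]
    by (subst Bochner_Integration.integral_sum) auto
  finally show ?thesis by (simp add: block_coef_def sum_distrib_left mult.left_commute)
qed

lemma block_coef_le_lp_norm:
  assumes p: "1 \<le> p" and B: "finite_blocks M R B" and f: "f \<in> Lp_functions p M" and r: "r < R"
  shows "cmod (block_coef p M (B r) f) \<le> lp_norm p M f"
proof -
  have "cmod (block_coef p M (B r) f) powr p \<le> (\<Sum>r<R. cmod (block_coef p M (B r) f) powr p)"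
    using r by (intro member_le_sum) auto
  also have "\<dots> \<le> (\<integral>t. cmod (f t) powr p \<partial>M)" by (rule block_coef_contraction[OF p B f])
  also have "\<dots> = lp_norm p M f powr p" using p by (simp add: lp_norm_powr)
  finally show ?thesis using p
    by (metis (no_types) lp_norm_nonneg not_le powr_less_mono2 less_le_trans zero_less_one)
qed

lemma lp_norm_block_vec:
  assumes p: "0 < p" and A: "A \<in> sets M" "emeasure M A < \<infinity>"
  shows "block_vec p M A \<in> Lp_functions p M" "lp_norm p M (block_vec p M A) \<le> 1"
proof -
  have "finite_blocks M 1 (\<lambda>_. A)" using A by (simp add: finite_blocks_def disjoint_family_on_def)
  from block_vec_combination[OF p this, of "\<lambda>_. 1"] p
  show "block_vec p M A \<in> Lp_functions p M" "lp_norm p M (block_vec p M A) \<le> 1"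
    by (simp_all add: lp_norm_le_iff)
qed

lemma block_coef_1:
  assumes A: "A \<in> sets M" "emeasure M A < \<infinity>"
  shows "block_coef 1 M A f = (\<integral>t. f t * indicator A t \<partial>M)"
proof (cases "measure M A = 0")
  case True
  then have "A \<in> null_sets M" using A by (auto simp: null_sets_def emeasure_eq_ennreal_measure less_top)
  then have "AE t in M. f t * indicator A t = 0" by (rule AE_mp[OF AE_not_in]) simp
  then have "(\<integral>t. f t * indicator A t \<partial>M) = 0" by (rule integral_eq_zero_AE)
  then show ?thesis by (simp add: block_coef_def)
qed (simp add: block_coef_def)

text \<open>The conditional expectation of \<open>f\<close> on the sets \<open>B r\<close>, extended by 0 outside their union. It is the
  composition of the two contractions between \<open>L\<^sup>p\<close> and \<open>\<ell>\<^sup>p\<close>; it does not depend on \<open>p\<close>.\<close>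

definition block_average ::
  "real \<Rightarrow> 'a measure \<Rightarrow> nat \<Rightarrow> (nat \<Rightarrow> 'a set) \<Rightarrow> ('a \<Rightarrow> complex) \<Rightarrow> 'a \<Rightarrow> complex" where
  "block_average p M R B f t = (\<Sum>r<R. block_coef p M (B r) f * block_vec p M (B r) t)"

lemma block_average_in_Lp:
  assumes "1 \<le> p" "finite_blocks M R B"
  shows "block_average p M R B f \<in> Lp_functions p M"
  using block_vec_combination(1)[of p M R B "\<lambda>r. block_coef p M (B r) f"] assms
  by (simp add: block_average_def[abs_def])

lemma lp_norm_block_average_powr:
  assumes p: "1 \<le> p" and B: "finite_blocks M R B"
  shows "lp_norm p M (block_average p M R B f) powr p \<le> (\<Sum>r<R. cmod (block_coef p M (B r) f) powr p)"
  using block_vec_combination(2)[of p M R B "\<lambda>r. block_coef p M (B r) f"] p B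
  by (simp add: lp_norm_powr block_average_def)

lemma lp_norm_block_average:
  assumes p: "1 \<le> p" and B: "finite_blocks M R B" and f: "f \<in> Lp_functions p M"
  shows "lp_norm p M (block_average p M R B f) \<le> lp_norm p M f"
proof -
  have "lp_norm p M (block_average p M R B f) powr p \<le> (\<integral>t. cmod (f t) powr p \<partial>M)"
    by (rule order_trans[OF lp_norm_block_average_powr[OF p B] block_coef_contraction[OF p B f]])
  then show ?thesis using p by (subst lp_norm_le_iff) (auto simp: lp_norm_powr)
qed

lemma block_average_diff:
  assumes p: "1 \<le> p" and B: "finite_blocks M R B"
    and f: "f \<in> Lp_functions p M" and g: "g \<in> Lp_functions p M"
  shows "block_average p M R B (\<lambda>t. f t - g t) t = block_average p M R B f t - block_average p M R B g t"
proof -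
  have "block_coef p M (B r) (\<lambda>t. f t - g t) = block_coef p M (B r) f - block_coef p M (B r) g" if "r < R" for r
    using block_coef_sum[OF p finite_blocksD(1,2)[OF B that], of "{True, False}" "\<lambda>i. if i then f else g" "\<lambda>i. if i then 1 else - 1"]
      f g by simp
  then show ?thesis by (simp add: block_average_def left_diff_distrib sum_subtractf)
qed

lemma block_average_step:
  assumes p: "1 \<le> p" and B: "finite_blocks M R B"
  shows "AE t in M. block_average p M R B (\<lambda>t. \<Sum>r<R. c r * indicator (B r) t) t
           = (\<Sum>r<R. c r * indicator (B r) t)"
proof -
  let ?G = "\<lambda>t. \<Sum>r<R. c r * indicator (B r) t"
  have coef: "block_coef p M (B r) ?G = of_real (measure M (B r) powr (1 / p - 1)) * (c r * of_real (measure M (B r)))"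
    if r: "r < R" for r
  proof -
    have "(\<integral>t. ?G t * indicator (B r) t \<partial>M) = (\<integral>t. indicator (B r) t *\<^sub>R c r \<partial>M)"
      using finite_blocks_sum[OF B _ r, of _ c] by (intro Bochner_Integration.integral_cong) (auto simp: indicator_def)
    also have "\<dots> = c r * of_real (measure M (B r))"
      using finite_blocksD[OF B r] by (simp add: integral_scaleR_left scaleR_conv_of_real mult.commute)
    finally show ?thesis by (simp add: block_coef_def)
  qed
  have null: "AE t in M. \<forall>r\<in>{..<R}. measure M (B r) = 0 \<longrightarrow> t \<notin> B r"
  proof (rule AE_finite_allI)
    fix r assume "r \<in> {..<R}"
    then have r: "r < R" by simp
    show "AE t in M. measure M (B r) = 0 \<longrightarrow> t \<notin> B r"
    proof (cases "measure M (B r) = 0")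
      case True
      then have "B r \<in> null_sets M" using finite_blocksD[OF B r] by (auto simp: null_sets_def)
      then show ?thesis using AE_not_in by auto
    qed simp
  qed simp
  show ?thesis using null
  proof eventually_elim
    case (elim t)
    have "block_coef p M (B r) ?G * block_vec p M (B r) t = c r * indicator (B r) t" if r: "r < R" for r
    proof (cases "t \<in> B r")
      case True
      then have m: "0 < measure M (B r)" using elim r by (metis lessThan_iff measure_nonneg order_le_less)
      have "measure M (B r) powr (1 / p - 1) * measure M (B r) * measure M (B r) powr (- 1 / p) = 1"
        using m by (simp add: powr_diff powr_minus_divide)
      then have "complex_of_real (measure M (B r) powr (1 / p - 1)) * of_real (measure M (B r)) * of_real (measure M (B r) powr (- 1 / p)) = 1"
        by (metis of_real_1 of_real_mult)
      moreover have "block_coef p M (B r) ?G * block_vec p M (B r) t = c r * (complex_of_real (measure M (B r) powr (1 / p - 1))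
          * of_real (measure M (B r)) * of_real (measure M (B r) powr (- 1 / p)))"
        unfolding coef[OF r] using True by (simp add: block_vec_def)
      ultimately show ?thesis using True by simp
    qed (simp add: block_vec_def)
    then show ?case unfolding block_average_def by (intro sum.cong) auto
  qed
qed

text \<open>The sets are the fibres of the joint value map \<open>t \<mapsto> (G s t)\<^bsub>s \<in> S\<^esub>\<close> over the nonzero tuples. On such a
  fibre some \<open>G s\<close> has a constant nonzero value, so integrability forces the fibre to have finite
  measure.\<close>

lemma finite_simple_family_blocks:
  assumes p: "0 < p" and S: "finite S"
    and G: "\<And>s. s \<in> S \<Longrightarrow> simple_function M (G s)" "\<And>s. s \<in> S \<Longrightarrow> G s \<in> Lp_functions p M"
  obtains R B c where "1 \<le> R" "finite_blocks M R B"
    "\<And>s t. s \<in> S \<Longrightarrow> t \<in> space M \<Longrightarrow> G s t = (\<Sum>r<R. c s r * indicator (B r) t)"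
proof -
  define \<tau> where "\<tau> t = (\<lambda>s\<in>S. G s t)" for t
  define V where "V = {v \<in> \<tau> ` space M. \<exists>s\<in>S. v s \<noteq> 0}"
  have "\<tau> ` space M \<subseteq> (\<Pi>\<^sub>E s\<in>S. G s ` space M)" by (auto simp: \<tau>_def)
  then have "finite (\<tau> ` space M)"
    by (rule finite_subset) (use S G in \<open>auto intro!: finite_PiE simp: simple_function_def\<close>)
  then have "finite V" by (simp add: V_def)
  then obtain h where h: "bij_betw h {0..<card V} V" using ex_bij_betw_nat_finite by blast
  \<comment> \<open>One additional empty set ensures that the family is nonempty.\<close>
  define R where "R = Suc (card V)"
  define B where "B r = (if r < card V then {t\<in>space M. \<tau> t = h r} else {})" for r
  have Bm: "B r \<in> sets M \<and> emeasure M (B r) < \<infinity>" for r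
  proof (cases "r < card V")
    case True
    then have hr: "h r \<in> V" using h by (auto simp: bij_betw_def)
    then have "h r \<in> extensional S" by (auto simp: V_def \<tau>_def)
    then have eq: "{t\<in>space M. \<tau> t = h r} = {t\<in>space M. \<forall>s\<in>S. G s t = h r s}"
      by (auto simp: \<tau>_def fun_eq_iff extensional_def)
    have "{t\<in>space M. \<forall>s\<in>S. G s t = h r s} \<in> sets M"
      using S G(2)[THEN Lp_functions_measurable] by (intro sets.sets_Collect_finite_All) auto
    moreover from hr obtain s where s: "s \<in> S" "h r s \<noteq> 0" by (auto simp: V_def)
    have Gs: "G s \<in> borel_measurable M" using G(2)[OF s(1)] by (rule Lp_functions_measurable)
    have "emeasure M {t\<in>space M. \<forall>s\<in>S. G s t = h r s} \<le> emeasure M {t\<in>space M. cmod (G s t) powr p \<ge> cmod (h r s) powr p}"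
      using s Gs by (intro emeasure_mono) auto
    moreover have "emeasure M {t\<in>space M. cmod (G s t) powr p \<ge> cmod (h r s) powr p} < \<infinity>"
    proof -
      have "emeasure M {t\<in>space M. cmod (G s t) powr p \<ge> cmod (h r s) powr p}
         \<le> 1 / cmod (h r s) powr p * (\<integral>t. cmod (G s t) powr p \<partial>M)"
        using Lp_functions_integrable[OF G(2)[OF s(1)]] s by (intro integral_Markov_inequality) auto
      then show ?thesis by (rule order_le_less_trans) simp
    qed
    ultimately show ?thesis using True by (simp add: B_def eq)
  qed (simp add: B_def)
  have "disjoint_family_on B {..<R}"
    using h by (auto simp: disjoint_family_on_def B_def bij_betw_def inj_on_def split: if_splits)
  with Bm have B: "finite_blocks M R B" by (simp add: finite_blocks_def)
  have "G s t = (\<Sum>r<R. h r s * indicator (B r) t)" if s: "s \<in> S" and t: "t \<in> space M" for s t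
  proof (cases "\<tau> t \<in> V")
    case True
    then obtain r where r: "r < card V" "h r = \<tau> t" using h by (auto simp: bij_betw_def image_iff) (metis atLeastLessThan_iff imageE)
    then have "t \<in> B r" "r < R" using t by (auto simp: B_def R_def)
    from finite_blocks_sum[OF B this] have "(\<Sum>r<R. h r s * indicator (B r) t) = h r s" .
    then show ?thesis using r s unfolding \<tau>_def by (metis restrict_apply')
  next
    case False
    then have "G s t = 0" using s t by (auto simp: V_def \<tau>_def)
    moreover have "(\<Sum>r<R. h r s * indicator (B r) t) = 0"
      using False h t by (intro finite_blocks_sum_outside) (auto simp: B_def bij_betw_def)
    ultimately show ?thesis by metis
  qed
  then show ?thesis using that[of R B "\<lambda>s r. h r s"] B by (simp add: R_def)
qed

text \<open>Averaging is a contraction that fixes the step functions on the blocks, so it moves every \<open>f s\<close> by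
  at most twice the distance of \<open>f s\<close> from a simple function. This needs one family of blocks adapted
  to simple approximations of all the functions \<open>f s\<close>.\<close>

lemma block_average_approximation:
  assumes p: "1 \<le> p" and S: "finite S" and f: "\<And>s. s \<in> S \<Longrightarrow> f s \<in> Lp_functions p M" and e: "0 < e"
  obtains R B where "1 \<le> R" "finite_blocks M R B"
    "\<And>s. s \<in> S \<Longrightarrow> lp_norm p M (\<lambda>t. f s t - block_average p M R B (f s) t) \<le> e"
proof -
  have "\<exists>G. simple_function M G \<and> G \<in> Lp_functions p M \<and> lp_norm p M (\<lambda>t. f s t - G t) \<le> e / 2" if "s \<in> S" for s
    using Lp_simple_approximation[OF p f[OF that], of "e / 2"] e by (metis half_gt_zero)
  then obtain G where G: "\<And>s. s \<in> S \<Longrightarrow> simple_function M (G s)" "\<And>s. s \<in> S \<Longrightarrow> G s \<in> Lp_functions p M"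
    "\<And>s. s \<in> S \<Longrightarrow> lp_norm p M (\<lambda>t. f s t - G s t) \<le> e / 2" by metis
  have p0: "0 < p" using p by simp
  obtain R B c where R: "1 \<le> R" and B: "finite_blocks M R B"
    and c: "\<And>s t. s \<in> S \<Longrightarrow> t \<in> space M \<Longrightarrow> G s t = (\<Sum>r<R. c s r * indicator (B r) t)"
    using finite_simple_family_blocks[where G = G, OF p0 S] G(1,2) by blast
  have "lp_norm p M (\<lambda>t. f s t - block_average p M R B (f s) t) \<le> e" if s: "s \<in> S" for s
  proof -
    let ?A = "block_average p M R B"
    note fs = f[OF s] and Gs = G(2)[OF s]
    have d: "(\<lambda>t. f s t - G s t) \<in> Lp_functions p M" using p fs Gs by (intro Lp_functions_diff) auto
    have "block_coef p M (B r) (G s) = block_coef p M (B r) (\<lambda>t. \<Sum>r<R. c s r * indicator (B r) t)" for r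
      using c[OF s] by (auto simp: block_coef_def intro!: Bochner_Integration.integral_cong)
    then have "?A (G s) = ?A (\<lambda>t. \<Sum>r<R. c s r * indicator (B r) t)"
      by (simp add: block_average_def fun_eq_iff)
    then have AE: "AE t in M. ?A (G s) t = G s t"
      using block_average_step[OF p B, of "c s"] c[OF s] by (auto elim: AE_mp intro!: AE_I2)
    have "lp_norm p M (\<lambda>t. f s t - ?A (f s) t)
       = lp_norm p M (\<lambda>t. (f s t - G s t) + (- 1) * ?A (\<lambda>t. f s t - G s t) t)"
    proof (rule lp_norm_cong_AE)
      show "AE t in M. f s t - ?A (f s) t = (f s t - G s t) + (- 1) * ?A (\<lambda>t. f s t - G s t) t"
        using AE by eventually_elim (simp add: block_average_diff[OF p B fs Gs])
    qed (use fs Gs block_average_in_Lp[OF p B] in \<open>auto intro!: borel_measurable_diff borel_measurable_add borel_measurable_uminus Lp_functions_measurable\<close>)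
    also have "\<dots> \<le> lp_norm p M (\<lambda>t. f s t - G s t) + lp_norm p M (\<lambda>t. (- 1) * ?A (\<lambda>t. f s t - G s t) t)"
      by (intro lp_norm_triangle[OF p] d Lp_functions_scale block_average_in_Lp[OF p B])
    also have "\<dots> \<le> e / 2 + e / 2"
      unfolding lp_norm_scale[OF p0] using G(3)[OF s] lp_norm_block_average[OF p B d] by simp
    finally show ?thesis by simp
  qed
  then show ?thesis using that R B by blast
qed

section \<open>Quotients of function spaces\<close>

lemma linear_mapD:
  assumes "linear_map V W T"
  shows "x \<in> carr V \<Longrightarrow> T x \<in> carr W"
    and "x \<in> carr V \<Longrightarrow> y \<in> carr V \<Longrightarrow> T (vadd V x y) = vadd W (T x) (T y)"
    and "x \<in> carr V \<Longrightarrow> T (vscale V c x) = vscale W c (T x)"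
  using assms by (simp_all add: linear_map_def)

lemma vsum_cong: "(\<And>l. l < m \<Longrightarrow> f l = g l) \<Longrightarrow> vsum W f m = vsum W g m"
  by (induction m) auto

definition fun_eq_rel ::
  "('a \<Rightarrow> complex) set \<Rightarrow> (('a \<Rightarrow> bool) \<Rightarrow> bool) \<Rightarrow> (('a \<Rightarrow> complex) \<times> ('a \<Rightarrow> complex)) set" where
  "fun_eq_rel F Q = {(f, g) \<in> F \<times> F. Q (\<lambda>t. f t = g t)}"

text \<open>The common part of \<open>L\<^sup>p(\<mu>)\<close> and \<open>L\<^sup>\<infinity>(\<mu>)\<close>: \<open>Q\<close> is the notion of "almost everywhere", once with respect
  to null sets and once with respect to locally null sets.\<close>

locale function_class_space =
  fixes F :: "('a \<Rightarrow> complex) set" and Q :: "('a \<Rightarrow> bool) \<Rightarrow> bool"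
    and N :: "('a \<Rightarrow> complex) \<Rightarrow> real" and V :: "('a \<Rightarrow> complex) set nspace"
  assumes V: "V = function_quotient F (fun_eq_rel F Q) N"
    and zero_mem: "(\<lambda>t. 0) \<in> F"
    and add_mem: "\<And>f g. f \<in> F \<Longrightarrow> g \<in> F \<Longrightarrow> (\<lambda>t. f t + g t) \<in> F"
    and scale_mem: "\<And>c f. f \<in> F \<Longrightarrow> (\<lambda>t. c * f t) \<in> F"
    and Q_all: "\<And>P. (\<And>t. P t) \<Longrightarrow> Q P"
    and Q_mono2: "\<And>P P' P''. Q P \<Longrightarrow> Q P' \<Longrightarrow> (\<And>t. P t \<Longrightarrow> P' t \<Longrightarrow> P'' t) \<Longrightarrow> Q P''"
    and N_cong: "\<And>f g. f \<in> F \<Longrightarrow> g \<in> F \<Longrightarrow> Q (\<lambda>t. f t = g t) \<Longrightarrow> N f = N g"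
begin

definition cls :: "('a \<Rightarrow> complex) \<Rightarrow> ('a \<Rightarrow> complex) set" where
  "cls f = fun_eq_rel F Q `` {f}"

lemma Q_mono: "Q P \<Longrightarrow> (\<And>t. P t \<Longrightarrow> P' t) \<Longrightarrow> Q P'"
  using Q_mono2[of P P] by blast

lemma equiv_rel: "equiv F (fun_eq_rel F Q)"
proof (intro equivI refl_onI symI transI)
  show "fun_eq_rel F Q \<subseteq> F \<times> F" by (auto simp: fun_eq_rel_def)
  show "(f, f) \<in> fun_eq_rel F Q" if "f \<in> F" for f
    using that by (simp add: fun_eq_rel_def Q_all)
  show "(g, f) \<in> fun_eq_rel F Q" if "(f, g) \<in> fun_eq_rel F Q" for f g
    using that by (simp add: fun_eq_rel_def eq_commute)
  show "(f, h) \<in> fun_eq_rel F Q" if "(f, g) \<in> fun_eq_rel F Q" "(g, h) \<in> fun_eq_rel F Q" for f g h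
    using that Q_mono2[of "\<lambda>t. f t = g t" "\<lambda>t. g t = h t" "\<lambda>t. f t = h t"] by (simp add: fun_eq_rel_def)
qed

lemma carr_V: "carr V = F // fun_eq_rel F Q"
  by (simp add: V function_quotient_def)

lemma cls_carr: "f \<in> F \<Longrightarrow> cls f \<in> carr V"
  by (simp add: carr_V cls_def quotientI)

lemma cls_eq_iff: "f \<in> F \<Longrightarrow> g \<in> F \<Longrightarrow> cls f = cls g \<longleftrightarrow> Q (\<lambda>t. f t = g t)"
  using eq_equiv_class_iff[OF equiv_rel, of f g] by (simp add: cls_def fun_eq_rel_def)

lemma rep_cls:
  assumes "f \<in> F"
  shows "rep (cls f) \<in> F" "Q (\<lambda>t. rep (cls f) t = f t)"
proof -
  have "f \<in> cls f" using assms equiv_class_self[OF equiv_rel] by (simp add: cls_def)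
  then have "rep (cls f) \<in> cls f" unfolding rep_def by (rule someI[of "\<lambda>g. g \<in> cls f"])
  then have "(f, rep (cls f)) \<in> fun_eq_rel F Q" by (subst (asm) (2) cls_def) simp
  then have "rep (cls f) \<in> F \<and> Q (\<lambda>t. f t = rep (cls f) t)" by (simp add: fun_eq_rel_def)
  then show "rep (cls f) \<in> F" "Q (\<lambda>t. rep (cls f) t = f t)" by (simp_all add: eq_commute)
qed

lemma carrE:
  assumes "A \<in> carr V" obtains f where "f \<in> F" "A = cls f"
  using assms by (auto simp: carr_V cls_def elim: quotientE)

lemma rep_carr:
  assumes "A \<in> carr V"
  shows "rep A \<in> F" "cls (rep A) = A"
proof -
  obtain f where f: "f \<in> F" "A = cls f" using assms by (rule carrE)
  then show "rep A \<in> F" "cls (rep A) = A" using rep_cls[OF f(1)] by (simp_all add: cls_eq_iff)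
qed

lemma vadd_eq: "vadd V A B = cls (\<lambda>t. rep A t + rep B t)"
  by (simp add: V function_quotient_def cls_def)

lemma vscale_eq: "vscale V c A = cls (\<lambda>t. c * rep A t)"
  by (simp add: V function_quotient_def cls_def)

lemma vadd_cls:
  assumes "f \<in> F" "g \<in> F"
  shows "vadd V (cls f) (cls g) = cls (\<lambda>t. f t + g t)"
proof -
  have "vadd V (cls f) (cls g) = cls (\<lambda>t. rep (cls f) t + rep (cls g) t)"
    by (rule vadd_eq)
  also have "\<dots> = cls (\<lambda>t. f t + g t)"
    using rep_cls[OF assms(1)] rep_cls[OF assms(2)] assms
      Q_mono2[of "\<lambda>t. rep (cls f) t = f t" "\<lambda>t. rep (cls g) t = g t" "\<lambda>t. rep (cls f) t + rep (cls g) t = f t + g t"]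
    by (subst cls_eq_iff) (simp_all add: add_mem)
  finally show ?thesis .
qed

lemma vscale_cls:
  assumes "f \<in> F"
  shows "vscale V c (cls f) = cls (\<lambda>t. c * f t)"
proof -
  have "vscale V c (cls f) = cls (\<lambda>t. c * rep (cls f) t)"
    by (rule vscale_eq)
  also have "\<dots> = cls (\<lambda>t. c * f t)"
    using rep_cls[OF assms] assms Q_mono[of "\<lambda>t. rep (cls f) t = f t" "\<lambda>t. c * rep (cls f) t = c * f t"]
    by (subst cls_eq_iff) (simp_all add: scale_mem)
  finally show ?thesis .
qed

lemma rep_vadd:
  assumes "A \<in> carr V" "B \<in> carr V"
  shows "Q (\<lambda>t. rep (vadd V A B) t = rep A t + rep B t)"
  using rep_cls(2)[of "\<lambda>t. rep A t + rep B t"] assms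
  by (simp add: vadd_eq rep_carr add_mem)

lemma rep_vscale:
  assumes "A \<in> carr V"
  shows "Q (\<lambda>t. rep (vscale V c A) t = c * rep A t)"
  using rep_cls(2)[of "\<lambda>t. c * rep A t"] assms
  by (simp add: vscale_eq rep_carr scale_mem)

lemma vzero_cls: "vzero V = cls (\<lambda>t. 0)"
  by (simp add: V function_quotient_def cls_def)

lemma vnorm_carr: "vnorm V A = N (rep A)"
  by (simp add: V function_quotient_def)

lemma vnorm_cls: "f \<in> F \<Longrightarrow> vnorm V (cls f) = N f"
  using N_cong[OF rep_cls(1) _ rep_cls(2)] by (simp add: vnorm_carr)

lemma vadd_carr: "A \<in> carr V \<Longrightarrow> B \<in> carr V \<Longrightarrow> vadd V A B \<in> carr V"
  by (erule carrE, erule carrE) (simp add: vadd_cls cls_carr add_mem)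

lemma vscale_carr: "A \<in> carr V \<Longrightarrow> vscale V c A \<in> carr V"
  by (erule carrE) (simp add: vscale_cls cls_carr scale_mem)

lemma vscale_0: "A \<in> carr V \<Longrightarrow> vscale V 0 A = vzero V"
  by (erule carrE) (simp add: vscale_cls vzero_cls)

lemma sum_mem: "(\<And>l. l < m \<Longrightarrow> f l \<in> F) \<Longrightarrow> (\<lambda>t. \<Sum>l<m. f l t) \<in> F"
  for m :: nat
  by (induction m) (auto simp: zero_mem intro!: add_mem)

lemma vsum_cls:
  "(\<And>l. l < m \<Longrightarrow> f l \<in> F) \<Longrightarrow> vsum V (\<lambda>l. cls (f l)) m = cls (\<lambda>t. \<Sum>l<m. f l t)"
  by (induction m) (auto simp: vzero_cls vadd_cls sum_mem)

lemma vsum_carr: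
  assumes "\<And>l. l < m \<Longrightarrow> A l \<in> carr V"
  shows "vsum V A m = cls (\<lambda>t. \<Sum>l<m. rep (A l) t)"
proof -
  have "vsum V A m = vsum V (\<lambda>l. cls (rep (A l))) m"
    using assms rep_carr by (intro vsum_cong) auto
  then show ?thesis using assms rep_carr by (simp add: vsum_cls)
qed

lemma linear_map_combination:
  fixes m :: nat
  assumes T: "linear_map V W T" and W0: "\<And>y. y \<in> carr W \<Longrightarrow> vscale W 0 y = vzero W"
    and f: "\<And>l. l < m \<Longrightarrow> f l \<in> F"
  shows "T (cls (\<lambda>t. \<Sum>l<m. z l * f l t)) = vsum W (\<lambda>l. vscale W (z l) (T (cls (f l)))) m"
  using f
proof (induction m)
  case 0
  have "T (cls (\<lambda>t. 0)) = T (vscale V 0 (cls (\<lambda>t. 0)))" by (simp add: vscale_cls zero_mem)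
  also have "\<dots> = vzero W" using W0 by (simp add: linear_mapD[OF T] cls_carr zero_mem)
  finally show ?case by simp
next
  case (Suc m)
  have mem: "(\<lambda>t. \<Sum>l<m. z l * f l t) \<in> F" "f m \<in> F"
    using Suc.prems by (auto intro!: sum_mem scale_mem)
  have "T (cls (\<lambda>t. (\<Sum>l<m. z l * f l t) + z m * f m t))
      = T (vadd V (cls (\<lambda>t. \<Sum>l<m. z l * f l t)) (vscale V (z m) (cls (f m))))"
    using mem by (simp add: vadd_cls vscale_cls scale_mem)
  also have "\<dots> = vadd W (T (cls (\<lambda>t. \<Sum>l<m. z l * f l t))) (vscale W (z m) (T (cls (f m))))"
    using mem by (simp add: linear_mapD[OF T] cls_carr vscale_carr)
  finally show ?case using Suc by simp
qed

end

lemma function_class_space_Lp: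
  assumes "1 \<le> p"
  shows "function_class_space (Lp_functions p M) (\<lambda>P. AE t in M. P t) (lp_norm p M) (Lp p M)"
proof
  show "Lp p M = function_quotient (Lp_functions p M) (fun_eq_rel (Lp_functions p M) (\<lambda>P. AE t in M. P t)) (lp_norm p M)"
    by (simp add: Lp_def fun_eq_rel_def lp_norm_def[abs_def])
  show "lp_norm p M f = lp_norm p M g"
    if "f \<in> Lp_functions p M" "g \<in> Lp_functions p M" "AE t in M. f t = g t" for f g
    using that by (intro lp_norm_cong_AE Lp_functions_measurable)
  show "AE t in M. P'' t" if "AE t in M. P t" "AE t in M. P' t" "\<And>t. P t \<Longrightarrow> P' t \<Longrightarrow> P'' t" for P P' P''
    using that(1,2) by eventually_elim (rule that(3))
qed (use assms in \<open>auto intro: Lp_functions_add Lp_functions_scale\<close>)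

lemma vnorm_Lp: "vnorm (Lp p M) A = lp_norm p M (rep A)"
  by (simp add: Lp_def function_quotient_def lp_norm_def)

definition linf_norm :: "'a measure \<Rightarrow> ('a \<Rightarrow> complex) \<Rightarrow> real" where
  "linf_norm M f = Inf {C. 0 \<le> C \<and> locally_AE M (\<lambda>t. cmod (f t) \<le> C)}"

lemma locally_AE_mono2:
  assumes "locally_AE M P" "locally_AE M P'" "\<And>t. P t \<Longrightarrow> P' t \<Longrightarrow> P'' t"
  shows "locally_AE M P''"
  unfolding locally_AE_def
proof (intro ballI impI)
  fix A assume A: "A \<in> sets M" "emeasure M A < \<infinity>"
  then have "AE t in M. t \<in> A \<longrightarrow> P t" "AE t in M. t \<in> A \<longrightarrow> P' t"
    using assms(1,2) unfolding locally_AE_def by blast+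
  then show "AE t in M. t \<in> A \<longrightarrow> P'' t" by eventually_elim (use assms(3) in blast)
qed

lemma locally_AE_all: "(\<And>t. P t) \<Longrightarrow> locally_AE M P"
  by (simp add: locally_AE_def)

lemma Linf_functions_measurable:
  "f \<in> Linf_functions M \<Longrightarrow> f \<in> borel_measurable M"
  by (simp add: Linf_functions_def)

lemma function_class_space_Linf:
  "function_class_space (Linf_functions M) (locally_AE M) (linf_norm M) (Linf M)"
proof
  show "Linf M = function_quotient (Linf_functions M) (fun_eq_rel (Linf_functions M) (locally_AE M)) (linf_norm M)"
    by (simp add: Linf_def fun_eq_rel_def linf_norm_def[abs_def])
  show "(\<lambda>t. 0) \<in> Linf_functions M"
    by (auto simp: Linf_functions_def intro!: exI[of _ 0] locally_AE_all)
  show "(\<lambda>t. f t + g t) \<in> Linf_functions M" if fg: "f \<in> Linf_functions M" "g \<in> Linf_functions M" for f g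
  proof -
    obtain C D where "locally_AE M (\<lambda>t. cmod (f t) \<le> C)" "locally_AE M (\<lambda>t. cmod (g t) \<le> D)"
      using fg by (auto simp: Linf_functions_def)
    then have "locally_AE M (\<lambda>t. cmod (f t + g t) \<le> C + D)"
      by (rule locally_AE_mono2) (rule norm_triangle_mono)
    then show ?thesis using fg by (auto simp: Linf_functions_def)
  qed
  show "(\<lambda>t. c * f t) \<in> Linf_functions M" if f: "f \<in> Linf_functions M" for c f
  proof -
    obtain C where C: "locally_AE M (\<lambda>t. cmod (f t) \<le> C)"
      using f by (auto simp: Linf_functions_def)
    have "locally_AE M (\<lambda>t. cmod (c * f t) \<le> cmod c * C)"
      using C C by (rule locally_AE_mono2) (simp add: norm_mult mult_left_mono)
    then show ?thesis using f by (auto simp: Linf_functions_def)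
  qed
  show "linf_norm M f = linf_norm M g" if eq: "locally_AE M (\<lambda>t. f t = g t)" for f g
  proof -
    have "locally_AE M (\<lambda>t. cmod (f t) \<le> C) \<longleftrightarrow> locally_AE M (\<lambda>t. cmod (g t) \<le> C)" for C
      using locally_AE_mono2[OF eq, of "\<lambda>t. cmod (f t) \<le> C" "\<lambda>t. cmod (g t) \<le> C"]
        locally_AE_mono2[OF eq, of "\<lambda>t. cmod (g t) \<le> C" "\<lambda>t. cmod (f t) \<le> C"] by auto
    then show ?thesis by (simp add: linf_norm_def)
  qed
qed (erule locally_AE_all, erule (1) locally_AE_mono2, simp)

lemma linf_norm_le:
  assumes "0 \<le> C" "locally_AE M (\<lambda>t. cmod (f t) \<le> C)"
  shows "linf_norm M f \<le> C"
  unfolding linf_norm_def by (rule cInf_lower) (use assms in \<open>auto intro!: bdd_belowI[of _ 0]\<close>)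

text \<open>The set where an integrable function is nonzero is a countable union of sets of finite measure, by
  Markov's inequality. So nothing is lost when \<open>L\<^sup>1\<close> functions are paired with classes of functions
  modulo equality locally almost everywhere.\<close>

lemma locally_AE_on_integrable_support:
  fixes g :: "'a \<Rightarrow> complex"
  assumes P: "locally_AE M P" and g: "integrable M g"
  shows "AE t in M. g t \<noteq> 0 \<longrightarrow> P t"
proof -
  have "AE t in M. \<forall>k. t \<in> {t \<in> space M. cmod (g t) \<ge> 1 / real (Suc k)} \<longrightarrow> P t"
  proof (subst AE_all_countable, intro allI)
    fix k
    have m: "{t \<in> space M. cmod (g t) \<ge> 1 / real (Suc k)} \<in> sets M"
      using g by measurable
    have "emeasure M {t \<in> space M. cmod (g t) \<ge> 1 / real (Suc k)} \<le> 1 / (1 / real (Suc k)) * (\<integral>t. cmod (g t) \<partial>M)"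
      using g by (intro integral_Markov_inequality) auto
    then have "emeasure M {t \<in> space M. cmod (g t) \<ge> 1 / real (Suc k)} < \<infinity>"
      by (rule order_le_less_trans) simp
    then show "AE t in M. t \<in> {t \<in> space M. cmod (g t) \<ge> 1 / real (Suc k)} \<longrightarrow> P t"
      using P m unfolding locally_AE_def by blast
  qed
  then show ?thesis
    using AE_space
  proof eventually_elim
    case (elim t)
    show ?case
    proof
      assume "g t \<noteq> 0"
      then obtain k where "1 / real (Suc k) < cmod (g t)"
        using reals_Archimedean[of "cmod (g t)"] by (auto simp: inverse_eq_divide)
      then have "t \<in> {t \<in> space M. 1 / real (Suc k) \<le> cmod (g t)}" using elim(2) by simp
      then show "P t" using elim(1) by blast
    qed
  qed
qed

lemma integrable_mult_Linf:
  assumes g: "integrable M g" and f: "f \<in> Linf_functions M"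
  shows "integrable M (\<lambda>t. g t * f t)"
    and "cmod (\<integral>t. g t * f t \<partial>M) \<le> lp_norm 1 M g * linf_norm M f"
proof -
  have m: "f \<in> borel_measurable M" "g \<in> borel_measurable M" using f g by (auto simp: Linf_functions_def)
  have bound: "AE t in M. norm (g t * f t) \<le> norm (C * cmod (g t))"
    if "0 \<le> C" and C: "locally_AE M (\<lambda>t. cmod (f t) \<le> C)" for C
    using locally_AE_on_integrable_support[OF C g]
  proof eventually_elim
    case (elim t)
    then show ?case
      using \<open>0 \<le> C\<close> by (cases "g t = 0") (auto simp: norm_mult mult.commute[of C] intro!: mult_left_mono)
  qed
  obtain C where "locally_AE M (\<lambda>t. cmod (f t) \<le> C)" using f by (auto simp: Linf_functions_def)
  then have C: "locally_AE M (\<lambda>t. cmod (f t) \<le> max 0 C)" by (rule locally_AE_mono2[OF _ locally_AE_all[of "\<lambda>_. True"]]) auto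
  show int: "integrable M (\<lambda>t. g t * f t)"
  proof (rule Bochner_Integration.integrable_bound)
    show "integrable M (\<lambda>t. max 0 C * cmod (g t))" using g by simp
    show "AE t in M. norm (g t * f t) \<le> norm (max 0 C * cmod (g t))" by (rule bound[OF _ C]) simp
  qed (use m in measurable)
  have le: "cmod (\<integral>t. g t * f t \<partial>M) \<le> D * lp_norm 1 M g"
    if D: "0 \<le> D" "locally_AE M (\<lambda>t. cmod (f t) \<le> D)" for D
  proof -
    have "cmod (\<integral>t. g t * f t \<partial>M) \<le> (\<integral>t. cmod (g t * f t) \<partial>M)" by (rule integral_norm_bound)
    also have "\<dots> \<le> (\<integral>t. D * cmod (g t) \<partial>M)"
    proof (rule integral_mono_AE)
      show "AE t in M. cmod (g t * f t) \<le> D * cmod (g t)" using bound[OF D] D(1) by simp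
    qed (use g int in auto)
    also have "\<dots> = D * lp_norm 1 M g" using g by (simp add: lp_norm_def)
    finally show ?thesis .
  qed
  show "cmod (\<integral>t. g t * f t \<partial>M) \<le> lp_norm 1 M g * linf_norm M f"
  proof (cases "lp_norm 1 M g = 0")
    case True
    then show ?thesis using le[OF _ C] by simp
  next
    case False
    then have pos: "0 < lp_norm 1 M g" using lp_norm_nonneg[of 1 M g] by linarith
    have "cmod (\<integral>t. g t * f t \<partial>M) / lp_norm 1 M g \<le> linf_norm M f"
      unfolding linf_norm_def
    proof (rule cInf_greatest)
      show "{C. 0 \<le> C \<and> locally_AE M (\<lambda>t. cmod (f t) \<le> C)} \<noteq> {}" using C by (metis (mono_tags) empty_Collect_eq max.cobounded1)
    qed (use le pos in \<open>simp add: divide_le_eq\<close>)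
    then show ?thesis using pos by (simp add: divide_le_eq mult.commute)
  qed
qed

section \<open>Operator norms as bounds for scalar matrices\<close>

lemma op_norm_le_iff:
  assumes "0 \<le> C"
  shows "op_norm V W T \<le> ennreal C \<longleftrightarrow> (\<forall>x\<in>carr V. vnorm V x \<le> 1 \<longrightarrow> vnorm W (T x) \<le> C)"
  using assms by (auto simp: op_norm_def SUP_le_iff ennreal_le_iff)

lemma root_powr_le_iff:
  fixes S C p :: real
  assumes "0 < p" "0 \<le> S" "0 \<le> C"
  shows "S powr (1 / p) \<le> C \<longleftrightarrow> S \<le> C powr p"
proof -
  have "(S powr (1 / p)) powr p = S" using assms by (simp add: powr_powr)
  then show ?thesis using assms
    by (metis powr_ge_zero powr_mono2 powr_less_mono2 not_le less_imp_le)
qed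

lemma cfield_simps [simp]:
  "carr cfield = UNIV" "vadd cfield = (+)" "vzero cfield = 0" "vscale cfield = (*)" "vnorm cfield = cmod"
  by (simp_all add: cfield_def)

lemma vsum_cfield [simp]: "vsum cfield f n = (\<Sum>l<n. f l)"
  by (induction n) auto

lemma ell_simps:
  "carr (ell p n E) = {..<n} \<rightarrow>\<^sub>E carr E"
  "vnorm (ell p n E) x = (\<Sum>i<n. vnorm E (x i) powr p) powr (1 / p)"
  by (simp_all add: ell_def)

lemma vsum_ell_cfield:
  "i < n \<Longrightarrow> vsum (ell p n cfield) f m i = (\<Sum>l<m. f l i)"
  by (induction m) (auto simp: ell_def)

lemma ell_cfield_norm_le_iff:
  assumes "0 < p" "0 \<le> C"
  shows "vnorm (ell p n cfield) x \<le> C \<longleftrightarrow> (\<Sum>i<n. cmod (x i) powr p) \<le> C powr p"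
  using assms by (simp add: ell_simps root_powr_le_iff sum_nonneg)

lemma ell_ell_cfield_norm_le_iff:
  assumes "0 < p" "0 \<le> C"
  shows "vnorm (ell p m (ell p n cfield)) x \<le> C \<longleftrightarrow>
    (\<Sum>(k, i)\<in>{..<m} \<times> {..<n}. cmod (x k i) powr p) \<le> C powr p"
proof -
  have "vnorm (ell p n cfield) y powr p = (\<Sum>i<n. cmod (y i) powr p)" for y
    using assms by (simp add: ell_simps powr_powr sum_nonneg)
  then show ?thesis
    using assms root_powr_le_iff[OF assms(1) _ assms(2), of "\<Sum>(k, i)\<in>{..<m} \<times> {..<n}. cmod (x k i) powr p"]
    by (subst ell_simps) (simp add: sum.cartesian_product sum_nonneg case_prod_unfold)
qed

lemma scalar_matrix_op_apply:
  "x \<in> carr (ell p n cfield) \<Longrightarrow> i < n \<Longrightarrow> scalar_matrix_op p n a x i = (\<Sum>j<n. a i j * x j)"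
  by (simp add: scalar_matrix_op_def matrix_op_def)

lemma op_norm_scalar_matrix_le_iff:
  assumes p: "0 < p" and C: "0 \<le> C"
  shows "op_norm (ell p n cfield) (ell p n cfield) (scalar_matrix_op p n a) \<le> ennreal C
    \<longleftrightarrow> lp_bounded p {..<n} {..<n} a C"
proof -
  let ?E = "ell p n cfield"
  have "(\<forall>x\<in>carr ?E. vnorm ?E x \<le> 1 \<longrightarrow> vnorm ?E (scalar_matrix_op p n a x) \<le> C)
    \<longleftrightarrow> (\<forall>x\<in>carr ?E. (\<Sum>j<n. cmod (x j) powr p) \<le> 1 \<longrightarrow>
          (\<Sum>i<n. cmod (\<Sum>j<n. a i j * x j) powr p) \<le> C powr p)"
    using p C by (intro ball_cong refl) (simp add: ell_cfield_norm_le_iff scalar_matrix_op_apply)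
  also have "\<dots> \<longleftrightarrow> lp_bounded p {..<n} {..<n} a C"
  proof (intro iffI ballI impI)
    assume *: "\<forall>x\<in>carr ?E. (\<Sum>j<n. cmod (x j) powr p) \<le> 1 \<longrightarrow>
          (\<Sum>i<n. cmod (\<Sum>j<n. a i j * x j) powr p) \<le> C powr p"
    show "lp_bounded p {..<n} {..<n} a C"
    proof (rule lp_bounded_by_unit_ball)
      fix z :: "nat \<Rightarrow> complex" assume "(\<Sum>j<n. cmod (z j) powr p) \<le> 1"
      then show "(\<Sum>i<n. cmod (\<Sum>j<n. a i j * z j) powr p) \<le> C powr p"
        using *[rule_format, of "restrict z {..<n}"] by (simp add: ell_simps)
    qed (use p in auto)
  next
    fix x assume a: "lp_bounded p {..<n} {..<n} a C" and x: "(\<Sum>j<n. cmod (x j) powr p) \<le> 1"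
    show "(\<Sum>i<n. cmod (\<Sum>j<n. a i j * x j) powr p) \<le> C powr p"
      using lp_boundedD[OF a, of x] mult_left_mono[OF x, of "C powr p"] by simp
  qed
  finally show ?thesis using C by (simp add: op_norm_le_iff)
qed

text \<open>The identification of \<open>\<ell>\<^sup>p(m, \<ell>\<^sup>p(n))\<close> with \<open>\<ell>\<^sup>p\<close> of the \<open>m n\<close> index pairs. The outer indices \<open>k\<close>, \<open>l\<close> belong
  to the matrix over the predual, the inner indices \<open>i\<close>, \<open>j\<close> to the matrix of functionals.\<close>

lemma op_norm_block_scalar_matrix_le_iff:
  assumes p: "0 < p" and C: "0 \<le> C"
  shows "op_norm (ell p m (ell p n cfield)) (ell p m (ell p n cfield))
      (matrix_op p m (ell p n cfield) (\<lambda>k l. scalar_matrix_op p n (\<lambda>i j. a i j k l))) \<le> ennreal C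
    \<longleftrightarrow> lp_bounded p ({..<m} \<times> {..<n}) ({..<m} \<times> {..<n}) (\<lambda>(k, i) (l, j). a i j k l) C"
proof -
  let ?E = "ell p m (ell p n cfield)" and ?I = "{..<m} \<times> {..<n}"
  let ?T = "matrix_op p m (ell p n cfield) (\<lambda>k l. scalar_matrix_op p n (\<lambda>i j. a i j k l))"
  let ?a = "\<lambda>(k, i) (l, j). a i j k l"
  have T: "?T x k i = (\<Sum>y\<in>?I. ?a (k, i) y * case_prod x y)"
    if x: "x \<in> carr ?E" and k: "k < m" and i: "i < n" for x k i
  proof -
    have xl: "x l \<in> carr (ell p n cfield)" if "l < m" for l
      using x that by (auto simp: ell_simps(1)[of p m])
    have "?T x k i = (\<Sum>l<m. scalar_matrix_op p n (\<lambda>i j. a i j k l) (x l) i)"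
      using x k i by (simp add: matrix_op_def vsum_ell_cfield)
    also have "\<dots> = (\<Sum>l<m. \<Sum>j<n. a i j k l * x l j)"
      using xl i by (intro sum.cong) (auto simp: scalar_matrix_op_apply)
    also have "\<dots> = (\<Sum>(l, j)\<in>?I. a i j k l * x l j)" by (rule sum.cartesian_product)
    finally show ?thesis by (simp add: case_prod_unfold)
  qed
  have "(\<Sum>(k, i)\<in>?I. cmod (?T x k i) powr p) = (\<Sum>u\<in>?I. cmod (\<Sum>y\<in>?I. ?a u y * case_prod x y) powr p)"
    if "x \<in> carr ?E" for x
    using T[OF that] by (intro sum.cong) auto
  then have "(\<forall>x\<in>carr ?E. vnorm ?E x \<le> 1 \<longrightarrow> vnorm ?E (?T x) \<le> C)
    \<longleftrightarrow> (\<forall>x\<in>carr ?E. (\<Sum>y\<in>?I. cmod (case_prod x y) powr p) \<le> 1 \<longrightarrow>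
          (\<Sum>u\<in>?I. cmod (\<Sum>y\<in>?I. ?a u y * case_prod x y) powr p) \<le> C powr p)"
    using p C by (intro ball_cong refl) (simp add: ell_ell_cfield_norm_le_iff case_prod_unfold)
  also have "\<dots> \<longleftrightarrow> lp_bounded p ?I ?I ?a C"
  proof (intro iffI ballI impI)
    assume *: "\<forall>x\<in>carr ?E. (\<Sum>y\<in>?I. cmod (case_prod x y) powr p) \<le> 1 \<longrightarrow>
          (\<Sum>u\<in>?I. cmod (\<Sum>y\<in>?I. ?a u y * case_prod x y) powr p) \<le> C powr p"
    show "lp_bounded p ?I ?I ?a C"
    proof (rule lp_bounded_by_unit_ball)
      fix z :: "nat \<times> nat \<Rightarrow> complex" assume z: "(\<Sum>y\<in>?I. cmod (z y) powr p) \<le> 1"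
      define x where "x = (\<lambda>l\<in>{..<m}. \<lambda>j\<in>{..<n}. z (l, j))"
      have x: "x \<in> carr ?E" by (auto simp: x_def ell_simps)
      have xz: "case_prod x y = z y" if "y \<in> ?I" for y using that by (auto simp: x_def)
      have "(\<Sum>y\<in>?I. cmod (case_prod x y) powr p) = (\<Sum>y\<in>?I. cmod (z y) powr p)"
        by (intro sum.cong refl) (simp only: xz)
      moreover have "(\<Sum>y\<in>?I. ?a u y * case_prod x y) = (\<Sum>y\<in>?I. ?a u y * z y)" for u
        by (intro sum.cong refl) (simp only: xz)
      ultimately show "(\<Sum>u\<in>?I. cmod (\<Sum>y\<in>?I. ?a u y * z y) powr p) \<le> C powr p"
        using *[rule_format, OF x] z by simp
    qed (use p in auto)
  next
    fix x assume a: "lp_bounded p ?I ?I ?a C" and x: "(\<Sum>y\<in>?I. cmod (case_prod x y) powr p) \<le> 1"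
    show "(\<Sum>u\<in>?I. cmod (\<Sum>y\<in>?I. ?a u y * case_prod x y) powr p) \<le> C powr p"
      using lp_boundedD[OF a, of "case_prod x"] mult_left_mono[OF x, of "C powr p"] by simp
  qed
  finally show ?thesis using C by (simp add: op_norm_le_iff)
qed

lemma with_mnorm_simps [simp]:
  "carr (with_mnorm X N) = carr X" "vadd (with_mnorm X N) = vadd X" "vzero (with_mnorm X N) = vzero X"
  "vscale (with_mnorm X N) = vscale X" "vnorm (with_mnorm X N) = vnorm X" "mnorm (with_mnorm X N) = N"
  by (simp_all add: with_mnorm_def nspace.extend_def pospace.fields_def)

lemma bounded_ops_simps:
  "carr (bounded_ops V W) = {T \<in> extensional (carr V). linear_map V W T \<and> op_norm V W T < \<infinity>}"
  "vadd (bounded_ops V W) S T = (\<lambda>x\<in>carr V. vadd W (S x) (T x))"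
  "vscale (bounded_ops V W) c T = (\<lambda>x\<in>carr V. vscale W c (T x))"
  "vnorm (bounded_ops V W) T = enn2real (op_norm V W T)"
  by (simp_all add: bounded_ops_def)

lemma bounded_ops_norm_le_iff:
  assumes "T \<in> carr (bounded_ops V W)" "0 \<le> C"
  shows "vnorm (bounded_ops V W) T \<le> C \<longleftrightarrow> (\<forall>x\<in>carr V. vnorm V x \<le> 1 \<longrightarrow> vnorm W (T x) \<le> C)"
proof -
  have "op_norm V W T < \<infinity>" using assms by (simp add: bounded_ops_simps)
  then obtain r where "op_norm V W T = ennreal r" "0 \<le> r"
    by (cases "op_norm V W T") auto
  then have "enn2real (op_norm V W T) \<le> C \<longleftrightarrow> op_norm V W T \<le> ennreal C"
    using assms by (simp add: ennreal_le_iff)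
  then show ?thesis using assms by (simp add: bounded_ops_simps op_norm_le_iff)
qed

lemma bounded_opsI:
  assumes "T \<in> extensional (carr V)" "linear_map V W T" "0 \<le> C"
    and "\<And>x. x \<in> carr V \<Longrightarrow> vnorm V x \<le> 1 \<Longrightarrow> vnorm W (T x) \<le> C"
  shows "T \<in> carr (bounded_ops V W)" "vnorm (bounded_ops V W) T \<le> C"
proof -
  have "op_norm V W T \<le> ennreal C" using assms by (simp add: op_norm_le_iff)
  then have "op_norm V W T < \<infinity>" by (rule order_le_less_trans) simp
  then show T: "T \<in> carr (bounded_ops V W)" using assms by (simp add: bounded_ops_simps)
  show "vnorm (bounded_ops V W) T \<le> C" using assms by (simp add: bounded_ops_norm_le_iff[OF T])
qed

lemma pmin_norm_le_1_iff:
  assumes p: "0 < p"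
  shows "mnorm (pmin p X) m v \<le> 1 \<longleftrightarrow>
    (\<forall>\<psi>\<in>carr (dual_space X). (\<forall>x\<in>carr X. vnorm X x \<le> 1 \<longrightarrow> cmod (\<psi> x) \<le> 1) \<longrightarrow>
       lp_bounded p {..<m} {..<m} (\<lambda>k l. \<psi> (v k l)) 1)"
proof -
  have "mnorm (pmin p X) m v \<le> ennreal 1 \<longleftrightarrow>
    (\<forall>\<psi>\<in>carr (dual_space X). vnorm (dual_space X) \<psi> \<le> 1 \<longrightarrow>
       lp_bounded p {..<m} {..<m} (amplify \<psi> v) 1)"
    using op_norm_scalar_matrix_le_iff[OF p, of 1 m] by (simp add: pmin_def SUP_le_iff) blast
  then show ?thesis
    by (simp add: bounded_ops_norm_le_iff amplify_def[abs_def] cong: ball_cong)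
qed

lemma pdual_norm_le_iff:
  assumes p: "0 < p" and C: "0 \<le> C"
  shows "mnorm (pdual p V) n f \<le> ennreal C \<longleftrightarrow>
    (\<forall>m\<ge>1. \<forall>v\<in>matrices m V. mnorm V m v \<le> 1 \<longrightarrow>
      lp_bounded p ({..<m} \<times> {..<n}) ({..<m} \<times> {..<n}) (\<lambda>(k, i) (l, j). f i j (v k l)) C)"
proof -
  have "mnorm (pops p (ell p n cfield)) m (amplify (\<lambda>v. scalar_matrix_op p n (\<lambda>i j. f i j v)) v)
      = op_norm (ell p m (ell p n cfield)) (ell p m (ell p n cfield))
      (matrix_op p m (ell p n cfield) (\<lambda>k l. scalar_matrix_op p n (\<lambda>i j. f i j (v k l))))" for m v
    by (simp add: pops_def amplify_def)
  then show ?thesis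
    by (simp add: pdual_def pcb_norm_def SUP_le_iff op_norm_block_scalar_matrix_le_iff[OF p C]) auto
qed

lemma ell_Lp_norm_le_iff:
  assumes "0 < p" "0 \<le> C"
  shows "vnorm (ell p n (Lp p M)) \<xi> \<le> C \<longleftrightarrow> (\<Sum>i<n. lp_norm p M (rep (\<xi> i)) powr p) \<le> C powr p"
  using assms by (simp add: ell_simps root_powr_le_iff sum_nonneg vnorm_Lp)

lemma pmax_norm_le_iff:
  fixes X :: "'v nspace"
  assumes p: "1 \<le> p" and C: "0 \<le> C" and x: "x \<in> matrices n X"
  shows "mnorm (pmax TYPE('b) p X) n x \<le> ennreal C \<longleftrightarrow>
    (\<forall>(\<phi> :: 'b measure) \<pi>. linear_contraction X (bounded_ops (Lp p \<phi>) (Lp p \<phi>)) \<pi> \<longrightarrow>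
      (\<forall>\<xi>\<in>{..<n} \<rightarrow>\<^sub>E carr (Lp p \<phi>). (\<Sum>j<n. lp_norm p \<phi> (rep (\<xi> j)) powr p) \<le> 1 \<longrightarrow>
        (\<Sum>i<n. lp_norm p \<phi> (\<lambda>t. \<Sum>j<n. rep (\<pi> (x i j) (\<xi> j)) t) powr p) \<le> C powr p))"
proof -
  have "mnorm (pops p (Lp p \<phi>)) n (amplify \<pi> x) \<le> ennreal C \<longleftrightarrow>
      (\<forall>\<xi>\<in>{..<n} \<rightarrow>\<^sub>E carr (Lp p \<phi>). (\<Sum>j<n. lp_norm p \<phi> (rep (\<xi> j)) powr p) \<le> 1 \<longrightarrow>
        (\<Sum>i<n. lp_norm p \<phi> (\<lambda>t. \<Sum>j<n. rep (\<pi> (x i j) (\<xi> j)) t) powr p) \<le> C powr p)"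
    if \<pi>: "linear_contraction X (bounded_ops (Lp p \<phi>) (Lp p \<phi>)) \<pi>" for \<phi> :: "'b measure" and \<pi>
  proof -
    interpret E: function_class_space "Lp_functions p \<phi>" "\<lambda>P. AE t in \<phi>. P t" "lp_norm p \<phi>" "Lp p \<phi>"
      by (rule function_class_space_Lp[OF p])
    have entry: "\<pi> (x i j) y \<in> carr (Lp p \<phi>)" if "i < n" "j < n" "y \<in> carr (Lp p \<phi>)" for i j y
    proof -
      have "\<pi> (x i j) \<in> carr (bounded_ops (Lp p \<phi>) (Lp p \<phi>))"
        using \<pi> x that unfolding linear_contraction_def linear_map_def matrices_def by blast
      then show ?thesis using that by (auto simp: bounded_ops_simps linear_map_def)
    qed
    have "vnorm (Lp p \<phi>) (matrix_op p n (Lp p \<phi>) (amplify \<pi> x) \<xi> i)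
        = lp_norm p \<phi> (\<lambda>t. \<Sum>j<n. rep (\<pi> (x i j) (\<xi> j)) t)"
      if "\<xi> \<in> {..<n} \<rightarrow>\<^sub>E carr (Lp p \<phi>)" "i < n" for \<xi> i
    proof -
      have c: "\<pi> (x i j) (\<xi> j) \<in> carr (Lp p \<phi>)" if "j < n" for j
        using entry \<open>\<xi> \<in> _\<close> \<open>i < n\<close> that by (auto simp: PiE_iff)
      have "matrix_op p n (Lp p \<phi>) (amplify \<pi> x) \<xi> i = vsum (Lp p \<phi>) (\<lambda>j. \<pi> (x i j) (\<xi> j)) n"
        using that by (simp add: matrix_op_def ell_simps amplify_def)
      also have "\<dots> = E.cls (\<lambda>t. \<Sum>j<n. rep (\<pi> (x i j) (\<xi> j)) t)" using c by (rule E.vsum_carr)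
      finally show ?thesis using c by (simp add: E.vnorm_cls E.sum_mem E.rep_carr)
    qed
    then show ?thesis using p C
      by (simp add: pops_def op_norm_le_iff ell_Lp_norm_le_iff ell_simps(1) ell_simps(2)[of p n _ "matrix_op _ _ _ _ _"]
          root_powr_le_iff sum_nonneg cong: ball_cong)
  qed
  then show ?thesis by (simp add: pmax_def SUP_le_iff)
qed

section \<open>The canonical embedding of \<open>L\<^sup>1\<close>\<close>

lemma L1_embedding_apply:
  "B \<in> carr (Linf M) \<Longrightarrow> L1_embedding M A B = (\<integral>t. rep A t * rep B t \<partial>M)"
  by (simp add: L1_embedding_def)

lemma L1_rep_integrable: "A \<in> carr (Lp 1 M) \<Longrightarrow> integrable M (rep A)"
  using function_class_space.rep_carr(1)[OF function_class_space_Lp[of 1 M]] by (simp add: L1_functions_iff)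

lemma Linf_rep: "B \<in> carr (Linf M) \<Longrightarrow> rep B \<in> Linf_functions M"
  using function_class_space.rep_carr(1)[OF function_class_space_Linf] .

lemma L1_embedding_bound:
  assumes "A \<in> carr (Lp 1 M)" "B \<in> carr (Linf M)"
  shows "cmod (L1_embedding M A B) \<le> vnorm (Lp 1 M) A * vnorm (Linf M) B"
  using integrable_mult_Linf(2)[OF L1_rep_integrable[OF assms(1)] Linf_rep[OF assms(2)]] assms
  by (simp add: L1_embedding_apply vnorm_Lp function_class_space.vnorm_carr[OF function_class_space_Linf])

lemma L1_embedding_in_dual:
  assumes A: "A \<in> carr (Lp 1 M)"
  shows "L1_embedding M A \<in> carr (dual_space (Linf M))"
    and "vnorm (dual_space (Linf M)) (L1_embedding M A) \<le> vnorm (Lp 1 M) A"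
proof -
  interpret I: function_class_space "Linf_functions M" "locally_AE M" "linf_norm M" "Linf M"
    by (rule function_class_space_Linf)
  note gi = L1_rep_integrable[OF A]
  have gm: "rep A \<in> borel_measurable M" using gi by simp
  have fm: "rep B \<in> borel_measurable M" if "B \<in> carr (Linf M)" for B
    using Linf_rep[OF that] by (rule Linf_functions_measurable)
  have lin: "linear_map (Linf M) cfield (L1_embedding M A)"
    unfolding linear_map_def
  proof (intro conjI ballI allI)
    fix B D assume B: "B \<in> carr (Linf M)" and D: "D \<in> carr (Linf M)"
    have "(\<integral>t. rep A t * rep (vadd (Linf M) B D) t \<partial>M) = (\<integral>t. rep A t * rep B t + rep A t * rep D t \<partial>M)"
    proof (rule integral_cong_AE)
      show "AE t in M. rep A t * rep (vadd (Linf M) B D) t = rep A t * rep B t + rep A t * rep D t"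
        using locally_AE_on_integrable_support[OF I.rep_vadd[OF B D] gi]
        by eventually_elim (auto simp: algebra_simps)
    qed (use gm fm B D I.vadd_carr[OF B D] in auto)
    also have "\<dots> = (\<integral>t. rep A t * rep B t \<partial>M) + (\<integral>t. rep A t * rep D t \<partial>M)"
      using integrable_mult_Linf(1)[OF gi] B D Linf_rep by (intro Bochner_Integration.integral_add) auto
    finally show "L1_embedding M A (vadd (Linf M) B D) = vadd cfield (L1_embedding M A B) (L1_embedding M A D)"
      using B D I.vadd_carr[OF B D] by (simp add: L1_embedding_apply)
  next
    fix c B assume B: "B \<in> carr (Linf M)"
    have "(\<integral>t. rep A t * rep (vscale (Linf M) c B) t \<partial>M) = (\<integral>t. c * (rep A t * rep B t) \<partial>M)"
    proof (rule integral_cong_AE)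
      show "AE t in M. rep A t * rep (vscale (Linf M) c B) t = c * (rep A t * rep B t)"
        using locally_AE_on_integrable_support[OF I.rep_vscale[OF B, of c] gi]
        by eventually_elim auto
    qed (use gm fm B I.vscale_carr[OF B] in auto)
    then show "L1_embedding M A (vscale (Linf M) c B) = vscale cfield c (L1_embedding M A B)"
      using B I.vscale_carr[OF B] by (simp add: L1_embedding_apply)
  qed simp
  have bound: "vnorm cfield (L1_embedding M A B) \<le> vnorm (Lp 1 M) A" if "B \<in> carr (Linf M)" "vnorm (Linf M) B \<le> 1" for B
    using L1_embedding_bound[OF A that(1)] mult_left_mono[OF that(2), of "vnorm (Lp 1 M) A"]
    by (simp add: vnorm_Lp)
  have ext: "L1_embedding M A \<in> extensional (carr (Linf M))" by (simp add: L1_embedding_def)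
  show "L1_embedding M A \<in> carr (dual_space (Linf M))"
    "vnorm (dual_space (Linf M)) (L1_embedding M A) \<le> vnorm (Lp 1 M) A"
    by (rule bounded_opsI[OF ext lin _ bound]; simp add: vnorm_Lp)+
qed

lemma L1_embedding_linear: "linear_map (Lp 1 M) (dual_space (Linf M)) (L1_embedding M)"
proof -
  interpret E: function_class_space "Lp_functions 1 M" "\<lambda>P. AE t in M. P t" "lp_norm 1 M" "Lp 1 M"
    by (rule function_class_space_Lp) simp
  have m: "rep A \<in> borel_measurable M" if "A \<in> carr (Lp 1 M)" for A
    using L1_rep_integrable[OF that] by simp
  have fm: "rep B \<in> borel_measurable M" if "B \<in> carr (Linf M)" for B
    using Linf_rep[OF that] by (rule Linf_functions_measurable)
  show ?thesis
    unfolding linear_map_def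
  proof (intro conjI ballI allI)
    fix A D assume A: "A \<in> carr (Lp 1 M)" and D: "D \<in> carr (Lp 1 M)"
    have "L1_embedding M (vadd (Lp 1 M) A D) B = L1_embedding M A B + L1_embedding M D B"
      if B: "B \<in> carr (Linf M)" for B
    proof -
      have "(\<integral>t. rep (vadd (Lp 1 M) A D) t * rep B t \<partial>M) = (\<integral>t. rep A t * rep B t + rep D t * rep B t \<partial>M)"
      proof (rule integral_cong_AE)
        show "AE t in M. rep (vadd (Lp 1 M) A D) t * rep B t = rep A t * rep B t + rep D t * rep B t"
          using E.rep_vadd[OF A D] by eventually_elim (simp add: algebra_simps)
      qed (use m fm A B D E.vadd_carr[OF A D] in auto)
      also have "\<dots> = (\<integral>t. rep A t * rep B t \<partial>M) + (\<integral>t. rep D t * rep B t \<partial>M)"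
        using integrable_mult_Linf(1)[OF L1_rep_integrable Linf_rep[OF B]] A D
        by (intro Bochner_Integration.integral_add) auto
      finally show ?thesis using B by (simp add: L1_embedding_apply)
    qed
    then show "L1_embedding M (vadd (Lp 1 M) A D) = vadd (dual_space (Linf M)) (L1_embedding M A) (L1_embedding M D)"
      by (intro ext) (auto simp: bounded_ops_simps L1_embedding_def)
  next
    fix c A assume A: "A \<in> carr (Lp 1 M)"
    have "L1_embedding M (vscale (Lp 1 M) c A) B = c * L1_embedding M A B"
      if B: "B \<in> carr (Linf M)" for B
    proof -
      have "(\<integral>t. rep (vscale (Lp 1 M) c A) t * rep B t \<partial>M) = (\<integral>t. c * (rep A t * rep B t) \<partial>M)"
      proof (rule integral_cong_AE)
        show "AE t in M. rep (vscale (Lp 1 M) c A) t * rep B t = c * (rep A t * rep B t)"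
          using E.rep_vscale[OF A, of c] by eventually_elim simp
      qed (use m fm A B E.vscale_carr[OF A] in auto)
      then show ?thesis using B by (simp add: L1_embedding_apply)
    qed
    then show "L1_embedding M (vscale (Lp 1 M) c A) = vscale (dual_space (Linf M)) c (L1_embedding M A)"
      by (intro ext) (auto simp: bounded_ops_simps L1_embedding_def)
  qed (rule L1_embedding_in_dual)
qed

text \<open>The normalised functional \<open>A / \<parallel>A\<parallel>\<close> is one of the contractive functionals in the definition of the
  minimal norm. If \<open>\<parallel>A\<parallel> = 0\<close>, all entries vanish.\<close>

lemma L1_pairing_lp_bounded:
  assumes p: "0 < p" and v: "v \<in> matrices m (Linf M)" "mnorm (pmin p (Linf M)) m v \<le> 1"
    and A: "A \<in> carr (Lp 1 M)"
  shows "lp_bounded p {..<m} {..<m} (\<lambda>k l. L1_embedding M A (v k l)) (vnorm (Lp 1 M) A)"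
proof (cases "vnorm (Lp 1 M) A = 0")
  case True
  have "L1_embedding M A (v k l) = 0" if "k < m" "l < m" for k l
    using L1_embedding_bound[OF A, of "v k l"] v(1) that True by (simp add: matrices_def)
  then have "lp_bounded p {..<m} {..<m} (\<lambda>k l. L1_embedding M A (v k l)) 0
     \<longleftrightarrow> lp_bounded p {..<m} {..<m} (\<lambda>k l. 0) 0"
    by (intro lp_bounded_cong) auto
  then show ?thesis using True by (simp add: lp_bounded_def)
next
  case False
  interpret E: function_class_space "Lp_functions 1 M" "\<lambda>P. AE t in M. P t" "lp_norm 1 M" "Lp 1 M"
    by (rule function_class_space_Lp) simp
  define r where "r = vnorm (Lp 1 M) A"
  have r: "0 < r" using False by (simp add: r_def vnorm_Lp order_less_le)
  define D where "D = vscale (Lp 1 M) (of_real (1 / r)) A"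
  have D: "D \<in> carr (Lp 1 M)" unfolding D_def by (rule E.vscale_carr[OF A])
  have "vnorm (Lp 1 M) D = lp_norm 1 M (\<lambda>t. of_real (1 / r) * rep A t)"
    unfolding D_def E.vscale_eq using E.rep_carr(1)[OF A] by (intro E.vnorm_cls Lp_functions_scale)
  also have "\<dots> = 1" using r by (simp add: lp_norm_scale norm_divide del: of_real_divide) (simp add: r_def vnorm_Lp)
  finally have D1: "vnorm (Lp 1 M) D = 1" .
  have unit: "cmod (L1_embedding M D B) \<le> 1" if "B \<in> carr (Linf M)" "vnorm (Linf M) B \<le> 1" for B
    using L1_embedding_bound[OF D that(1)] that(2) D1 by simp
  have "lp_bounded p {..<m} {..<m} (\<lambda>k l. L1_embedding M D (v k l)) 1"
    using v(2) L1_embedding_in_dual(1)[OF D] unit unfolding pmin_norm_le_1_iff[OF p] by blast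
  from lp_bounded_scale[OF this, where w = "of_real r"]
  have *: "lp_bounded p {..<m} {..<m} (\<lambda>k l. of_real r * L1_embedding M D (v k l)) r" using r by simp
  have "of_real r * L1_embedding M D (v k l) = L1_embedding M A (v k l)" if "k < m" "l < m" for k l
  proof -
    have "v k l \<in> carr (Linf M)" using v(1) that by (simp add: matrices_def)
    then show ?thesis
      using linear_mapD(3)[OF L1_embedding_linear A, of "of_real (1 / r)"] r
      by (simp add: D_def bounded_ops_simps)
  qed
  then show ?thesis using * lp_bounded_cong[of "{..<m}" "{..<m}" "\<lambda>k l. of_real r * L1_embedding M D (v k l)"]
    by (simp add: r_def)
qed

section \<open>The dual norm is at most the maximal norm\<close>

text \<open>The space \<open>\<ell>\<^sup>p(m)\<close> as an \<open>L\<^sup>p\<close> space over \<open>m\<close> points of an arbitrary infinite type.\<close>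

lemma finite_count_space_Lp:
  fixes e :: "nat \<Rightarrow> 'b" and f :: "'b \<Rightarrow> complex"
  assumes e: "inj_on e {..<m}" and p: "0 < p"
  shows "f \<in> Lp_functions p (count_space (e ` {..<m}))"
    and "lp_norm p (count_space (e ` {..<m})) f powr p = (\<Sum>k<m. cmod (f (e k)) powr p)"
proof -
  have fin: "finite (e ` {..<m})" by simp
  show "f \<in> Lp_functions p (count_space (e ` {..<m}))"
    unfolding Lp_functions_def using integrable_count_space[OF fin] by simp
  show "lp_norm p (count_space (e ` {..<m})) f powr p = (\<Sum>k<m. cmod (f (e k)) powr p)"
    unfolding lp_norm_powr[OF p] lebesgue_integral_count_space_finite[OF fin] sum.reindex[OF e] by simp
qed

text \<open>The pairing with \<open>v\<close>, carried over to \<open>L\<^sup>p\<close> of \<open>m\<close> points of \<open>'b\<close>, is a linear contraction on \<open>L\<^sup>1(\<mu>)\<close>; the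
  bound for this single contraction is the bound for the matrix \<open>[\<langle>x\<^sub>i\<^sub>j, v\<^sub>k\<^sub>l\<rangle>]\<close>.\<close>

lemma dual_norm_le_max_norm:
  fixes \<mu> :: "'a measure"
  assumes p: "1 \<le> p" and inf: "infinite (UNIV :: 'b set)" and C: "0 \<le> C"
    and x: "x \<in> matrices n (Lp 1 \<mu>)" and max: "mnorm (pmax TYPE('b) p (Lp 1 \<mu>)) n x \<le> ennreal C"
    and v: "v \<in> matrices m (Linf \<mu>)" "mnorm (pmin p (Linf \<mu>)) m v \<le> 1"
  shows "lp_bounded p ({..<m} \<times> {..<n}) ({..<m} \<times> {..<n})
           (\<lambda>(k, i) (l, j). L1_embedding \<mu> (x i j) (v k l)) C"
proof -
  obtain e :: "nat \<Rightarrow> 'b" where "inj e" using infinite_countable_subset[OF inf] by blast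
  then have e: "inj_on e {..<m}" by (rule inj_on_subset) simp
  \<comment> \<open>\<open>\<iota> t\<close> is the coordinate that the point \<open>t\<close> stands for.\<close>
  define \<iota> where "\<iota> = inv_into {..<m} e"
  have \<iota>: "\<iota> (e k) = k" if "k < m" for k using e that by (simp add: \<iota>_def)
  define \<phi> where "\<phi> = count_space (e ` {..<m})"
  have p0: "0 < p" using p by simp
  note Lpf = finite_count_space_Lp[OF e p0, folded \<phi>_def]
  interpret E: function_class_space "Lp_functions p \<phi>" "\<lambda>P. AE t in \<phi>. P t" "lp_norm p \<phi>" "Lp p \<phi>"
    by (rule function_class_space_Lp[OF p])
  have AE: "(AE t in \<phi>. P t) \<longleftrightarrow> (\<forall>k<m. P (e k))" for P
    unfolding \<phi>_def AE_count_space by auto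
  have rep_cls: "rep (E.cls f) (e k) = f (e k)" if "k < m" for f k
    using E.rep_cls(2)[OF Lpf(1), of f] that by (simp add: AE)
  have cls_eqI: "E.cls f = E.cls g" if "\<And>k. k < m \<Longrightarrow> f (e k) = g (e k)" for f g
    using that E.cls_eq_iff[OF Lpf(1) Lpf(1)] by (simp add: AE)
  let ?E = "Lp p \<phi>" and ?L = "L1_embedding \<mu>"
  define \<pi> where "\<pi> A = (\<lambda>X\<in>carr ?E. E.cls (\<lambda>t. \<Sum>l<m. ?L A (v (\<iota> t) l) * rep X (e l)))" for A
  have vkl: "v k l \<in> carr (Linf \<mu>)" if "k < m" "l < m" for k l using v(1) that by (simp add: matrices_def)
  have lin: "linear_map ?E ?E (\<pi> A)" for A
    unfolding linear_map_def
  proof (intro conjI ballI allI)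
    fix X Y assume X: "X \<in> carr ?E" and Y: "Y \<in> carr ?E"
    have "rep (vadd ?E X Y) (e l) = rep X (e l) + rep Y (e l)" if "l < m" for l
      using E.rep_vadd[OF X Y] that by (simp add: AE)
    then show "\<pi> A (vadd ?E X Y) = vadd ?E (\<pi> A X) (\<pi> A Y)"
      using X Y E.vadd_carr[OF X Y] by (simp add: \<pi>_def E.vadd_cls[OF Lpf(1) Lpf(1)] ring_distribs sum.distrib)
  next
    fix c X assume X: "X \<in> carr ?E"
    have "rep (vscale ?E c X) (e l) = c * rep X (e l)" if "l < m" for l
      using E.rep_vscale[OF X, of c] that by (simp add: AE)
    then show "\<pi> A (vscale ?E c X) = vscale ?E c (\<pi> A X)"
      using X E.vscale_carr[OF X] by (simp add: \<pi>_def E.vscale_cls[OF Lpf(1)] sum_distrib_left mult.left_commute)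
  qed (simp add: \<pi>_def E.cls_carr Lpf)
  have norm: "vnorm ?E (\<pi> A X) powr p = (\<Sum>k<m. cmod (\<Sum>l<m. ?L A (v k l) * rep X (e l)) powr p)"
    if "X \<in> carr ?E" for A X
    using that by (simp add: \<pi>_def E.vnorm_cls Lpf \<iota>)
  have contr: "vnorm ?E (\<pi> A X) \<le> vnorm (Lp 1 \<mu>) A"
    if A: "A \<in> carr (Lp 1 \<mu>)" and X: "X \<in> carr ?E" "vnorm ?E X \<le> 1" for A X
  proof -
    have "vnorm ?E (\<pi> A X) powr p \<le> vnorm (Lp 1 \<mu>) A powr p * (\<Sum>l<m. cmod (rep X (e l)) powr p)"
      unfolding norm[OF X(1)] by (rule lp_boundedD[OF L1_pairing_lp_bounded[OF p0 v A]])
    also have "\<dots> = vnorm (Lp 1 \<mu>) A powr p * vnorm ?E X powr p"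
      by (simp add: vnorm_Lp Lpf)
    also have "\<dots> \<le> vnorm (Lp 1 \<mu>) A powr p * 1"
      using X(2) p by (intro mult_left_mono) (auto simp: powr_le1 vnorm_Lp)
    finally show ?thesis using p0
      by (metis mult.right_neutral not_le powr_less_mono2 vnorm_Lp lp_norm_nonneg)
  qed
  have ext: "\<pi> A \<in> extensional (carr ?E)" for A by (simp add: \<pi>_def)
  have "linear_contraction (Lp 1 \<mu>) (bounded_ops ?E ?E) \<pi>"
    unfolding linear_contraction_def linear_map_def
  proof (intro conjI ballI allI)
    fix A assume A: "A \<in> carr (Lp 1 \<mu>)"
    have nn: "0 \<le> vnorm (Lp 1 \<mu>) A" by (simp add: vnorm_Lp)
    show "\<pi> A \<in> carr (bounded_ops ?E ?E)" "vnorm (bounded_ops ?E ?E) (\<pi> A) \<le> vnorm (Lp 1 \<mu>) A"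
      using bounded_opsI[OF ext lin nn contr[OF A]] by auto
  next
    fix A D assume A: "A \<in> carr (Lp 1 \<mu>)" and D: "D \<in> carr (Lp 1 \<mu>)"
    have "?L (vadd (Lp 1 \<mu>) A D) (v k l) = ?L A (v k l) + ?L D (v k l)" if "k < m" "l < m" for k l
      using linear_mapD(2)[OF L1_embedding_linear A D] vkl[OF that] by (simp add: bounded_ops_simps)
    then show "\<pi> (vadd (Lp 1 \<mu>) A D) = vadd (bounded_ops ?E ?E) (\<pi> A) (\<pi> D)"
      by (auto simp: fun_eq_iff bounded_ops_simps \<pi>_def E.vadd_cls Lpf \<iota> ring_distribs sum.distrib intro!: cls_eqI)
  next
    fix c A assume A: "A \<in> carr (Lp 1 \<mu>)"
    have "?L (vscale (Lp 1 \<mu>) c A) (v k l) = c * ?L A (v k l)" if "k < m" "l < m" for k l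
      using linear_mapD(3)[OF L1_embedding_linear A] vkl[OF that] by (simp add: bounded_ops_simps)
    then show "\<pi> (vscale (Lp 1 \<mu>) c A) = vscale (bounded_ops ?E ?E) c (\<pi> A)"
      by (auto simp: fun_eq_iff bounded_ops_simps \<pi>_def E.vscale_cls Lpf \<iota> sum_distrib_left mult.assoc intro!: cls_eqI)
  qed
  note bound = max[unfolded pmax_norm_le_iff[OF p C x], rule_format, OF this]
  show ?thesis
  proof (rule lp_bounded_by_unit_ball)
    fix z :: "nat \<times> nat \<Rightarrow> complex"
    assume z: "(\<Sum>y\<in>{..<m} \<times> {..<n}. cmod (z y) powr p) \<le> 1"
    define \<xi> where "\<xi> = (\<lambda>j\<in>{..<n}. E.cls (\<lambda>t. z (\<iota> t, j)))"
    have \<xi>: "\<xi> \<in> {..<n} \<rightarrow>\<^sub>E carr ?E" by (auto simp: \<xi>_def E.cls_carr Lpf)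
    have \<xi>_rep: "rep (\<xi> j) (e l) = z (l, j)" if "l < m" "j < n" for l j
      using that by (simp add: \<xi>_def rep_cls \<iota>)
    have "(\<Sum>j<n. lp_norm p \<phi> (rep (\<xi> j)) powr p) = (\<Sum>j<n. \<Sum>l<m. cmod (z (l, j)) powr p)"
      by (intro sum.cong refl) (simp add: Lpf \<xi>_rep)
    also have "\<dots> = (\<Sum>y\<in>{..<m} \<times> {..<n}. cmod (z y) powr p)"
      by (subst sum.swap) (simp add: sum.cartesian_product)
    finally have "(\<Sum>j<n. lp_norm p \<phi> (rep (\<xi> j)) powr p) \<le> 1" using z by simp
    from bound[OF \<xi> this]
    have le: "(\<Sum>i<n. lp_norm p \<phi> (\<lambda>t. \<Sum>j<n. rep (\<pi> (x i j) (\<xi> j)) t) powr p) \<le> C powr p" .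
    have "rep (\<pi> (x i j) (\<xi> j)) (e k) = (\<Sum>l<m. ?L (x i j) (v k l) * z (l, j))"
      if "i < n" "j < n" "k < m" for i j k
    proof -
      have "\<xi> j \<in> carr ?E" using \<xi> that by auto
      then show ?thesis using that by (simp add: \<pi>_def rep_cls \<iota> \<xi>_rep)
    qed
    then have "(\<Sum>i<n. lp_norm p \<phi> (\<lambda>t. \<Sum>j<n. rep (\<pi> (x i j) (\<xi> j)) t) powr p)
      = (\<Sum>i<n. \<Sum>k<m. cmod (\<Sum>j<n. \<Sum>l<m. ?L (x i j) (v k l) * z (l, j)) powr p)"
      by (simp add: Lpf)
    also have "\<dots> = (\<Sum>k<m. \<Sum>i<n. cmod (\<Sum>l<m. \<Sum>j<n. ?L (x i j) (v k l) * z (l, j)) powr p)"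
      by (subst sum.swap, subst (2) sum.swap) (rule refl)
    also have "\<dots> = (\<Sum>u\<in>{..<m} \<times> {..<n}. cmod (\<Sum>y\<in>{..<m} \<times> {..<n}.
        (case u of (k, i) \<Rightarrow> \<lambda>(l, j). ?L (x i j) (v k l)) y * z y) powr p)"
      by (simp add: sum.cartesian_product case_prod_unfold)
    finally show "(\<Sum>u\<in>{..<m} \<times> {..<n}. cmod (\<Sum>y\<in>{..<m} \<times> {..<n}.
        (case u of (k, i) \<Rightarrow> \<lambda>(l, j). ?L (x i j) (v k l)) y * z y) powr p) \<le> C powr p"
      using le by simp
  qed (use p0 in auto)
qed

section \<open>Contractive actions of \<open>L\<^sup>1\<close> on \<open>L\<^sup>p\<close>\<close>

text \<open>A linear contraction from \<open>L\<^sup>1\<close> to \<open>\<B>(L\<^sup>p)\<close>, seen as a bilinear map on functions instead of classes.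
  Bilinearity holds almost everywhere only, because \<open>\<beta>\<close> chooses representatives of its values.\<close>

locale L1_action =
  fixes p :: real and M :: "'a measure" and N :: "'b measure"
    and \<beta> :: "('a \<Rightarrow> complex) \<Rightarrow> ('b \<Rightarrow> complex) \<Rightarrow> 'b \<Rightarrow> complex"
  assumes p: "1 \<le> p"
    and mem: "\<And>g \<xi>. g \<in> Lp_functions 1 M \<Longrightarrow> \<xi> \<in> Lp_functions p N \<Longrightarrow> \<beta> g \<xi> \<in> Lp_functions p N"
    and bound: "\<And>g \<xi>. g \<in> Lp_functions 1 M \<Longrightarrow> \<xi> \<in> Lp_functions p N \<Longrightarrow>
        lp_norm p N (\<beta> g \<xi>) \<le> lp_norm 1 M g * lp_norm p N \<xi>"
    and combination_left: "\<And>(R :: nat) g c \<xi>. (\<And>r. r < R \<Longrightarrow> g r \<in> Lp_functions 1 M) \<Longrightarrow> \<xi> \<in> Lp_functions p N \<Longrightarrow>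
        AE t in N. \<beta> (\<lambda>s. \<Sum>r<R. c r * g r s) \<xi> t = (\<Sum>r<R. c r * \<beta> (g r) \<xi> t)"
    and combination_right: "\<And>(m :: nat) g c \<xi>. g \<in> Lp_functions 1 M \<Longrightarrow> (\<And>l. l < m \<Longrightarrow> \<xi> l \<in> Lp_functions p N) \<Longrightarrow>
        AE t in N. \<beta> g (\<lambda>s. \<Sum>l<m. c l * \<xi> l s) t = (\<Sum>l<m. c l * \<beta> g (\<xi> l) t)"
begin

lemma p0: "0 < p" using p by simp

lemma diff_left:
  assumes g: "g \<in> Lp_functions 1 M" "h \<in> Lp_functions 1 M" and \<xi>: "\<xi> \<in> Lp_functions p N"
  shows "AE t in N. \<beta> (\<lambda>s. g s - h s) \<xi> t = \<beta> g \<xi> t - \<beta> h \<xi> t"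
  using combination_left[of 2 "\<lambda>r. if r = 0 then g else h" \<xi> "\<lambda>r. if r = 0 then 1 else -1"] g \<xi>
  by (simp add: numeral_2_eq_2)

lemma diff_right:
  assumes g: "g \<in> Lp_functions 1 M" and \<xi>: "\<xi> \<in> Lp_functions p N" "\<eta> \<in> Lp_functions p N"
  shows "AE t in N. \<beta> g (\<lambda>s. \<xi> s - \<eta> s) t = \<beta> g \<xi> t - \<beta> g \<eta> t"
  using combination_right[of g 2 "\<lambda>r. if r = 0 then \<xi> else \<eta>" "\<lambda>r. if r = 0 then 1 else -1"] g \<xi>
  by (simp add: numeral_2_eq_2)

lemma block_coef_combination_left:
  fixes R :: nat
  assumes g: "\<And>r. r < R \<Longrightarrow> g r \<in> Lp_functions 1 M" and \<xi>: "\<xi> \<in> Lp_functions p N"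
    and A: "A \<in> sets N" "emeasure N A < \<infinity>"
  shows "block_coef p N A (\<beta> (\<lambda>s. \<Sum>r<R. c r * g r s) \<xi>) = (\<Sum>r<R. c r * block_coef p N A (\<beta> (g r) \<xi>))"
proof -
  have m: "\<beta> (\<lambda>s. \<Sum>r<R. c r * g r s) \<xi> \<in> Lp_functions p N"
    "(\<lambda>t. \<Sum>r<R. c r * \<beta> (g r) \<xi> t) \<in> Lp_functions p N"
    using g \<xi> p by (auto intro!: mem Lp_functions_sum Lp_functions_scale)
  have "block_coef p N A (\<beta> (\<lambda>s. \<Sum>r<R. c r * g r s) \<xi>) = block_coef p N A (\<lambda>t. \<Sum>r<R. c r * \<beta> (g r) \<xi> t)"
    by (rule block_coef_cong_AE[OF m[THEN Lp_functions_measurable] combination_left[of R g \<xi> c, OF g \<xi>] A(1)])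
  also have "\<dots> = (\<Sum>r<R. c r * block_coef p N A (\<beta> (g r) \<xi>))"
    using g \<xi> by (intro block_coef_sum[OF p A] mem) auto
  finally show ?thesis .
qed

lemma block_coef_combination_right:
  fixes m :: nat
  assumes g: "g \<in> Lp_functions 1 M" and \<xi>: "\<And>l. l < m \<Longrightarrow> \<xi> l \<in> Lp_functions p N"
    and A: "A \<in> sets N" "emeasure N A < \<infinity>"
  shows "block_coef p N A (\<beta> g (\<lambda>s. \<Sum>l<m. c l * \<xi> l s)) = (\<Sum>l<m. c l * block_coef p N A (\<beta> g (\<xi> l)))"
proof -
  have m: "\<beta> g (\<lambda>s. \<Sum>l<m. c l * \<xi> l s) \<in> Lp_functions p N"
    "(\<lambda>t. \<Sum>l<m. c l * \<beta> g (\<xi> l) t) \<in> Lp_functions p N"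
    using g \<xi> p by (auto intro!: mem Lp_functions_sum Lp_functions_scale)
  have "block_coef p N A (\<beta> g (\<lambda>s. \<Sum>l<m. c l * \<xi> l s)) = block_coef p N A (\<lambda>t. \<Sum>l<m. c l * \<beta> g (\<xi> l) t)"
    by (rule block_coef_cong_AE[OF m[THEN Lp_functions_measurable] combination_right[of g m \<xi> c, OF g \<xi>] A(1)])
  also have "\<dots> = (\<Sum>l<m. c l * block_coef p N A (\<beta> g (\<xi> l)))"
    using g \<xi> by (intro block_coef_sum[OF p A] mem) auto
  finally show ?thesis .
qed

text \<open>The operator \<open>\<xi> \<mapsto> \<beta> g \<xi>\<close> is a contraction, and so are the inclusion of \<open>\<ell>\<^sup>p(m)\<close> in \<open>L\<^sup>p\<close> and the coordinate
  map back, between which it is compressed.\<close>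

lemma compression_contraction:
  assumes A: "finite_blocks N m A" and g: "g \<in> Lp_functions 1 M" "lp_norm 1 M g \<le> 1"
  shows "lp_bounded p {..<m} {..<m} (\<lambda>k l. block_coef p N (A k) (\<beta> g (block_vec p N (A l)))) 1"
  unfolding lp_bounded_def
proof
  fix z :: "nat \<Rightarrow> complex"
  define \<xi> where "\<xi> = (\<lambda>s. \<Sum>l<m. z l * block_vec p N (A l) s)"
  have vec: "block_vec p N (A l) \<in> Lp_functions p N" if "l < m" for l
    using lp_norm_block_vec(1)[OF p0] finite_blocksD[OF A that] by blast
  have \<xi>: "\<xi> \<in> Lp_functions p N" "lp_norm p N \<xi> powr p \<le> (\<Sum>l<m. cmod (z l) powr p)"
    using block_vec_combination[OF p0 A, of z] p0 by (simp_all add: \<xi>_def lp_norm_powr)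
  have "(\<Sum>k<m. cmod (\<Sum>l<m. block_coef p N (A k) (\<beta> g (block_vec p N (A l))) * z l) powr p)
      = (\<Sum>k<m. cmod (block_coef p N (A k) (\<beta> g \<xi>)) powr p)"
    unfolding \<xi>_def
    using block_coef_combination_right[where \<xi> = "\<lambda>l. block_vec p N (A l)", OF g(1) vec finite_blocksD(1,2)[OF A], of m _ z]
    by (intro sum.cong refl) (simp add: mult.commute)
  also have "\<dots> \<le> lp_norm p N (\<beta> g \<xi>) powr p"
    unfolding lp_norm_powr[OF p0] by (rule block_coef_contraction[OF p A mem[OF g(1) \<xi>(1)]])
  also have "\<dots> \<le> lp_norm p N \<xi> powr p"
  proof (rule powr_mono2)
    show "lp_norm p N (\<beta> g \<xi>) \<le> lp_norm p N \<xi>"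
      using bound[OF g(1) \<xi>(1)] mult_right_mono[OF g(2), of "lp_norm p N \<xi>"] by simp
  qed (use p in auto)
  also note \<xi>(2)
  finally show "(\<Sum>k<m. cmod (\<Sum>l<m. block_coef p N (A k) (\<beta> g (block_vec p N (A l))) * z l) powr p)
      \<le> 1 powr p * (\<Sum>l<m. cmod (z l) powr p)" by simp
qed

text \<open>The passage from \<open>\<beta>\<close> to step functions. The hypothesis \<open>step\<close> is the dual norm bound for the
  matrix-valued step functions \<open>\<Sum>\<^sub>r D\<^sub>r 1\<^bsub>B\<^sub>r\<^esub>\<close>. Applied to the compressions \<open>D\<^sub>r\<close> of \<open>\<beta>\<close> at the normalised
  indicator functions of the sets \<open>B\<^sub>r\<close>, it bounds the compression of \<open>\<beta>\<close> at the averages of the functions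
  \<open>x i j\<close>, which are as close to \<open>x i j\<close> in \<open>L\<^sup>1\<close> as desired.\<close>

lemma compression_bounded:
  fixes n :: nat
  assumes A: "finite_blocks N m A"
    and x: "\<And>i j. i < n \<Longrightarrow> j < n \<Longrightarrow> x i j \<in> Lp_functions 1 M"
    and step: "\<And>R B D. finite_blocks M R B \<Longrightarrow> (\<And>r. r < R \<Longrightarrow> lp_bounded p {..<m} {..<m} (D r) 1) \<Longrightarrow>
       lp_bounded p ({..<m} \<times> {..<n}) ({..<m} \<times> {..<n})
         (\<lambda>(k, i) (l, j). \<Sum>r<R. D r k l * (\<integral>t. x i j t * indicator (B r) t \<partial>M)) C"
  shows "lp_bounded p ({..<m} \<times> {..<n}) ({..<m} \<times> {..<n})
     (\<lambda>(k, i) (l, j). block_coef p N (A k) (\<beta> (x i j) (block_vec p N (A l)))) C"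
proof (rule lp_bounded_approx)
  fix e :: real assume e: "0 < e"
  have fin: "finite ({..<n} \<times> {..<n})" by simp
  have x': "(case s of (i, j) \<Rightarrow> x i j) \<in> Lp_functions 1 M" if "s \<in> {..<n} \<times> {..<n}" for s
    using that x by auto
  obtain R B where B: "finite_blocks M R B"
    and approx0: "\<And>s. s \<in> {..<n} \<times> {..<n} \<Longrightarrow>
      lp_norm 1 M (\<lambda>t. (case s of (i, j) \<Rightarrow> x i j) t - block_average 1 M R B (case s of (i, j) \<Rightarrow> x i j) t) \<le> e"
    using block_average_approximation[where f = "\<lambda>s. case s of (i, j) \<Rightarrow> x i j", OF order_refl fin x' e] by metis
  have approx: "lp_norm 1 M (\<lambda>t. x i j t - block_average 1 M R B (x i j) t) \<le> e" if "i < n" "j < n" for i j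
    using approx0[of "(i, j)"] that by simp
  define D where "D r k l = block_coef p N (A k) (\<beta> (block_vec 1 M (B r)) (block_vec p N (A l)))" for r k l
  have vecB: "block_vec 1 M (B r) \<in> Lp_functions 1 M" "lp_norm 1 M (block_vec 1 M (B r)) \<le> 1" if "r < R" for r
    using lp_norm_block_vec[of 1 "B r" M] finite_blocksD[OF B that] by auto
  have vecA: "block_vec p N (A l) \<in> Lp_functions p N" "lp_norm p N (block_vec p N (A l)) \<le> 1" if "l < m" for l
    using lp_norm_block_vec[OF p0, of "A l" N] finite_blocksD[OF A that] by auto
  have avg: "block_average 1 M R B f \<in> Lp_functions 1 M" for f
    using block_average_in_Lp[OF _ B, of 1] by simp
  have "lp_bounded p {..<m} {..<m} (D r) 1" if "r < R" for r
    unfolding D_def by (rule compression_contraction[OF A vecB[OF that]])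
  from step[OF B this]
  have bounded: "lp_bounded p ({..<m} \<times> {..<n}) ({..<m} \<times> {..<n})
         (\<lambda>(k, i) (l, j). \<Sum>r<R. D r k l * (\<integral>t. x i j t * indicator (B r) t \<partial>M)) C" .
  have "cmod (block_coef p N (A k) (\<beta> (x i j) (block_vec p N (A l)))
      - (\<Sum>r<R. D r k l * (\<integral>t. x i j t * indicator (B r) t \<partial>M))) \<le> e"
    if ij: "i < n" "j < n" and kl: "k < m" "l < m" for i j k l
  proof -
    note Ak = finite_blocksD(1,2)[OF A kl(1)] and v = vecA[OF kl(2)] and xij = x[OF ij]
    let ?y = "block_average 1 M R B (x i j)" and ?v = "block_vec p N (A l)"
    have "(\<Sum>r<R. D r k l * (\<integral>t. x i j t * indicator (B r) t \<partial>M))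
        = (\<Sum>r<R. block_coef 1 M (B r) (x i j) * block_coef p N (A k) (\<beta> (block_vec 1 M (B r)) ?v))"
      by (intro sum.cong refl) (simp add: D_def block_coef_1 finite_blocksD[OF B] mult.commute)
    also have "\<dots> = block_coef p N (A k) (\<beta> ?y ?v)"
      unfolding block_average_def by (rule block_coef_combination_left[where g = "\<lambda>r. block_vec 1 M (B r)", OF vecB(1) v(1) Ak, symmetric])
    finally have b: "(\<Sum>r<R. D r k l * (\<integral>t. x i j t * indicator (B r) t \<partial>M)) = block_coef p N (A k) (\<beta> ?y ?v)" .
    have d: "(\<lambda>t. x i j t - ?y t) \<in> Lp_functions 1 M" using xij avg by (intro Lp_functions_diff) auto
    have "block_coef p N (A k) (\<beta> (\<lambda>t. x i j t - ?y t) ?v)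
        = block_coef p N (A k) (\<lambda>t. \<beta> (x i j) ?v t - \<beta> ?y ?v t)"
    proof (rule block_coef_cong_AE)
      show "(\<lambda>t. \<beta> (x i j) ?v t - \<beta> ?y ?v t) \<in> borel_measurable N"
        using mem[OF xij v(1)] mem[OF avg v(1)] by (intro borel_measurable_diff Lp_functions_measurable)
      show "\<beta> (\<lambda>t. x i j t - ?y t) ?v \<in> borel_measurable N"
        using mem[OF d v(1)] by (rule Lp_functions_measurable)
    qed (use diff_left[OF xij avg v(1)] Ak in auto)
    also have "\<dots> = block_coef p N (A k) (\<beta> (x i j) ?v) - block_coef p N (A k) (\<beta> ?y ?v)"
      using block_coef_sum[OF p Ak, of "{True, False}" "\<lambda>i'. if i' then \<beta> (x i j) ?v else \<beta> ?y ?v" "\<lambda>i. if i then 1 else - 1"]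
        mem[OF xij v(1)] mem[OF avg v(1)] by simp
    finally have "cmod (block_coef p N (A k) (\<beta> (x i j) ?v) - block_coef p N (A k) (\<beta> ?y ?v))
      = cmod (block_coef p N (A k) (\<beta> (\<lambda>t. x i j t - ?y t) ?v))" by simp
    also have "\<dots> \<le> lp_norm p N (\<beta> (\<lambda>t. x i j t - ?y t) ?v)"
      by (rule block_coef_le_lp_norm[OF p A mem[OF d v(1)] kl(1)])
    also have "\<dots> \<le> lp_norm 1 M (\<lambda>t. x i j t - ?y t) * lp_norm p N ?v" by (rule bound[OF d v(1)])
    also have "\<dots> \<le> e * 1" using approx[OF ij] v(2) e by (intro mult_mono) auto
    finally show ?thesis by (simp add: b)
  qed
  then show "\<exists>b. (\<forall>u\<in>{..<m} \<times> {..<n}. \<forall>w\<in>{..<m} \<times> {..<n}.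
       cmod ((case u of (k, i) \<Rightarrow> \<lambda>(l, j). block_coef p N (A k) (\<beta> (x i j) (block_vec p N (A l)))) w - b u w) \<le> e) \<and>
       lp_bounded p ({..<m} \<times> {..<n}) ({..<m} \<times> {..<n}) b C"
    using bounded by (intro exI[of _ "\<lambda>(k, i) (l, j). \<Sum>r<R. D r k l * (\<integral>t. x i j t * indicator (B r) t \<partial>M)"]) auto
qed (use p in auto)

text \<open>The blocks are chosen to suit both the vectors \<open>\<xi> j\<close> and their images \<open>\<Sum>\<^sub>j \<beta> (x i j) (\<xi> j)\<close>, so that
  averaging before and after the action of \<open>x\<close> changes little. What remains is the compression of \<open>\<beta>\<close>
  to \<open>\<ell>\<^sup>p(m)\<close>.\<close>

lemma matrix_bound:
  fixes n :: nat
  assumes x: "\<And>i j. i < n \<Longrightarrow> j < n \<Longrightarrow> x i j \<in> Lp_functions 1 M"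
    and \<xi>: "\<And>j. j < n \<Longrightarrow> \<xi> j \<in> Lp_functions p N"
    and step: "\<And>(m :: nat) R B D. 1 \<le> m \<Longrightarrow> finite_blocks M R B \<Longrightarrow> (\<And>r. r < R \<Longrightarrow> lp_bounded p {..<m} {..<m} (D r) 1) \<Longrightarrow>
       lp_bounded p ({..<m} \<times> {..<n}) ({..<m} \<times> {..<n})
         (\<lambda>(k, i) (l, j). \<Sum>r<R. D r k l * (\<integral>t. x i j t * indicator (B r) t \<partial>M)) C"
  shows "(\<Sum>i<n. lp_norm p N (\<lambda>t. \<Sum>j<n. \<beta> (x i j) (\<xi> j) t) powr p)
     \<le> C powr p * (\<Sum>j<n. lp_norm p N (\<xi> j) powr p)"
proof (rule sum_powr_le_by_approximation[where K = "\<lambda>i. 1 + (\<Sum>j<n. lp_norm 1 M (x i j))"])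
  fix e :: real assume e: "0 < e"
  define h where "h i = (\<lambda>t. \<Sum>j<n. \<beta> (x i j) (\<xi> j) t)" for i
  have h: "h i \<in> Lp_functions p N" if "i < n" for i
    unfolding h_def using that x \<xi> p by (intro Lp_functions_sum mem) auto
  have fin: "finite ({..<n} \<times> (UNIV :: bool set))" by simp
  \<comment> \<open>The Boolean tag combines the vectors and their images into one finite family.\<close>
  define f where "f s = (case s of (j, b) \<Rightarrow> if b then \<xi> j else h j)" for s
  have "f s \<in> Lp_functions p N" if "s \<in> {..<n} \<times> UNIV" for s
    using that \<xi> h by (auto simp: f_def)
  then obtain m A where m: "1 \<le> m" and A: "finite_blocks N m A"
    and approx: "\<And>s. s \<in> {..<n} \<times> UNIV \<Longrightarrow> lp_norm p N (\<lambda>t. f s t - block_average p N m A (f s) t) \<le> e"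
    using block_average_approximation[where f = f, OF p fin _ e] by metis
  let ?E = "block_average p N m A"
  have \<xi>_approx: "lp_norm p N (\<lambda>t. \<xi> j t - ?E (\<xi> j) t) \<le> e" if "j < n" for j
    using approx[of "(j, True)"] that by (simp add: f_def)
  have h_approx: "lp_norm p N (\<lambda>t. h i t - ?E (h i) t) \<le> e" if "i < n" for i
    using approx[of "(i, False)"] that by (simp add: f_def)
  have E: "?E g \<in> Lp_functions p N" for g by (rule block_average_in_Lp[OF p A])
  define h' where "h' i = (\<lambda>t. \<Sum>j<n. \<beta> (x i j) (?E (\<xi> j)) t)" for i
  have h': "h' i \<in> Lp_functions p N" if "i < n" for i
    unfolding h'_def using that x E p by (intro Lp_functions_sum mem) auto
  have dist: "lp_norm p N (\<lambda>t. h i t - h' i t) \<le> (\<Sum>j<n. lp_norm 1 M (x i j)) * e" if i: "i < n" for i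
  proof -
    have d: "(\<lambda>t. \<beta> (x i j) (\<xi> j) t - \<beta> (x i j) (?E (\<xi> j)) t) \<in> Lp_functions p N" if "j < n" for j
      using x[OF i that] \<xi>[OF that] E p by (intro Lp_functions_diff mem) auto
    have "lp_norm p N (\<lambda>t. \<Sum>j<n. \<beta> (x i j) (\<xi> j) t - \<beta> (x i j) (?E (\<xi> j)) t)
      \<le> (\<Sum>j<n. lp_norm p N (\<lambda>t. \<beta> (x i j) (\<xi> j) t - \<beta> (x i j) (?E (\<xi> j)) t))"
      using d by (intro lp_norm_sum[OF p]) auto
    also have "\<dots> \<le> (\<Sum>j<n. lp_norm 1 M (x i j) * e)"
    proof (rule sum_mono)
      fix j assume "j \<in> {..<n}"
      then have j: "j < n" by simp
      have \<xi>d: "(\<lambda>s. \<xi> j s - ?E (\<xi> j) s) \<in> Lp_functions p N"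
        using \<xi>[OF j] E p by (intro Lp_functions_diff) auto
      have "lp_norm p N (\<lambda>t. \<beta> (x i j) (\<xi> j) t - \<beta> (x i j) (?E (\<xi> j)) t)
        = lp_norm p N (\<beta> (x i j) (\<lambda>s. \<xi> j s - ?E (\<xi> j) s))"
      proof (rule lp_norm_cong_AE)
        show "AE t in N. \<beta> (x i j) (\<xi> j) t - \<beta> (x i j) (?E (\<xi> j)) t = \<beta> (x i j) (\<lambda>s. \<xi> j s - ?E (\<xi> j) s) t"
          using diff_right[OF x[OF i j] \<xi>[OF j] E[of "\<xi> j"]] by eventually_elim simp
      qed (use d[OF j] mem[OF x[OF i j] \<xi>d] in \<open>auto intro: Lp_functions_measurable\<close>)
      also have "\<dots> \<le> lp_norm 1 M (x i j) * lp_norm p N (\<lambda>s. \<xi> j s - ?E (\<xi> j) s)"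
        by (rule bound[OF x[OF i j] \<xi>d])
      also have "\<dots> \<le> lp_norm 1 M (x i j) * e"
        using \<xi>_approx[OF j] by (intro mult_left_mono) auto
      finally show "lp_norm p N (\<lambda>t. \<beta> (x i j) (\<xi> j) t - \<beta> (x i j) (?E (\<xi> j)) t) \<le> lp_norm 1 M (x i j) * e" .
    qed
    finally show ?thesis by (simp add: h_def h'_def sum_subtractf sum_distrib_right)
  qed
  have close: "lp_norm p N (h i) \<le> lp_norm p N (?E (h' i)) + e * (1 + (\<Sum>j<n. lp_norm 1 M (x i j)))"
    if i: "i < n" for i
  proof -
    have d: "(\<lambda>t. h i t - h' i t) \<in> Lp_functions p N" using h[OF i] h'[OF i] p by (intro Lp_functions_diff) auto
    have "lp_norm p N (h i) \<le> lp_norm p N (?E (h i)) + e"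
      using lp_norm_triangle_le[OF p h[OF i] E, of "h i"] h_approx[OF i] by simp
    also have "lp_norm p N (?E (h i)) \<le> lp_norm p N (?E (h' i)) + lp_norm p N (?E (\<lambda>t. h i t - h' i t))"
      using lp_norm_triangle_le[OF p E E, of "h i" "h' i"]
      by (simp add: block_average_diff[OF p A h[OF i] h'[OF i], abs_def])
    also have "lp_norm p N (?E (\<lambda>t. h i t - h' i t)) \<le> (\<Sum>j<n. lp_norm 1 M (x i j)) * e"
      using lp_norm_block_average[OF p A d] dist[OF i] by simp
    finally show ?thesis by (simp add: algebra_simps)
  qed
  let ?I = "{..<m} \<times> {..<n}"
  let ?a = "\<lambda>(k, i) (l, j). block_coef p N (A k) (\<beta> (x i j) (block_vec p N (A l)))"
  let ?z = "\<lambda>(l, j). block_coef p N (A l) (\<xi> j)"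
  have a: "lp_bounded p ?I ?I ?a C"
    by (rule compression_bounded[OF A]) (erule (1) x, rule step[OF m])
  have coef: "block_coef p N (A k) (h' i) = (\<Sum>w\<in>?I. ?a (k, i) w * ?z w)" if i: "i < n" and k: "k < m" for i k
  proof -
    note Ak = finite_blocksD(1,2)[OF A k]
    have vec: "block_vec p N (A l) \<in> Lp_functions p N" if "l < m" for l
      using lp_norm_block_vec(1)[OF p0] finite_blocksD[OF A that] by blast
    have "block_coef p N (A k) (h' i) = (\<Sum>j<n. block_coef p N (A k) (\<beta> (x i j) (?E (\<xi> j))))"
      using block_coef_sum[OF p Ak, of "{..<n}" "\<lambda>j. \<beta> (x i j) (?E (\<xi> j))" "\<lambda>_. 1"] x i E
      by (simp add: h'_def mem)
    also have "\<dots> = (\<Sum>j<n. \<Sum>l<m. block_coef p N (A l) (\<xi> j) * block_coef p N (A k) (\<beta> (x i j) (block_vec p N (A l))))"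
      unfolding block_average_def
      using x[OF i] by (intro sum.cong refl block_coef_combination_right[where \<xi> = "\<lambda>l. block_vec p N (A l)", OF _ vec Ak]) auto
    also have "\<dots> = (\<Sum>w\<in>?I. ?a (k, i) w * ?z w)"
      by (subst sum.swap) (simp add: sum.cartesian_product case_prod_unfold mult.commute)
    finally show ?thesis .
  qed
  have "(\<Sum>i<n. lp_norm p N (?E (h' i)) powr p) \<le> (\<Sum>i<n. \<Sum>k<m. cmod (block_coef p N (A k) (h' i)) powr p)"
    by (intro sum_mono lp_norm_block_average_powr[OF p A])
  also have "\<dots> = (\<Sum>k<m. \<Sum>i<n. cmod (block_coef p N (A k) (h' i)) powr p)" by (rule sum.swap)
  also have "\<dots> = (\<Sum>k<m. \<Sum>i<n. cmod (\<Sum>w\<in>?I. ?a (k, i) w * ?z w) powr p)"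
    by (intro sum.cong refl) (simp only: coef lessThan_iff)
  also have "\<dots> = (\<Sum>(k, i)\<in>?I. cmod (\<Sum>w\<in>?I. ?a (k, i) w * ?z w) powr p)" by (rule sum.cartesian_product)
  also have "\<dots> = (\<Sum>u\<in>?I. cmod (\<Sum>w\<in>?I. ?a u w * ?z w) powr p)" by (simp only: case_prod_eta split_beta' prod.collapse)
  also have "\<dots> \<le> C powr p * (\<Sum>w\<in>?I. cmod (?z w) powr p)" by (rule lp_boundedD[OF a])
  also have "(\<Sum>w\<in>?I. cmod (?z w) powr p) = (\<Sum>j<n. \<Sum>l<m. cmod (block_coef p N (A l) (\<xi> j)) powr p)"
    by (subst sum.swap) (simp add: sum.cartesian_product case_prod_unfold)
  also have "C powr p * \<dots> \<le> C powr p * (\<Sum>j<n. lp_norm p N (\<xi> j) powr p)"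
    using block_coef_contraction[OF p A \<xi>] by (intro mult_left_mono sum_mono) (auto simp: lp_norm_powr[OF p0])
  finally have "(\<Sum>i<n. lp_norm p N (?E (h' i)) powr p) \<le> C powr p * (\<Sum>j<n. lp_norm p N (\<xi> j) powr p)" .
  then show "\<exists>G. (\<forall>i\<in>{..<n}. 0 \<le> G i \<and> lp_norm p N (\<lambda>t. \<Sum>j<n. \<beta> (x i j) (\<xi> j) t)
        \<le> G i + e * (1 + (\<Sum>j<n. lp_norm 1 M (x i j)))) \<and>
      (\<Sum>i<n. G i powr p) \<le> C powr p * (\<Sum>j<n. lp_norm p N (\<xi> j) powr p)"
    using close by (intro exI[of _ "\<lambda>i. lp_norm p N (?E (h' i))"]) (auto simp: h_def)
qed (use p in auto)

end

section \<open>The maximal norm is at most the dual norm\<close>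

lemma L1_action_of_contraction:
  assumes p: "1 \<le> p" and \<pi>: "linear_contraction (Lp 1 M) (bounded_ops (Lp p N) (Lp p N)) \<pi>"
  shows "L1_action p M N (\<lambda>g \<xi>. rep (\<pi> (function_class_space.cls (Lp_functions 1 M) (\<lambda>P. AE t in M. P t) g)
      (function_class_space.cls (Lp_functions p N) (\<lambda>P. AE t in N. P t) \<xi>)))"
proof -
  interpret G: function_class_space "Lp_functions 1 M" "\<lambda>P. AE t in M. P t" "lp_norm 1 M" "Lp 1 M"
    by (rule function_class_space_Lp) simp
  interpret E: function_class_space "Lp_functions p N" "\<lambda>P. AE t in N. P t" "lp_norm p N" "Lp p N"
    by (rule function_class_space_Lp[OF p])
  let ?B = "bounded_ops (Lp p N) (Lp p N)"
  have lin: "linear_map (Lp 1 M) ?B \<pi>" using \<pi> by (simp add: linear_contraction_def)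
  have op: "\<pi> X \<in> carr ?B" if "X \<in> carr (Lp 1 M)" for X using linear_mapD(1)[OF lin that] .
  have lin_right: "linear_map (Lp p N) (Lp p N) (\<pi> X)" if "X \<in> carr (Lp 1 M)" for X
    using op[OF that] by (simp add: bounded_ops_simps)
  have lin_left: "linear_map (Lp 1 M) (Lp p N) (\<lambda>X. \<pi> X Y)" if Y: "Y \<in> carr (Lp p N)" for Y
    unfolding linear_map_def
    using linear_mapD(2,3)[OF lin] linear_mapD(1)[OF lin_right] Y by (simp add: bounded_ops_simps)
  have norm_op: "vnorm ?B (\<pi> X) \<le> vnorm (Lp 1 M) X" if "X \<in> carr (Lp 1 M)" for X
    using \<pi> that by (simp add: linear_contraction_def)
  have mem: "rep (\<pi> (G.cls g) (E.cls \<xi>)) \<in> Lp_functions p N"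
    if "g \<in> Lp_functions 1 M" "\<xi> \<in> Lp_functions p N" for g \<xi>
    using that by (intro E.rep_carr linear_mapD(1)[OF lin_right] G.cls_carr E.cls_carr)
  have bound: "lp_norm p N (rep (\<pi> (G.cls g) (E.cls \<xi>))) \<le> lp_norm 1 M g * lp_norm p N \<xi>"
    if g: "g \<in> Lp_functions 1 M" and \<xi>: "\<xi> \<in> Lp_functions p N" for g \<xi>
  proof -
    note Gg = G.cls_carr[OF g]
    have unit: "lp_norm p N (rep (\<pi> (G.cls g) Y)) \<le> lp_norm 1 M g"
      if "Y \<in> carr (Lp p N)" "vnorm (Lp p N) Y \<le> 1" for Y
      using bounded_ops_norm_le_iff[OF op[OF Gg], of "vnorm (Lp 1 M) (G.cls g)"] norm_op[OF Gg] that
      by (simp add: vnorm_Lp G.vnorm_cls[OF g, unfolded vnorm_Lp])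
    \<comment> \<open>Testing at all multiples of \<open>\<xi>\<close> in the unit ball also covers \<open>\<parallel>\<xi>\<parallel> = 0\<close>, where \<open>s\<close> is arbitrarily large.\<close>
    have scaled: "s * lp_norm p N (rep (\<pi> (G.cls g) (E.cls \<xi>))) \<le> lp_norm 1 M g"
      if s: "0 \<le> s" "s * lp_norm p N \<xi> \<le> 1" for s
    proof -
      let ?Y = "vscale (Lp p N) (of_real s) (E.cls \<xi>)"
      have Y: "?Y \<in> carr (Lp p N)" using \<xi> by (intro E.vscale_carr E.cls_carr)
      have "vnorm (Lp p N) ?Y = s * lp_norm p N \<xi>"
        using \<xi> s p by (simp add: E.vscale_cls E.vnorm_cls Lp_functions_scale lp_norm_scale)
      then have "lp_norm p N (rep (\<pi> (G.cls g) ?Y)) \<le> lp_norm 1 M g" using unit[OF Y] s by simp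
      moreover have "vnorm (Lp p N) (\<pi> (G.cls g) ?Y) = s * lp_norm p N (rep (\<pi> (G.cls g) (E.cls \<xi>)))"
      proof -
        have "\<pi> (G.cls g) ?Y = vscale (Lp p N) (of_real s) (\<pi> (G.cls g) (E.cls \<xi>))"
          by (rule linear_mapD(3)[OF lin_right[OF Gg] E.cls_carr[OF \<xi>]])
        also have "\<dots> = E.cls (\<lambda>t. of_real s * rep (\<pi> (G.cls g) (E.cls \<xi>)) t)" by (rule E.vscale_eq)
        finally show ?thesis
          using mem[OF g \<xi>] s p by (simp add: E.vnorm_cls Lp_functions_scale lp_norm_scale)
      qed
      ultimately show ?thesis by (simp add: vnorm_Lp)
    qed
    show ?thesis
    proof (cases "lp_norm p N \<xi> = 0")
      case True
      define b where "b = lp_norm p N (rep (\<pi> (G.cls g) (E.cls \<xi>)))"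
      have "s * b \<le> lp_norm 1 M g" if "0 \<le> s" for s using scaled[OF that] True by (simp add: b_def)
      from this[of "(lp_norm 1 M g + 1) / b"] have "b \<le> 0"
        using lp_norm_nonneg[of 1 M g] lp_norm_nonneg[of p N "rep (\<pi> (G.cls g) (E.cls \<xi>))", folded b_def]
        by (cases "b = 0") auto
      then show ?thesis using True by (simp add: b_def)
    next
      case False
      then have "0 < lp_norm p N \<xi>" using lp_norm_nonneg[of p N \<xi>] by linarith
      then show ?thesis using scaled[of "1 / lp_norm p N \<xi>"] by (simp add: divide_le_eq)
    qed
  qed
  have eval: "AE t in N. rep (vsum (Lp p N) (\<lambda>l. vscale (Lp p N) (c l) (Y l)) m) t = (\<Sum>l<m. c l * rep (Y l) t)"
    if "\<And>l. l < m \<Longrightarrow> Y l \<in> carr (Lp p N)" for Y c and m :: nat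
  proof -
    have "vsum (Lp p N) (\<lambda>l. vscale (Lp p N) (c l) (Y l)) m = vsum (Lp p N) (\<lambda>l. E.cls (\<lambda>t. c l * rep (Y l) t)) m"
      by (simp add: E.vscale_eq)
    also have "\<dots> = E.cls (\<lambda>t. \<Sum>l<m. c l * rep (Y l) t)"
      using that by (intro E.vsum_cls Lp_functions_scale E.rep_carr)
    finally show ?thesis
      using E.rep_cls(2)[of "\<lambda>t. \<Sum>l<m. c l * rep (Y l) t"] that
      by (simp add: E.sum_mem Lp_functions_scale E.rep_carr)
  qed
  show ?thesis
  proof (unfold_locales, rule p, erule (1) mem, erule (1) bound)
    fix R :: nat and g c \<xi>
    assume g: "\<And>r. r < R \<Longrightarrow> g r \<in> Lp_functions 1 M" and \<xi>: "\<xi> \<in> Lp_functions p N"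
    note Y = E.cls_carr[OF \<xi>]
    have "AE t in N. rep (vsum (Lp p N) (\<lambda>l. vscale (Lp p N) (c l) (\<pi> (G.cls (g l)) (E.cls \<xi>))) R) t
        = (\<Sum>l<R. c l * rep (\<pi> (G.cls (g l)) (E.cls \<xi>)) t)"
      using g by (intro eval linear_mapD(1)[OF lin_right] G.cls_carr Y) auto
    moreover have "\<pi> (G.cls (\<lambda>s. \<Sum>r<R. c r * g r s)) (E.cls \<xi>)
        = vsum (Lp p N) (\<lambda>l. vscale (Lp p N) (c l) (\<pi> (G.cls (g l)) (E.cls \<xi>))) R"
      by (rule G.linear_map_combination[where f = g, OF lin_left[OF Y] E.vscale_0 g])
    ultimately show "AE t in N. rep (\<pi> (G.cls (\<lambda>s. \<Sum>r<R. c r * g r s)) (E.cls \<xi>)) t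
        = (\<Sum>r<R. c r * rep (\<pi> (G.cls (g r)) (E.cls \<xi>)) t)"
      by simp
  next
    fix m :: nat and g c \<xi>
    assume g: "g \<in> Lp_functions 1 M" and \<xi>: "\<And>l. l < m \<Longrightarrow> \<xi> l \<in> Lp_functions p N"
    note X = G.cls_carr[OF g]
    have "AE t in N. rep (vsum (Lp p N) (\<lambda>l. vscale (Lp p N) (c l) (\<pi> (G.cls g) (E.cls (\<xi> l)))) m) t
        = (\<Sum>l<m. c l * rep (\<pi> (G.cls g) (E.cls (\<xi> l))) t)"
      using \<xi> by (intro eval linear_mapD(1)[OF lin_right[OF X]] E.cls_carr) auto
    moreover have "\<pi> (G.cls g) (E.cls (\<lambda>s. \<Sum>l<m. c l * \<xi> l s))
        = vsum (Lp p N) (\<lambda>l. vscale (Lp p N) (c l) (\<pi> (G.cls g) (E.cls (\<xi> l)))) m"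
      by (rule E.linear_map_combination[where f = \<xi>, OF lin_right[OF X] E.vscale_0 \<xi>])
    ultimately show "AE t in N. rep (\<pi> (G.cls g) (E.cls (\<lambda>s. \<Sum>l<m. c l * \<xi> l s))) t
        = (\<Sum>l<m. c l * rep (\<pi> (G.cls g) (E.cls (\<xi> l))) t)"
      by simp
  qed
qed

lemma step_functions_in_Linf:
  assumes B: "finite_blocks M R B"
  shows "(\<lambda>t. \<Sum>r<R. c r * indicator (B r) t) \<in> Linf_functions M"
proof -
  have "(\<lambda>t. \<Sum>r<R. c r * indicator (B r) t :: complex) \<in> borel_measurable M"
    using finite_blocksD(1)[OF B]
    by (intro borel_measurable_sum borel_measurable_times borel_measurable_const borel_measurable_indicator) auto
  moreover have "cmod (\<Sum>r<R. c r * indicator (B r) t) \<le> (\<Sum>r<R. cmod (c r))" for t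
    by (intro sum_norm_le) (simp add: norm_mult indicator_def)
  ultimately show ?thesis
    unfolding Linf_functions_def by (auto simp del: sum_mult_indicator intro!: exI[of _ "\<Sum>r<R. cmod (c r)"] locally_AE_all)
qed

lemma linf_norm_step_le:
  assumes B: "finite_blocks M R B" and c: "\<And>r. r < R \<Longrightarrow> cmod (c r) \<le> 1"
  shows "linf_norm M (\<lambda>t. \<Sum>r<R. c r * indicator (B r) t) \<le> 1"
proof (rule linf_norm_le)
  have "cmod (\<Sum>r<R. c r * indicator (B r) t) \<le> 1" for t
  proof (cases "\<exists>r<R. t \<in> B r")
    case True
    then obtain r where r: "r < R" "t \<in> B r" by blast
    show ?thesis unfolding finite_blocks_sum[OF B r(2,1)] by (rule c[OF r(1)])
  next
    case False
    then show ?thesis by (subst finite_blocks_sum_outside) auto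
  qed
  then show "locally_AE M (\<lambda>t. cmod (\<Sum>r<R. c r * indicator (B r) t) \<le> 1)" by (rule locally_AE_all)
qed simp

text \<open>Let \<open>\<psi>\<close> be a contractive functional and \<open>c r\<close> its value at the indicator function of \<open>B r\<close>. Testing \<open>\<psi>\<close> at
  \<open>\<Sum>\<^sub>r s\<^sub>r 1\<^bsub>B\<^sub>r\<^esub>\<close> with unimodular \<open>s\<^sub>r\<close> such that \<open>s\<^sub>r c\<^sub>r = |c\<^sub>r|\<close> (or \<open>s\<^sub>r = 0\<close> if \<open>c\<^sub>r = 0\<close>) gives
  \<open>\<Sum>\<^sub>r |c\<^sub>r| \<le> 1\<close>, because by disjointness this function is bounded by 1. So \<open>\<psi>\<close> maps the matrix to a
  subconvex combination of the contractions \<open>D r\<close>.\<close>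

lemma step_matrix_min_norm:
  assumes p: "1 \<le> p" and B: "finite_blocks M R B"
    and D: "\<And>r. r < R \<Longrightarrow> lp_bounded p {..<m} {..<m} (D r) 1"
  shows "mnorm (pmin p (Linf M)) m
     (\<lambda>k l. function_class_space.cls (Linf_functions M) (locally_AE M) (\<lambda>t. \<Sum>r<R. D r k l * indicator (B r) t)) \<le> 1"
proof -
  interpret I: function_class_space "Linf_functions M" "locally_AE M" "linf_norm M" "Linf M"
    by (rule function_class_space_Linf)
  have ind: "indicator (B r) \<in> Linf_functions M" if "r < R" for r
  proof -
    have "(\<lambda>t. \<Sum>s<R. (if s = r then 1 else 0) * indicator (B s) t) = (indicator (B r) :: 'a \<Rightarrow> complex)"
      using that by (simp add: fun_eq_iff if_distrib if_distribR del: sum_mult_indicator cong: if_cong)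
    then show ?thesis using step_functions_in_Linf[OF B, of "\<lambda>s. if s = r then 1 else 0"] by metis
  qed
  show ?thesis
    unfolding pmin_norm_le_1_iff[OF less_le_trans[OF zero_less_one p]]
  proof (intro ballI impI)
    fix \<psi> assume \<psi>: "\<psi> \<in> carr (dual_space (Linf M))"
      and unit: "\<forall>x\<in>carr (Linf M). vnorm (Linf M) x \<le> 1 \<longrightarrow> cmod (\<psi> x) \<le> 1"
    have lin: "linear_map (Linf M) cfield \<psi>" using \<psi> by (simp add: bounded_ops_simps)
    define c where "c r = \<psi> (I.cls (indicator (B r)))" for r
    have eval: "\<psi> (I.cls (\<lambda>t. \<Sum>r<R. a r * indicator (B r) t)) = (\<Sum>r<R. a r * c r)" for a
      using I.linear_map_combination[OF lin _ ind, of R "\<lambda>r. r" a] by (simp add: c_def)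
    have "(\<Sum>r<R. cmod (c r)) \<le> 1"
    proof -
      define s where "s r = cnj (sgn (c r))" for r
      have s: "cmod (s r) \<le> 1" "s r * c r = of_real (cmod (c r))" for r
      proof -
        show "cmod (s r) \<le> 1" by (simp add: s_def norm_sgn)
        show "s r * c r = of_real (cmod (c r))"
        proof (cases "c r = 0")
          case False
          have "s r * c r = (c r * cnj (c r)) / of_real (cmod (c r))" by (simp add: s_def sgn_eq)
          also have "\<dots> = of_real (cmod (c r))"
            using False by (simp add: power2_eq_square flip: complex_norm_square)
          finally show ?thesis .
        qed (simp add: s_def)
      qed
      have "cmod (\<psi> (I.cls (\<lambda>t. \<Sum>r<R. s r * indicator (B r) t))) \<le> 1"
        using unit step_functions_in_Linf[OF B, of s] linf_norm_step_le[OF B s(1)]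
        by (simp add: I.cls_carr I.vnorm_cls del: sum_mult_indicator)
      then have "cmod (of_real (\<Sum>r<R. cmod (c r))) \<le> 1" by (simp add: eval s(2) del: sum_mult_indicator)
      then show ?thesis by (simp add: sum_nonneg del: of_real_sum)
    qed
    then have "lp_bounded p {..<m} {..<m} (\<lambda>k l. \<Sum>r<R. c r * D r k l) 1"
      using D by (intro lp_bounded_subconvex[OF _ p]) auto
    then show "lp_bounded p {..<m} {..<m} (\<lambda>k l. \<psi> (I.cls (\<lambda>t. \<Sum>r<R. D r k l * indicator (B r) t))) 1"
      by (simp add: eval mult.commute del: sum_mult_indicator)
  qed
qed

lemma L1_embedding_step:
  assumes A: "A \<in> carr (Lp 1 M)" and B: "finite_blocks M R B"
  shows "L1_embedding M A (function_class_space.cls (Linf_functions M) (locally_AE M) (\<lambda>t. \<Sum>r<R. c r * indicator (B r) t))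
    = (\<Sum>r<R. c r * (\<integral>t. rep A t * indicator (B r) t \<partial>M))"
proof -
  interpret I: function_class_space "Linf_functions M" "locally_AE M" "linf_norm M" "Linf M"
    by (rule function_class_space_Linf)
  let ?s = "\<lambda>t. \<Sum>r<R. c r * indicator (B r) t"
  note s = step_functions_in_Linf[OF B, of c] and g = L1_rep_integrable[OF A]
  have "L1_embedding M A (I.cls ?s) = (\<integral>t. rep A t * rep (I.cls ?s) t \<partial>M)"
    by (rule L1_embedding_apply[OF I.cls_carr[OF s]])
  also have "\<dots> = (\<integral>t. rep A t * ?s t \<partial>M)"
  proof (rule integral_cong_AE)
    show "AE t in M. rep A t * rep (I.cls ?s) t = rep A t * ?s t"
      using locally_AE_on_integrable_support[OF I.rep_cls(2)[OF s] g] by eventually_elim auto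
    show "(\<lambda>t. rep A t * rep (I.cls ?s) t) \<in> borel_measurable M"
      by (intro borel_measurable_times borel_measurable_integrable[OF g] Linf_functions_measurable[OF I.rep_cls(1)[OF s]])
    show "(\<lambda>t. rep A t * ?s t) \<in> borel_measurable M"
      by (intro borel_measurable_times borel_measurable_integrable[OF g] Linf_functions_measurable[OF s])
  qed
  also have "\<dots> = (\<integral>t. (\<Sum>r<R. c r * (rep A t * indicator (B r) t)) \<partial>M)"
    by (simp add: sum_distrib_left mult.left_commute del: sum_mult_indicator)
  also have "\<dots> = (\<Sum>r<R. c r * (\<integral>t. rep A t * indicator (B r) t \<partial>M))"
    using Lp_functions_integrable_on_finite[of 1 "rep A" M] finite_blocksD[OF B] g
    by (subst Bochner_Integration.integral_sum) (auto simp: L1_functions_iff)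
  finally show ?thesis .
qed

text \<open>The step functions \<open>\<Sum>\<^sub>r D\<^sub>r 1\<^bsub>B\<^sub>r\<^esub>\<close> are matrices over \<open>L\<^sup>\<infinity>(\<mu>)\<close> of minimal norm at most 1, so \<open>dual\<close>
  supplies the bound that \<open>matrix_bound\<close> requires of them.\<close>

lemma max_norm_le_dual_norm:
  fixes \<mu> :: "'a measure"
  assumes p: "1 \<le> p" and C: "0 \<le> C" and x: "x \<in> matrices n (Lp 1 \<mu>)"
    and dual: "\<And>m v. 1 \<le> m \<Longrightarrow> v \<in> matrices m (Linf \<mu>) \<Longrightarrow> mnorm (pmin p (Linf \<mu>)) m v \<le> 1 \<Longrightarrow>
      lp_bounded p ({..<m} \<times> {..<n}) ({..<m} \<times> {..<n}) (\<lambda>(k, i) (l, j). L1_embedding \<mu> (x i j) (v k l)) C"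
  shows "mnorm (pmax TYPE('b) p (Lp 1 \<mu>)) n x \<le> ennreal C"
  unfolding pmax_norm_le_iff[OF p C x]
proof (intro allI impI ballI)
  fix \<phi> :: "'b measure" and \<pi> \<xi>
  assume \<pi>: "linear_contraction (Lp 1 \<mu>) (bounded_ops (Lp p \<phi>) (Lp p \<phi>)) \<pi>"
    and \<xi>: "\<xi> \<in> {..<n} \<rightarrow>\<^sub>E carr (Lp p \<phi>)" and \<xi>1: "(\<Sum>j<n. lp_norm p \<phi> (rep (\<xi> j)) powr p) \<le> 1"
  interpret G: function_class_space "Lp_functions 1 \<mu>" "\<lambda>P. AE t in \<mu>. P t" "lp_norm 1 \<mu>" "Lp 1 \<mu>"
    by (rule function_class_space_Lp) simp
  interpret E: function_class_space "Lp_functions p \<phi>" "\<lambda>P. AE t in \<phi>. P t" "lp_norm p \<phi>" "Lp p \<phi>"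
    by (rule function_class_space_Lp[OF p])
  interpret I: function_class_space "Linf_functions \<mu>" "locally_AE \<mu>" "linf_norm \<mu>" "Linf \<mu>"
    by (rule function_class_space_Linf)
  interpret L1_action p \<mu> \<phi> "\<lambda>g \<xi>. rep (\<pi> (G.cls g) (E.cls \<xi>))"
    by (rule L1_action_of_contraction[OF p \<pi>])
  have xc: "x i j \<in> carr (Lp 1 \<mu>)" if "i < n" "j < n" for i j using x that by (simp add: matrices_def)
  have \<xi>c: "\<xi> j \<in> carr (Lp p \<phi>)" if "j < n" for j using \<xi> that by auto
  have "(\<Sum>i<n. lp_norm p \<phi> (\<lambda>t. \<Sum>j<n. rep (\<pi> (x i j) (\<xi> j)) t) powr p)
    = (\<Sum>i<n. lp_norm p \<phi> (\<lambda>t. \<Sum>j<n. rep (\<pi> (G.cls (rep (x i j))) (E.cls (rep (\<xi> j)))) t) powr p)"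
  proof (rule sum.cong[OF refl])
    fix i assume "i \<in> {..<n}"
    then have "(\<Sum>j<n. rep (\<pi> (x i j) (\<xi> j)) t)
        = (\<Sum>j<n. rep (\<pi> (G.cls (rep (x i j))) (E.cls (rep (\<xi> j)))) t)" for t
      by (intro sum.cong refl) (simp add: G.rep_carr(2)[OF xc] E.rep_carr(2)[OF \<xi>c])
    then show "lp_norm p \<phi> (\<lambda>t. \<Sum>j<n. rep (\<pi> (x i j) (\<xi> j)) t) powr p
        = lp_norm p \<phi> (\<lambda>t. \<Sum>j<n. rep (\<pi> (G.cls (rep (x i j))) (E.cls (rep (\<xi> j)))) t) powr p"
      by presburger
  qed
  also have "\<dots> \<le> C powr p * (\<Sum>j<n. lp_norm p \<phi> (rep (\<xi> j)) powr p)"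
  proof (rule matrix_bound)
    fix m R B D
    assume m: "1 \<le> (m :: nat)" and B: "finite_blocks \<mu> R B"
      and D: "\<And>r. r < R \<Longrightarrow> lp_bounded p {..<m} {..<m} (D r) 1"
    let ?v = "\<lambda>k l. I.cls (\<lambda>t. \<Sum>r<R. D r k l * indicator (B r) t)"
    have "?v \<in> matrices m (Linf \<mu>)"
      by (simp only: matrices_def mem_Collect_eq I.cls_carr[OF step_functions_in_Linf[OF B]]) simp
    from dual[OF m this step_matrix_min_norm[OF p B D]]
    have "lp_bounded p ({..<m} \<times> {..<n}) ({..<m} \<times> {..<n}) (\<lambda>(k, i) (l, j). L1_embedding \<mu> (x i j) (?v k l)) C" .
    moreover have "lp_bounded p ({..<m} \<times> {..<n}) ({..<m} \<times> {..<n}) (\<lambda>(k, i) (l, j). L1_embedding \<mu> (x i j) (?v k l)) C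
      \<longleftrightarrow> lp_bounded p ({..<m} \<times> {..<n}) ({..<m} \<times> {..<n})
         (\<lambda>(k, i) (l, j). \<Sum>r<R. D r k l * (\<integral>t. rep (x i j) t * indicator (B r) t \<partial>\<mu>)) C"
      using L1_embedding_step[OF xc B] by (intro lp_bounded_cong) (auto simp del: sum_mult_indicator)
    ultimately show "lp_bounded p ({..<m} \<times> {..<n}) ({..<m} \<times> {..<n})
         (\<lambda>(k, i) (l, j). \<Sum>r<R. D r k l * (\<integral>t. rep (x i j) t * indicator (B r) t \<partial>\<mu>)) C" by simp
  qed (use G.rep_carr(1)[OF xc] E.rep_carr(1)[OF \<xi>c] in auto)
  also have "\<dots> \<le> C powr p" using mult_left_mono[OF \<xi>1, of "C powr p"] by simp
  finally show "(\<Sum>i<n. lp_norm p \<phi> (\<lambda>t. \<Sum>j<n. rep (\<pi> (x i j) (\<xi> j)) t) powr p) \<le> C powr p" .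
qed

lemma ennreal_eq_by_upper_bounds:
  fixes a b :: ennreal
  assumes "\<And>C. 0 \<le> C \<Longrightarrow> a \<le> ennreal C \<longleftrightarrow> b \<le> ennreal C"
  shows "a = b"
proof (rule antisym)
  show "a \<le> b"
    using assms[of "enn2real b"] by (cases b) auto
  show "b \<le> a"
    using assms[of "enn2real a"] by (cases a) auto
qed

lemma dual_norm_eq_max_norm:
  fixes \<mu> :: "'a measure"
  assumes p: "1 \<le> p" and inf: "infinite (UNIV :: 'b set)" and x: "x \<in> matrices n (Lp 1 \<mu>)"
  shows "mnorm (pdual p (pmin p (Linf \<mu>))) n (amplify (L1_embedding \<mu>) x)
    = mnorm (pmax TYPE('b) p (Lp 1 \<mu>)) n x"
proof (rule ennreal_eq_by_upper_bounds)
  fix C :: real assume C: "0 \<le> C"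
  have p0: "0 < p" using p by simp
  have carr: "matrices m (pmin p (Linf \<mu>)) = matrices m (Linf \<mu>)" for m
    by (simp add: matrices_def pmin_def)
  show "mnorm (pdual p (pmin p (Linf \<mu>))) n (amplify (L1_embedding \<mu>) x) \<le> ennreal C
      \<longleftrightarrow> mnorm (pmax TYPE('b) p (Lp 1 \<mu>)) n x \<le> ennreal C"
    unfolding pdual_norm_le_iff[OF p0 C] carr amplify_def
    using dual_norm_le_max_norm[OF p inf C x] max_norm_le_dual_norm[OF p C x, where ?'b = 'b] by blast
qed

theorem theorem2p5:
  fixes p :: real and \<mu> :: "'a measure"
  assumes "1 < p"
    and "decomposable \<mu>"
    and "infinite (UNIV :: 'b set)"
  shows "(\<forall>n\<ge>1. \<forall>x\<in>matrices n (Lp 1 \<mu>).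
            mnorm (subspace_structure (Lp 1 \<mu>) (L1_embedding \<mu>) (pdual p (pmin p (Linf \<mu>)))) n x
            = mnorm (pmax TYPE('b) p (Lp 1 \<mu>)) n x)
       \<and> complete_isometry (pmax TYPE('b) p (Lp 1 \<mu>)) (pdual p (pmin p (Linf \<mu>)))
            (L1_embedding \<mu>)"
proof -
  have eq: "mnorm (pdual p (pmin p (Linf \<mu>))) n (amplify (L1_embedding \<mu>) x)
    = mnorm (pmax TYPE('b) p (Lp 1 \<mu>)) n x" if "x \<in> matrices n (Lp 1 \<mu>)" for n x
    using dual_norm_eq_max_norm[OF _ assms(3) that] assms(1) by simp
  have "linear_map (pmax TYPE('b) p (Lp 1 \<mu>)) (pdual p (pmin p (Linf \<mu>))) (L1_embedding \<mu>)"
    using L1_embedding_linear[of \<mu>] by (simp add: linear_map_def pmax_def pdual_def pmin_def bounded_ops_def op_norm_def)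
  moreover have "matrices n (pmax TYPE('b) p (Lp 1 \<mu>)) = matrices n (Lp 1 \<mu>)" for n
    by (simp add: matrices_def pmax_def)
  ultimately show ?thesis
    using eq by (simp add: complete_isometry_def subspace_structure_def)
qed

end
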